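(* Let $d\ge1$ be an integer, $p$ a prime, $f:(\mathbb Z/p\mathbb Z)^d\to\mathbb C$ any function and $\theta_f(\tau)=\sum_{x\in\mathbb Z^d} f(x[p])\,e^{2\pi iQ(x,x)\tau}$ ($\tau\in\mathcal H$). (1) If $p=2$, then $\theta_f$ is a cusp form (of weight $\frac d2$ under $\Gamma_2$) if and only if $\sum_{x\in X_{2,d}(a)}f(x)=0$ for every $a\in\mathbb Z/4\mathbb Z$, $f(1,\dots,1)=0$ and $f(0,\dots,0)=0$. (2) If $p$ is odd, then $\theta_f$ is a cusp form (of weight $\frac d2$ under $\Gamma_p$) if and only if $\sum_{x\in X_{p,d}(a)}f(x)=0$ for every $a\in\mathbb Z/p\mathbb Z$ and $f(0,\dots,0)=0$.
   Context: $\mathcal H$ is the upper half-plane, $Q(x,x)=x_1^2+\dots+x_d^2$, $x[p]$ is reduction mod $p$. For odd $p$ and $a\in\mathbb Z/p\mathbb Z$, $X_{p,d}(a)=\{x\in(\mathbb Z/p\mathbb Z)^d:x_1^2+\dots+x_d^2=a\}$. For $a\in\mathbb Z/4\mathbb Z$, $X_{2,d}(a)$ is the set of $x\in(\mathbb Z/2\mathbb Z)^d$ such that $y_1^2+\dots+y_d^2\equiv a\pmod 4$ for an (equivalently any) integer lift $y$ of $x$. $\Gamma_2=\{g\in SL_2(\mathbb Z): a\equiv e\equiv1 \ (4),\ c\equiv0\ (16)\}$ and, for odd $p$, $\Gamma_p=\{g\in SL_2(\mathbb Z): a\equiv e\equiv1\ (4p),\ c\equiv 0\ (4p^2)\}$,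 where $g=\begin{pmatrix}a&b\\c&e\end{pmatrix}$; $\theta_f$ is a modular form of weight $d/2$ under these groups. Cusp form: a modular form $\psi$ of weight $k=d/2$ such that for every $\gamma=\begin{pmatrix}a&b\\c&e\end{pmatrix}\in SL_2(\mathbb Z)$, $(\sqrt{c\tau+e})^{-2k}\psi(\gamma\cdot\tau)\to0$ as $\operatorname{Im}\tau\to\infty$ (principal branch square roots). *)

theory Defs
  imports "HOL-Analysis.Analysis" "HOL-Number_Theory.Number_Theory"
begin

text \<open>
  The ring of integers modulo \<open>p\<close> is represented by the residues \<open>{0..<int p}\<close>, and a function on
  its \<open>d\<close>-fold power by a function on \<open>int ^ 'n\<close>, with \<open>d = CARD('n)\<close>, of which
  only the values on \<open>residue_vectors p\<close> are ever used.
\<close>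

definition residue_vectors :: "nat \<Rightarrow> (int ^ 'n) set" where
  "residue_vectors p = {x. \<forall>i. x $ i \<in> {0..<int p}}"

definition reduce :: "nat \<Rightarrow> int ^ 'n \<Rightarrow> int ^ 'n" where
  "reduce p x = (\<chi> i. x $ i mod int p)"

definition Q :: "int ^ 'n \<Rightarrow> int" where
  "Q x = (\<Sum>i\<in>UNIV. (x $ i)\<^sup>2)"

definition X_odd :: "nat \<Rightarrow> int \<Rightarrow> (int ^ 'n) set" where
  "X_odd p a = {x \<in> residue_vectors p. [Q x = a] (mod int p)}"

definition X_two :: "int \<Rightarrow> (int ^ 'n) set" where
  "X_two a = {x \<in> residue_vectors 2. \<exists>y. reduce 2 y = x \<and> [Q y = a] (mod 4)}"

definition theta :: "nat \<Rightarrow> (int ^ 'n \<Rightarrow> complex) \<Rightarrow> complex \<Rightarrow> complex" where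
  "theta p f \<tau> =
     (\<Sum>\<^sub>\<infinity>x\<in>UNIV. f (reduce p x) * exp (2 * of_real pi * \<i> * of_int (Q x) * \<tau>))"

definition upper_half_plane :: "complex set" where
  "upper_half_plane = {\<tau>. Im \<tau> > 0}"

definition SL2Z :: "(int ^ 2 ^ 2) set" where
  "SL2Z = {g. det g = 1}"

definition act :: "int ^ 2 ^ 2 \<Rightarrow> complex \<Rightarrow> complex" where
  "act g = moebius (of_int (g $ 1 $ 1)) (of_int (g $ 1 $ 2)) (of_int (g $ 2 $ 1)) (of_int (g $ 2 $ 2))"

definition root_factor :: "int ^ 2 ^ 2 \<Rightarrow> complex \<Rightarrow> complex" where
  "root_factor g \<tau> = csqrt (of_int (g $ 2 $ 1) * \<tau> + of_int (g $ 2 $ 2))"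

text \<open>
  The quadratic residue symbol for odd \<open>e\<close> of either sign, in Shimura's normalization: the Jacobi
  symbol of \<open>c\<close> over the absolute value of \<open>e\<close>, with an extra sign if both \<open>c\<close> and \<open>e\<close> are
  negative; its value is 1 for \<open>c = 0\<close>, \<open>e = 1\<close>.
\<close>

definition quadratic_symbol :: "int \<Rightarrow> int \<Rightarrow> int" where
  "quadratic_symbol c e =
     (if c < 0 \<and> e < 0 then -1 else 1) *
     (\<Prod>q\<in>prime_factors e. Legendre c q ^ multiplicity q e)"

text \<open>
  Modular forms of weight \<open>m/2\<close> for a group \<open>\<Gamma>\<close> of matrices with \<open>c \<equiv> 0\<close> and \<open>e \<equiv> 1\<close> modulo 4.
  On such matrices the symbol times the principal square root of \<open>c\<tau> + e\<close> is the usual automorphy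
  factor of weight 1/2: Shimura's additional factor, depending only on \<open>e\<close> modulo 4, equals 1 there.
  For even \<open>m\<close> the law reads \<open>\<psi>(\<gamma>\<tau>) = (c\<tau> + e)^(m/2) \<psi>(\<tau>)\<close>.
  The last clause is holomorphy at all cusps.
\<close>

definition modular_form :: "nat \<Rightarrow> (int ^ 2 ^ 2) set \<Rightarrow> (complex \<Rightarrow> complex) \<Rightarrow> bool" where
  "modular_form m \<Gamma> \<psi> \<longleftrightarrow>
     \<psi> holomorphic_on upper_half_plane \<and>
     (\<forall>g\<in>\<Gamma>. \<forall>\<tau>\<in>upper_half_plane.
        \<psi> (act g \<tau>) =
          (of_int (quadratic_symbol (g $ 2 $ 1) (g $ 2 $ 2)) * root_factor g \<tau>) ^ m * \<psi> \<tau>) \<and>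
     (\<forall>g\<in>SL2Z. Bfun (\<lambda>\<tau>. inverse (root_factor g \<tau> ^ m) * \<psi> (act g \<tau>)) (filtercomap Im at_top))"

definition cusp_form :: "nat \<Rightarrow> (int ^ 2 ^ 2) set \<Rightarrow> (complex \<Rightarrow> complex) \<Rightarrow> bool" where
  "cusp_form m \<Gamma> \<psi> \<longleftrightarrow>
     modular_form m \<Gamma> \<psi> \<and>
     (\<forall>g\<in>SL2Z. ((\<lambda>\<tau>. inverse (root_factor g \<tau> ^ m) * \<psi> (act g \<tau>)) \<longlongrightarrow> 0) (filtercomap Im at_top))"

definition Gamma_two :: "(int ^ 2 ^ 2) set" where
  "Gamma_two = {g \<in> SL2Z. [g $ 1 $ 1 = 1] (mod 4) \<and> [g $ 2 $ 2 = 1] (mod 4) \<and>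
                          [g $ 2 $ 1 = 0] (mod 16)}"

definition Gamma_odd :: "nat \<Rightarrow> (int ^ 2 ^ 2) set" where
  "Gamma_odd p = {g \<in> SL2Z. [g $ 1 $ 1 = 1] (mod 4 * int p) \<and> [g $ 2 $ 2 = 1] (mod 4 * int p) \<and>
                            [g $ 2 $ 1 = 0] (mod 4 * (int p)\<^sup>2)}"

end

theory Submission
  imports Defs "HOL-Complex_Analysis.Complex_Analysis"
    "HOL-Probability.Characteristic_Functions" "HOL-Real_Asymp.Real_Asymp"
begin

text \<open>
  Write \<open>e(x) = exp (2 \<pi> \<i> x)\<close>. Splitting \<open>\<int>\<^sup>d\<close> into residue classes modulo \<open>p\<close> turns \<open>\<theta>\<^sub>f\<close> into the
  finite sum over \<open>r\<close> of \<open>f(r)\<close> times the product of the one-dimensional series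
  \<open>\<Theta>\<^sub>h(\<tau>) = \<Sum> e(n\<^sup>2 \<tau>)\<close>, \<open>n \<equiv> h (mod p)\<close>, at \<open>h = r\<^sub>i\<close>.

  Since \<open>\<Theta>\<^sub>h = \<Theta>\<^sub>-\<^sub>h\<close>, each \<open>\<Theta>\<^sub>h\<close> is a combination of the translates \<open>\<theta>(\<tau> + j/p)\<close> of the classical theta
  series, which inherit the transformation law of \<open>\<theta>\<close>. The latter follows from Poisson summation
  by a Euclidean descent on the bottom row \<open>(c, e)\<close>, where quadratic reciprocity supplies the
  invariance of the quadratic symbol under \<open>e \<mapsto> e + c\<close>.

  Poisson summation also shows that the normalised limit of \<open>\<Theta>\<^sub>h\<close> at the cusp \<open>a/c\<close> is, up to a non-zero
  factor that does not depend on \<open>h\<close>, the Gauss sum \<open>g(h) = \<Sum> e(a x\<^sup>2 / c)\<close> over \<open>x\<close> modulo \<open>p c\<close> with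
  \<open>x \<equiv> h (mod p)\<close>. So \<open>\<theta>\<^sub>f\<close> is a cusp form if and only if \<open>f(0) = 0\<close> and \<open>\<Sum> f(r) \<Prod> g(r\<^sub>i) = 0\<close> for all
  \<open>a/c\<close>. Translating \<open>x\<close> by divisors of \<open>c\<close> shows that \<open>g(h)\<close> is proportional to some \<open>e(u h\<^sup>2 / q)\<close>, with
  \<open>q = p\<close> for odd \<open>p\<close> and \<open>q = 4\<close> for \<open>p = 2\<close>, if \<open>c\<close> has few factors \<open>p\<close>, and is concentrated on one
  residue otherwise; the first case is equivalent to the vanishing of the sums over the sets \<open>X\<close> by
  Fourier inversion modulo \<open>q\<close>, the second one involves only \<open>f(0)\<close> and, for \<open>p = 2\<close> and \<open>c\<close> exactly
  divisible by 8, \<open>f(1, \<dots>, 1)\<close>.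
\<close>

section \<open>The Jacobi symbol\<close>

text \<open>This is \<open>quadratic_symbol\<close> without its extra sign: for odd
  \<open>e\<close>, the Jacobi symbol over the absolute value of \<open>e\<close>. Multiplicativity
  and reciprocity are proved for it first.\<close>

definition jacobi :: "int \<Rightarrow> int \<Rightarrow> int" where
  "jacobi c e = (\<Prod>q\<in>prime_factors e. Legendre c q ^ multiplicity q e)"

text \<open>Over the multiset of prime factors, multiplicativity in the denominator becomes
  additivity of factorizations.\<close>

lemma jacobi_prod_mset:
  "jacobi c e = prod_mset (image_mset (Legendre c) (prime_factorization e))"
  unfolding jacobi_def image_prod_mset_multiplicity
  by (intro prod.cong refl) (auto simp: count_prime_factorization_prime in_prime_factors_iff)

lemma jacobi_1_right [simp]: "jacobi c 1 = 1"
  by (simp add: jacobi_def)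

lemma jacobi_minus_right [simp]: "jacobi c (- e) = jacobi c e"
proof -
  have "prime_factorization (- e) = prime_factorization e"
    by (metis prime_factorization_normalize normalize_int_def abs_minus_cancel)
  then show ?thesis by (simp add: jacobi_prod_mset)
qed

lemma jacobi_abs_right [simp]: "jacobi c \<bar>e\<bar> = jacobi c e"
  by (simp add: abs_if)

lemma jacobi_mult_right: "e \<noteq> 0 \<Longrightarrow> f \<noteq> 0 \<Longrightarrow> jacobi c (e * f) = jacobi c e * jacobi c f"
  by (simp add: jacobi_prod_mset prime_factorization_mult)

lemma jacobi_prime: "prime q \<Longrightarrow> jacobi c q = Legendre c q"
  by (simp add: jacobi_prod_mset prime_factorization_prime)

text \<open>Coprimality excludes the value 0, so every Legendre factor is 1 or -1.\<close>

lemma jacobi_square_eq_1: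
  assumes "coprime c e" "e \<noteq> 0"
  shows "jacobi c e * jacobi c e = 1"
proof -
  have "(Legendre c q)\<^sup>2 = 1" if "q \<in> prime_factors e" for q
  proof -
    have "prime q" "q dvd e" using that by auto
    then have "\<not> q dvd c" using assms(1) by (meson coprime_common_divisor not_prime_unit)
    then show ?thesis by (auto simp: Legendre_def cong_0_iff)
  qed
  then have "(jacobi c e)\<^sup>2 = 1"
    unfolding jacobi_def prod_power_distrib
    by (intro prod.neutral) (metis (no_types, lifting) mult.commute power_mult power_one)
  then show ?thesis by (simp add: power2_eq_square)
qed

lemma Legendre_cong: "[c = c'] (mod q) \<Longrightarrow> Legendre c q = Legendre c' q"
proof -
  assume c: "[c = c'] (mod q)"
  have "[x = c] (mod q) \<longleftrightarrow> [x = c'] (mod q)" for x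
    using c by (meson cong_sym cong_trans)
  moreover from this[of 0] have "[c = 0] (mod q) \<longleftrightarrow> [c' = 0] (mod q)"
    by (simp add: cong_sym_eq)
  ultimately show ?thesis unfolding Legendre_def QuadRes_def by simp
qed

lemma jacobi_cong:
  assumes "[c = c'] (mod e)"
  shows "jacobi c e = jacobi c' e"
  unfolding jacobi_def
proof (intro prod.cong refl)
  fix q assume "q \<in> prime_factors e"
  then have "q dvd e" by auto
  then have "[c = c'] (mod q)" using assms cong_dvd_modulus by blast
  then show "Legendre c q ^ multiplicity q e = Legendre c' q ^ multiplicity q e"
    using Legendre_cong by metis
qed

text \<open>Peeling off one odd prime at a time reduces laws of the Jacobi symbol to laws of the
  Legendre symbol.\<close>

lemma odd_pos_int_induct [consumes 2, case_names one mult]: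
  fixes n :: int
  assumes "odd n" "n > 0" and one: "P 1"
    and mult: "\<And>q x. prime q \<Longrightarrow> odd q \<Longrightarrow> q > 2 \<Longrightarrow> odd x \<Longrightarrow> x > 0 \<Longrightarrow> P x \<Longrightarrow> P (q * x)"
  shows "P n"
proof -
  have "odd n \<longrightarrow> n > 0 \<longrightarrow> P n"
  proof (induction n rule: prime_divisors_induct)
    case zero then show ?case by simp
  next
    case (unit x) then show ?case using one by auto
  next
    case (factor q x)
    have "q > 0" using factor(1) prime_gt_0_int by blast
    show ?case
    proof (intro impI)
      assume o: "odd (q * x)" and p: "q * x > 0"
      have "q \<noteq> 2" "q \<ge> 2" using o factor(1) by (auto simp: prime_ge_2_int)
      moreover have "x > 0" using p \<open>q > 0\<close> by (simp add: zero_less_mult_iff)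
      ultimately show "P (q * x)" using factor o by (intro mult) auto
    qed
  qed
  with assms show ?thesis by blast
qed

section \<open>Multiplicativity and quadratic reciprocity\<close>

lemma Legendre_cases: "Legendre a q \<in> {-1, 0, 1}"
  by (auto simp: Legendre_def)

text \<open>Upgrades congruences from Euler's criterion to equalities: two numbers in {-1, 0, 1}
  differ by at most 2, hence by less than \<open>q\<close>.\<close>

lemma small_int_cong_eq:
  fixes x y :: int
  assumes "[x = y] (mod q)" "q > 2" "\<bar>x\<bar> \<le> 1" "\<bar>y\<bar> \<le> 1"
  shows "x = y"
proof -
  have "q dvd x - y" using assms(1) by (simp add: cong_iff_dvd_diff)
  then show ?thesis using assms zdvd_imp_le[of q "x - y"] zdvd_imp_le[of q "y - x"]
    by (cases "x = y") (smt (verit) dvd_diff_commute)+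
qed

lemma euler_criterion_int:
  fixes q :: int
  assumes "prime q" "q > 2"
  shows "[Legendre a q = a ^ nat ((q - 1) div 2)] (mod q)"
proof -
  have "prime (nat q)" "2 < nat q" using assms by auto
  from euler_criterion[OF this, of a] show ?thesis
    using assms by (simp add: nat_div_distrib nat_diff_distrib)
qed

lemma Legendre_mult:
  fixes q :: int
  assumes "prime q" "q > 2"
  shows "Legendre (a * b) q = Legendre a q * Legendre b q"
proof (rule small_int_cong_eq[OF _ assms(2)])
  note ec = euler_criterion_int[OF assms]
  have "[Legendre a q * Legendre b q = a ^ nat ((q - 1) div 2) * b ^ nat ((q - 1) div 2)] (mod q)"
    by (intro cong_mult ec)
  then show "[Legendre (a * b) q = Legendre a q * Legendre b q] (mod q)"
    using ec[of "a * b"] by (metis cong_sym cong_trans power_mult_distrib)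
  show "\<bar>Legendre (a * b) q\<bar> \<le> 1" "\<bar>Legendre a q * Legendre b q\<bar> \<le> 1"
    using Legendre_cases[of "a*b" q] Legendre_cases[of a q] Legendre_cases[of b q] by auto
qed

lemma minus_one_power_int_half:
  fixes q :: int
  assumes "odd q" "q > 0"
  shows "(-1 :: int) ^ nat ((q - 1) div 2) = (if q mod 4 = 3 then -1 else 1)"
proof -
  from assms obtain k where k: "q = 2 * k + 1" "k \<ge> 0" by (auto elim!: oddE)
  have "q mod 4 = 3 \<longleftrightarrow> odd k" using k by presburger
  moreover have "odd (nat k) \<longleftrightarrow> odd k" using k by (simp add: even_nat_iff)
  ultimately show ?thesis using k by (auto simp: minus_one_power_iff)
qed

lemma jacobi_mult_left:
  fixes n :: int
  assumes "odd n"
  shows "jacobi (a * b) n = jacobi a n * jacobi b n"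
proof -
  have "jacobi (a * b) \<bar>n\<bar> = jacobi a \<bar>n\<bar> * jacobi b \<bar>n\<bar>"
  proof (rule odd_pos_int_induct[of "\<bar>n\<bar>"])
    show "odd \<bar>n\<bar>" "\<bar>n\<bar> > 0" using assms by auto
  qed (auto simp: jacobi_mult_right jacobi_prime Legendre_mult)
  then show ?thesis by simp
qed

lemma odd_mod_4_cases: "odd (n::int) \<Longrightarrow> n mod 4 = 1 \<or> n mod 4 = 3"
  by presburger

text \<open>Being 3 modulo 4 behaves like a parity under products of odd numbers, so the reciprocity
  signs of the prime factors combine to the sign of the product.\<close>

lemma mult_mod_4_eq_3_iff:
  fixes m n :: int
  assumes "odd m" "odd n"
  shows "(m * n) mod 4 = 3 \<longleftrightarrow> (m mod 4 = 3) \<noteq> (n mod 4 = 3)"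
proof -
  have "(m * n) mod 4 = ((m mod 4) * (n mod 4)) mod 4" by (simp add: mod_mult_eq)
  then show ?thesis using odd_mod_4_cases[OF assms(1)] odd_mod_4_cases[OF assms(2)] by auto
qed

lemma Legendre_minus_one:
  fixes q :: int
  assumes "prime q" "q > 2" "odd q"
  shows "Legendre (-1) q = (if q mod 4 = 3 then -1 else 1)"
proof (rule small_int_cong_eq[OF _ assms(2)])
  show "[Legendre (-1) q = (if q mod 4 = 3 then -1 else 1)] (mod q)"
    using euler_criterion_int[OF assms(1,2), of "-1"] minus_one_power_int_half[of q] assms by simp
qed (use Legendre_cases[of "-1" q] in auto)

lemma jacobi_minus_one:
  fixes n :: int
  assumes "odd n" "n > 0"
  shows "jacobi (-1) n = (if n mod 4 = 3 then -1 else 1)"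
  using assms
proof (induction rule: odd_pos_int_induct)
  case (mult q x)
  then show ?case
    by (auto simp: jacobi_mult_right jacobi_prime Legendre_minus_one mult_mod_4_eq_3_iff)
qed auto

text \<open>The product form of reciprocity solved for one symbol: the product is 1 or -1, so both
  symbols are non-zero and equal up to that sign.\<close>

lemma Legendre_reciprocity:
  fixes p q :: int
  assumes "prime p" "p > 2" "prime q" "q > 2" "p \<noteq> q"
  shows "Legendre p q = (if p mod 4 = 3 \<and> q mod 4 = 3 then -1 else 1) * Legendre q p"
proof -
  have odd: "odd p" "odd q" using assms prime_odd_int by auto
  let ?s = "(-1::int) ^ nat ((p - 1) div 2 * ((q - 1) div 2))"
  have "Legendre p q * Legendre q p = ?s"
    using assms by (intro Quadratic_Reciprocity_int) auto
  moreover have "?s = (if p mod 4 = 3 \<and> q mod 4 = 3 then -1 else 1)"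
    using minus_one_power_int_half[of p] minus_one_power_int_half[of q] odd assms
    by (auto simp: nat_mult_distrib power_mult split: if_splits)
  moreover have "Legendre p q \<in> {-1,0,1}" "Legendre q p \<in> {-1,0,1}" by (rule Legendre_cases)+
  ultimately show ?thesis by (auto split: if_splits)
qed

text \<open>First of two inductions on prime factors: the denominator stays prime while the
  numerator is built up.\<close>

lemma jacobi_reciprocity_prime:
  fixes n q :: int
  assumes "odd n" "n > 0" and q: "prime q" "q > 2" "odd q"
  shows "coprime n q \<longrightarrow> jacobi n q = (if n mod 4 = 3 \<and> q mod 4 = 3 then -1 else 1) * jacobi q n"
  using assms(1,2)
proof (induction rule: odd_pos_int_induct)
  case one
  have "Legendre 1 q = 1" using q
      by (auto simp: Legendre_def QuadRes_def cong_0_iff intro: exI[of _ 1])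
  then show ?case using q by (simp add: jacobi_prime)
next
  case (mult r x)
  show ?case
  proof
    assume "coprime (r * x) q"
    then have c: "coprime x q" "coprime r q" by auto
    then have "r \<noteq> q" using q by auto
    then have "jacobi r q = (if r mod 4 = 3 \<and> q mod 4 = 3 then -1 else 1) * jacobi q r"
      using mult q Legendre_reciprocity[of r q] by (simp add: jacobi_prime)
    moreover have "jacobi q (r * x) = jacobi q r * jacobi q x"
      using mult by (intro jacobi_mult_right) auto
    moreover have "jacobi (r * x) q = jacobi r q * jacobi x q"
      using q by (intro jacobi_mult_left)
    ultimately show "jacobi (r * x) q = (if (r * x) mod 4 = 3 \<and> q mod 4 = 3 then -1 else 1)
        * jacobi q (r * x)"
      using mult c by (auto simp: mult_mod_4_eq_3_iff)
  qed
qed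

text \<open>Second induction, now on the denominator \<open>n\<close>, with the prime case supplying
  each factor.\<close>

lemma jacobi_reciprocity:
  fixes m n :: int
  assumes "odd m" "m > 0" "odd n" "n > 0" "coprime m n"
  shows "jacobi m n = (if m mod 4 = 3 \<and> n mod 4 = 3 then -1 else 1) * jacobi n m"
proof -
  have "coprime m n \<longrightarrow> jacobi m n = (if m mod 4 = 3 \<and> n mod 4 = 3 then -1 else 1) * jacobi n m"
    using assms(3,4)
  proof (induction rule: odd_pos_int_induct)
    case one
    \<comment> \<open>\<open>jacobi 1 m\<close> equals its own square, and that square is 1 because
      1 is coprime to \<open>m\<close>.\<close>
    have "jacobi 1 m * jacobi 1 m = jacobi 1 m" using jacobi_mult_left[OF assms(1), of 1 1] by simp
    then show ?case using jacobi_square_eq_1[of 1 m] assms(2) by simp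
  next
    case (mult q x)
    have "jacobi m (q * x) = jacobi m q * jacobi m x"
      using mult by (intro jacobi_mult_right) auto
    moreover have "jacobi (q * x) m = jacobi q m * jacobi x m"
      using assms by (intro jacobi_mult_left)
    ultimately show ?case using jacobi_reciprocity_prime[OF assms(1,2), of q] mult assms
      by (auto simp: mult_mod_4_eq_3_iff)
  qed
  with assms show ?thesis by blast
qed

section \<open>Periodicity of the quadratic symbol in its denominator\<close>

lemma quadratic_symbol_jacobi:
  "quadratic_symbol c e = (if c < 0 \<and> e < 0 then -1 else 1) * jacobi c e"
  by (simp add: quadratic_symbol_def jacobi_def)

lemma jacobi_minus_left:
  assumes "odd n" "n > 0"
  shows "jacobi (- c) n = (if n mod 4 = 3 then -1 else 1) * jacobi c n"
  using jacobi_mult_left[OF assms(1), of "-1" c] jacobi_minus_one[OF assms] by simp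

text \<open>With \<open>n = e + c\<close>, replacing \<open>c\<close> by \<open>- e\<close> modulo \<open>n\<close> and applying reciprocity exchanges the two
  denominators.\<close>

lemma jacobi_add_denominator:
  assumes "odd e" "e > 0" "e + c > 0" "4 dvd c" "coprime c e"
  shows "jacobi c (e + c) = jacobi c e"
proof -
  let ?n = "e + c"
  have n: "odd ?n" "?n mod 4 = e mod 4" using assms by presburger+
  have cop: "coprime e ?n" using assms(5) by (metis coprime_commute gcd_add2 coprime_iff_gcd_eq_1)
  have "jacobi c ?n = jacobi (- e) ?n"
    by (rule jacobi_cong) (simp add: cong_iff_dvd_diff add.commute)
  also have "\<dots> = (if ?n mod 4 = 3 then -1 else 1) * jacobi e ?n"
    using n assms by (intro jacobi_minus_left) auto
  also have "jacobi e ?n = (if e mod 4 = 3 \<and> ?n mod 4 = 3 then -1 else 1) * jacobi ?n e"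
    using n assms cop by (intro jacobi_reciprocity) auto
  also have "jacobi ?n e = jacobi c e"
    by (rule jacobi_cong) (simp add: cong_iff_dvd_diff)
  finally show ?thesis using n by auto
qed

text \<open>There are four sign patterns of \<open>e\<close> and \<open>e + c\<close>. For equal
  signs the positive case is applied to absolute values; for opposite signs one of the absolute
  values is 1 modulo 4, so reciprocity between them introduces no sign.\<close>

lemma quadratic_symbol_add_right:
  assumes "e mod 4 = 1" "4 dvd c" "coprime c e"
  shows "quadratic_symbol c (e + c) = quadratic_symbol c e"
proof -
  let ?n = "e + c"
  have n: "odd e" "odd ?n" "?n mod 4 = 1" using assms by presburger+
  then have nz: "e \<noteq> 0" "?n \<noteq> 0" by presburger+
  have cop: "coprime c ?n"
    using assms(3) by (metis coprime_iff_gcd_eq_1 gcd_add2 add.commute)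
  consider "e > 0" "?n > 0" | "e < 0" "?n < 0" | "e < 0" "?n > 0" | "e > 0" "?n < 0"
    using nz by linarith
  then show ?thesis
  proof cases
    case 1
    then show ?thesis
      using jacobi_add_denominator[of e c] assms n by (simp add: quadratic_symbol_jacobi)
  next
    \<comment> \<open>Passing from \<open>c\<close> to \<open>- c\<close> costs a sign over both
      \<open>- e\<close> and \<open>- (e + c)\<close>, which are 3 modulo 4; the two signs
      cancel.\<close>
    case 2
    have "jacobi (- c) (- e + - c) = jacobi (- c) (- e)"
      using 2 assms n by (intro jacobi_add_denominator) auto
    moreover have "(- e) mod 4 = 3" "(- ?n) mod 4 = 3" using assms n by presburger+
    moreover have "- e + - c = - ?n" by simp
    ultimately have "jacobi c ?n = jacobi c e"
      using jacobi_minus_left[of "- e" c] jacobi_minus_left[of "- ?n" c] 2 n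
      by (simp only: jacobi_minus_right neg_0_less_iff_less even_minus if_True simp_thms) simp
    then show ?thesis using 2 by (simp add: quadratic_symbol_jacobi)
  next
    case 3
    have cop': "coprime ?n (- e)" using assms(3)
        by (metis coprime_minus_right_iff coprime_iff_gcd_eq_1 gcd_add1 add.commute)
    have "jacobi c ?n = jacobi (- e) ?n"
      by (rule jacobi_cong) (simp add: cong_iff_dvd_diff add.commute)
    also have "\<dots> = jacobi ?n (- e)"
      using jacobi_reciprocity[of "- e" ?n] 3 n cop' by (simp add: coprime_commute)
    also have "\<dots> = jacobi c e"
      by (simp, rule jacobi_cong) (simp add: cong_iff_dvd_diff)
    finally show ?thesis using 3 by (simp add: quadratic_symbol_jacobi)
  next
    case 4
    have cop': "coprime (- ?n) e" using assms(3)
        by (metis coprime_minus_left_iff coprime_iff_gcd_eq_1 gcd_add1 add.commute)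
    have m: "(- ?n) mod 4 = 3" using n by presburger
    have "jacobi c e = jacobi ?n e"
      by (rule jacobi_cong) (simp add: cong_iff_dvd_diff)
    also have "\<dots> = jacobi (- ?n) e"
      using jacobi_minus_left[of e ?n] 4 n assms by simp
    also have "\<dots> = jacobi e (- ?n)"
      using jacobi_reciprocity[of "- ?n" e] 4 n cop' assms by simp
    also have "\<dots> = jacobi (- c) (- ?n)"
      unfolding jacobi_minus_right by (rule jacobi_cong) (simp add: cong_iff_dvd_diff)
    \<comment> \<open>This sign is cancelled by the extra sign of \<open>quadratic_symbol\<close>,
      as both \<open>c\<close> and \<open>e + c\<close> are negative here.\<close>
    also have "\<dots> = - jacobi c (- ?n)"
      using jacobi_minus_left[of "- ?n" c] m 4 n by simp
    finally show ?thesis using 4 by (simp add: quadratic_symbol_jacobi del: minus_add_distrib)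
  qed
qed

lemma quadratic_symbol_add_multiple_right:
  assumes "e mod 4 = 1" "4 dvd c" "coprime c e"
  shows "quadratic_symbol c (e + k * c) = quadratic_symbol c e"
proof -
  have nat: "quadratic_symbol c (e + int j * c) = quadratic_symbol c e"
    if "e mod 4 = 1" "coprime c e" for j e
  proof (induction j)
    case (Suc j)
    have "quadratic_symbol c ((e + int j * c) + c) = quadratic_symbol c (e + int j * c)"
    proof (rule quadratic_symbol_add_right)
      show "(e + int j * c) mod 4 = 1" using that assms(2)
          by (auto elim!: dvdE simp: mod_add_eq[symmetric])
      show "coprime c (e + int j * c)"
        using that(2) by (metis coprime_iff_gcd_eq_1 gcd_add_mult add.commute)
    qed fact
    then show ?case using Suc by (simp add: algebra_simps)
  qed simp
  show ?thesis
  proof (cases "k \<ge> 0")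
    case True
    then show ?thesis using nat[OF assms(1,3), of "nat k"] by simp
  next
    case False
    \<comment> \<open>For negative \<open>k\<close> the result for natural multiples leads from
      \<open>e + k * c\<close> back to \<open>e\<close>.\<close>
    let ?e = "e + k * c"
    have "?e mod 4 = 1" using assms(1,2) by (auto elim!: dvdE simp: mod_add_eq[symmetric])
    moreover have "coprime c ?e"
      using assms(3) by (metis coprime_iff_gcd_eq_1 gcd_add_mult add.commute)
    ultimately have "quadratic_symbol c (?e + int (nat (- k)) * c) = quadratic_symbol c ?e"
      by (rule nat)
    then show ?thesis using False by simp
  qed
qed

text \<open>A positive square prime to \<open>e\<close> contributes only 1. With
  \<open>c = p^2 * d\<close>, this lets the denominator move by multiples of \<open>p * d\<close>,
  not only of \<open>c\<close>.\<close>

lemma quadratic_symbol_square_mult_left: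
  assumes "odd e" "coprime p e" "p > 0"
  shows "quadratic_symbol (p\<^sup>2 * c) e = quadratic_symbol c e"
proof -
  have "jacobi (p\<^sup>2 * c) e = jacobi p e * jacobi p e * jacobi c e"
    using assms(1) by (simp add: jacobi_mult_left power2_eq_square)
  also have "\<dots> = jacobi c e"
    using assms by (subst jacobi_square_eq_1) auto
  finally show ?thesis using assms(3)
    by (simp add: quadratic_symbol_jacobi mult_less_0_iff)
qed

section \<open>Poisson summation for Gaussians\<close>

text \<open>Jacobi's theta function \<open>\<vartheta>(w; \<tau>)\<close> in the variable \<open>s = - \<i> \<tau>\<close>.\<close>

definition jtheta :: "complex \<Rightarrow> complex \<Rightarrow> complex" where
  "jtheta s w
      = (\<Sum>\<^sub>\<infinity>n::int. exp (- of_real pi * s * of_int n ^ 2 + 2 * of_real pi * \<i> * of_int n * w))"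

lemma summable_on_exp_neg_abs: "(\<lambda>n::int. exp (- real_of_int \<bar>n\<bar>)) summable_on UNIV"
proof -
  have "summable (\<lambda>n. exp (-1::real) ^ n)" by (rule summable_geometric) simp
  then have "(\<lambda>n::nat. exp (- real n)) summable_on UNIV"
    by (subst summable_on_UNIV_nonneg_real_iff) (auto simp: exp_of_nat_mult[symmetric] mult.commute)
  then have 1: "(\<lambda>n::int. exp (- real_of_int \<bar>n\<bar>)) summable_on range int"
       and 2: "(\<lambda>n::int. exp (- real_of_int \<bar>n\<bar>)) summable_on range (\<lambda>n. - int n)"
    by (auto simp: summable_on_reindex inj_on_def o_def)
  have "(UNIV :: int set) = range int \<union> range (\<lambda>n. - int n)"
    by (auto simp: image_iff) (metis nonneg_int_cases nonpos_int_cases linear)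
  then show ?thesis using summable_on_union[OF 1 2] by simp
qed

text \<open>Majorant for the convergence arguments below. Completing the square shows that the
  Gaussian absorbs \<open>(R + 1) * \<bar>n\<bar>\<close> at the cost of a constant, which leaves a
  geometric series.\<close>

lemma summable_on_exp_neg_square:
  assumes "\<sigma> > 0"
  shows "(\<lambda>n::int. exp (- \<sigma> * real_of_int n ^ 2 + R * \<bar>real_of_int n\<bar>)) summable_on UNIV"
proof (rule summable_on_comparison_test)
  let ?C = "(R + 1)\<^sup>2 / (4 * \<sigma>)"
  show "(\<lambda>n::int. exp ?C * exp (- real_of_int \<bar>n\<bar>)) summable_on UNIV"
    by (intro summable_on_cmult_right summable_on_exp_neg_abs)
  fix n :: int
  let ?k = "\<bar>real_of_int n\<bar>"
  have "0 \<le> (2 * \<sigma> * ?k - (R + 1))\<^sup>2" by simp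
  then have "(R + 1) * ?k - \<sigma> * ?k\<^sup>2 \<le> ?C"
    using assms by (simp add: field_simps power2_eq_square)
  then have "- \<sigma> * real_of_int n ^ 2 + R * ?k \<le> ?C + - ?k"
    by (simp add: algebra_simps)
  then show "exp (- \<sigma> * real_of_int n ^ 2 + R * ?k) \<le> exp ?C * exp (- real_of_int \<bar>n\<bar>)"
    unfolding exp_add[symmetric] by simp
qed auto

lemma norm_jtheta_term_le:
  assumes "\<sigma> \<le> Re s" "norm w \<le> R"
  shows "norm (exp (- of_real pi * s * of_int n ^ 2 + 2 * of_real pi * \<i> * of_int n * w))
           \<le> exp (- (pi * \<sigma>) * real_of_int n ^ 2 + (2 * pi * R) * \<bar>real_of_int n\<bar>)"
proof -
  have "Re (- of_real pi * s * of_int n ^ 2) = - ((pi * Re s) * real_of_int n ^ 2)"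
    by (simp add: Re_power2 power2_eq_square)
  moreover have "(pi * \<sigma>) * real_of_int n ^ 2 \<le> (pi * Re s) * real_of_int n ^ 2"
    using assms by (intro mult_right_mono mult_left_mono) auto
  moreover have "Re (2 * of_real pi * \<i> * of_int n * w) \<le> norm (2 * of_real pi * \<i> * of_int n * w)"
    by (rule complex_Re_le_cmod)
  moreover have "norm (2 * of_real pi * \<i> * of_int n * w) \<le> 2 * pi * R * \<bar>real_of_int n\<bar>"
    using assms by (simp add: norm_mult mult.commute mult_right_mono)
  ultimately have "Re (- of_real pi * s * of_int n ^ 2) + Re (2 * of_real pi * \<i> * of_int n * w)
     \<le> - (pi * \<sigma>) * real_of_int n ^ 2 + (2 * pi * R) * \<bar>real_of_int n\<bar>"
    unfolding mult_minus_left by linarith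
  then show ?thesis unfolding norm_exp_eq_Re plus_complex.sel by simp
qed

lemma jtheta_summable_norm:
  assumes "Re s > 0"
  shows "(\<lambda>n::int. norm (exp (- of_real pi * s * of_int n ^ 2 + 2 * of_real pi * \<i> * of_int n * w)))
      summable_on UNIV"
proof (rule summable_on_comparison_test)
  show "(\<lambda>n::int. exp (- (pi * Re s) * real_of_int n ^ 2 + (2 * pi * norm w) * \<bar>real_of_int n\<bar>))
      summable_on UNIV"
    using assms by (intro summable_on_exp_neg_square) simp
qed (use norm_jtheta_term_le[of "Re s" s w "norm w"] in auto)

lemmas jtheta_summable = jtheta_summable_norm[THEN abs_summable_summable]

lemma jtheta_uniform_limit:
  assumes "\<sigma> > 0" "\<And>\<zeta>. \<zeta> \<in> K \<Longrightarrow> \<sigma> \<le> Re (S \<zeta>)" "\<And>\<zeta>. \<zeta> \<in> K \<Longrightarrow> norm (W \<zeta>) \<le> R"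
  shows "uniform_limit K
     (\<lambda>X \<zeta>. \<Sum>n\<in>X. exp (- of_real pi * S \<zeta> * of_int n ^ 2 + 2 * of_real pi * \<i> * of_int n * W \<zeta>))
     (\<lambda>\<zeta>. jtheta (S \<zeta>) (W \<zeta>)) (finite_subsets_at_top UNIV)"
  unfolding jtheta_def
proof (rule Weierstrass_m_test_general)
  show "(\<lambda>n::int. exp (- (pi * \<sigma>) * real_of_int n ^ 2 + (2 * pi * R) * \<bar>real_of_int n\<bar>))
      summable_on UNIV"
    using assms by (intro summable_on_exp_neg_square) simp
qed (use assms norm_jtheta_term_le in blast)

text \<open>Letting both arguments depend on one variable avoids holomorphy in two variables.
  Extrema over closed discs give the constants for uniform convergence.\<close>

lemma jtheta_holomorphic:
  assumes "open A" "S holomorphic_on A" "W holomorphic_on A" "\<And>\<zeta>. \<zeta> \<in> A \<Longrightarrow> Re (S \<zeta>) > 0"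
  shows "(\<lambda>\<zeta>. jtheta (S \<zeta>) (W \<zeta>)) holomorphic_on A"
proof -
  have "\<exists>r>0. (\<lambda>\<zeta>. jtheta (S \<zeta>) (W \<zeta>)) holomorphic_on ball z r" if z: "z \<in> A" for z
  proof -
    obtain r where r: "r > 0" "cball z r \<subseteq> A" using assms(1) z open_contains_cball by blast
    have hol: "S holomorphic_on cball z r" "W holomorphic_on cball z r"
      using assms r holomorphic_on_subset by blast+
    have cS: "continuous_on (cball z r) (\<lambda>\<zeta>. Re (S \<zeta>))"
        and cW: "continuous_on (cball z r) (\<lambda>\<zeta>. norm (W \<zeta>))"
      using hol holomorphic_on_imp_continuous_on by (auto intro!: continuous_intros)
    have ne: "cball z r \<noteq> {}" using r by auto
    obtain u where u: "u \<in> cball z r" "\<And>\<zeta>. \<zeta> \<in> cball z r \<Longrightarrow> Re (S u) \<le> Re (S \<zeta>)"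
      using continuous_attains_inf[OF compact_cball ne cS] by blast
    obtain v where v: "\<And>\<zeta>. \<zeta> \<in> cball z r \<Longrightarrow> norm (W \<zeta>) \<le> norm (W v)"
      using continuous_attains_sup[OF compact_cball ne cW] by blast
    have ul: "uniform_limit (cball z r)
     (\<lambda>X \<zeta>. \<Sum>n\<in>X. exp (- of_real pi * S \<zeta> * of_int n ^ 2 + 2 * of_real pi * \<i> * of_int n * W \<zeta>))
     (\<lambda>\<zeta>. jtheta (S \<zeta>) (W \<zeta>)) (finite_subsets_at_top UNIV)"
      using assms(4) u v r
          by (intro jtheta_uniform_limit[where \<sigma> = "Re (S u)" and R = "norm (W v)"]) auto
    have holX: "(\<lambda>\<zeta>. \<Sum>n\<in>X. exp (- of_real pi * S \<zeta> * of_int n ^ 2 + 2 * of_real pi * \<i> * of_int n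
        * W \<zeta>)) holomorphic_on cball z r" for X
      using hol by (intro holomorphic_intros)
    have "(\<lambda>\<zeta>. jtheta (S \<zeta>) (W \<zeta>)) holomorphic_on ball z r"
    proof (rule holomorphic_uniform_limit[OF _ ul])
      show "\<forall>\<^sub>F X in finite_subsets_at_top UNIV.
        continuous_on (cball z r) (\<lambda>\<zeta>. \<Sum>n\<in>X. exp (- of_real pi * S \<zeta> * of_int n ^ 2 + 2 * of_real pi
            * \<i> * of_int n * W \<zeta>)) \<and>
        (\<lambda>\<zeta>. \<Sum>n\<in>X. exp (- of_real pi * S \<zeta> * of_int n ^ 2 + 2 * of_real pi * \<i> * of_int n * W \<zeta>))
            holomorphic_on ball z r"
        using holX holomorphic_on_imp_continuous_on holomorphic_on_subset[OF holX ball_subset_cball]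
        by (intro always_eventually allI conjI) blast+
    qed auto
    then show ?thesis using r by blast
  qed
  then have "\<forall>z\<in>A. (\<lambda>\<zeta>. jtheta (S \<zeta>) (W \<zeta>)) field_differentiable at z"
    by (metis centre_in_ball holomorphic_on_imp_differentiable_at open_ball)
  then show ?thesis
    by (auto simp: holomorphic_on_def intro: field_differentiable_at_within)
qed

text \<open>Connects unconditional sums over the integers with the symmetric partial sums in which
  Fourier series converge.\<close>

lemma filterlim_symmetric_int_intervals:
  "filterlim (\<lambda>K::nat. {- int K..int K}) (finite_subsets_at_top UNIV) sequentially"
  unfolding filterlim_finite_subsets_at_top
proof (intro allI impI)
  fix X :: "int set" assume "finite X \<and> X \<subseteq> UNIV"
  then have "finite X" by simp
  define k where "k = nat (Max (insert 0 (abs ` X)))"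
  have "\<bar>x\<bar> \<le> int k" if "x \<in> X" for x
  proof -
    have "\<bar>x\<bar> \<le> Max (insert 0 (abs ` X))" using \<open>finite X\<close> that by (intro Max_ge) auto
    then show ?thesis unfolding k_def by linarith
  qed
  then have "X \<subseteq> {- int K..int K}" if "K \<ge> k" for K
    using that by force
  then show "\<forall>\<^sub>F K in sequentially. finite {- int K..int K} \<and> X \<subseteq> {- int K..int K}
      \<and> {- int K..int K} \<subseteq> UNIV"
    by (auto simp: eventually_sequentially)
qed

section \<open>Pointwise convergence of Fourier series\<close>

lemma integral_exp_2_pi_i_int:
  fixes m :: int
  shows "((\<lambda>x. exp (- (2 * of_real pi * \<i> * of_int m * complex_of_real x)))
      has_integral (if m = 0 then 1 else 0)) {-1/2..1/2::real}"
proof (cases "m = 0")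
  case True
  then show ?thesis using has_integral_const_real[of "1::complex" "-1/2" "1/2"] by simp
next
  case False
  let ?k = "- (2 * of_real pi * \<i> * of_int m)"
  let ?G = "\<lambda>z. exp (?k * z) / ?k"
  have "((\<lambda>x. exp (?k * complex_of_real x)) has_integral (?G (of_real (1/2)) - ?G (of_real (-1/2))))
      {-1/2..1/2::real}"
  proof (rule fundamental_theorem_of_calculus)
    fix x :: real
    show "((\<lambda>x. ?G (of_real x)) has_vector_derivative exp (?k * complex_of_real x))
        (at x within {-1/2..1/2})"
      by (rule has_vector_derivative_real_field) (use False in \<open>auto intro!: derivative_eq_intros\<close>)
  qed simp
  moreover have "exp (?k * of_real (1/2)) = exp (?k * of_real (-1/2))"
    by (subst exp_eq) (auto intro!: exI[of _ "-m"])
  ultimately show ?thesis using False by simp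
qed

text \<open>Writing \<open>F - F(0) = h (E - 1)\<close> with \<open>E(z) = e(z)\<close> and \<open>h\<close> holomorphic near the interval makes the
  Fourier coefficients telescope, so that only the decay of those of \<open>h\<close> is needed (Chernoff).\<close>

lemma fourier_series_at_0:
  assumes hol: "F holomorphic_on UNIV"
  shows "(\<lambda>K::nat. \<Sum>m\<in>{- int K..int K}. integral {-1/2..1/2}
            (\<lambda>x. F (of_real x) * exp (- (2 * of_real pi * \<i> * of_int m * complex_of_real x))))
                \<longlonglongrightarrow> F 0"
proof -
  define E where "E = (\<lambda>z. exp (2 * of_real pi * \<i> * z))"
  \<comment> \<open>\<open>q f\<close> is the difference quotient at 0 with its removable
    singularity filled in, so \<open>h\<close> extends \<open>(F - F 0) / (E - 1)\<close> over
    0.\<close>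
  define q where "q = (\<lambda>f z. if z = 0 then deriv f 0 else (f z - f 0) / (z - 0 :: complex))"
  define h where "h = (\<lambda>z. q F z / q E z)"
  \<comment> \<open>In this strip \<open>E\<close> takes the value 1 only at 0, and there to first
    order, so \<open>q E\<close> has no zero.\<close>
  define S where "S = {z. \<bar>Re z\<bar> < 1}"
  have S: "open S" unfolding S_def by (intro open_Collect_less continuous_intros)
  have IS: "of_real x \<in> S" if "x \<in> {-1/2..1/2}" for x using that by (auto simp: S_def)
  have "(E has_field_derivative 2 * of_real pi * \<i>) (at 0)"
    unfolding E_def by (auto intro!: derivative_eq_intros)
  then have dE: "deriv E 0 = 2 * of_real pi * \<i>" by (rule DERIV_imp_deriv)
  have holE: "E holomorphic_on UNIV" unfolding E_def by (intro holomorphic_intros)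
  have nz: "E z \<noteq> 1" if "z \<in> S" "z \<noteq> 0" for z
  proof
    assume "E z = 1"
    then obtain n :: int
        where "Re (2 * of_real pi * \<i> * z) = 0" "Im (2 * of_real pi * \<i> * z) = of_int (2 * n) * pi"
      unfolding E_def exp_eq_1 by blast
    then have "Im z = 0" "Re z = of_int n" by auto
    with that show False by (auto simp: S_def complex_eq_iff)
  qed
  then have "q E z \<noteq> 0" if "z \<in> S" for z
    using that by (auto simp: q_def dE) (simp add: E_def)
  moreover have "q F holomorphic_on S" "q E holomorphic_on S"
    unfolding q_def
        using pole_lemma_open[OF hol open_UNIV, of 0] pole_lemma_open[OF holE open_UNIV, of 0]
    by (auto intro: holomorphic_on_subset)
  ultimately have holh: "h holomorphic_on S"
    unfolding h_def by (intro holomorphic_intros) auto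
  have hmult: "h z * (E z - 1) = F z - F 0" if "z \<in> S" for z
    using nz[OF that] by (auto simp: h_def q_def E_def)
  have conth: "continuous_on {-1/2..1/2} (\<lambda>x. h (of_real x))"
    by (rule continuous_on_compose2[OF holomorphic_on_imp_continuous_on[OF holh]])
       (use IS in \<open>auto intro!: continuous_intros\<close>)
  have holh': "deriv h holomorphic_on S" using holh S by (rule holomorphic_deriv)
  have conth': "continuous_on {-1/2..1/2} (\<lambda>x. deriv h (of_real x))"
    by (rule continuous_on_compose2[OF holomorphic_on_imp_continuous_on[OF holh']])
       (use IS in \<open>auto intro!: continuous_intros\<close>)
  define hh where "hh
      = (\<lambda>m::int. integral {-1/2..1/2}
      (\<lambda>x. h (of_real x) * exp (- (2 * of_real pi * \<i> * of_int m * complex_of_real x))))"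
  have hhI: "((\<lambda>x. h (of_real x) * exp (- (2 * of_real pi * \<i> * of_int m * complex_of_real x)))
      has_integral hh m) {-1/2..1/2}" for m
    unfolding hh_def
    by (intro integrable_integral integrable_continuous_interval continuous_intros conth)
  \<comment> \<open>Multiplication by \<open>E\<close> lowers the frequency by one, which produces
    the difference of consecutive coefficients of \<open>h\<close>.\<close>
  have coeff: "integral {-1/2..1/2} (\<lambda>x. F (of_real x)
      * exp (- (2 * of_real pi * \<i> * of_int m * complex_of_real x)))
      = F 0 * (if m = 0 then 1 else 0) + (hh (m - 1) - hh m)" for m
  proof (rule integral_unique)
    let ?e = "\<lambda>m x. exp (- (2 * of_real pi * \<i> * of_int m * complex_of_real x))"
    have I: "((\<lambda>x. F 0 * ?e m x + (h (of_real x) * ?e (m - 1) x - h (of_real x) * ?e m x))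
        has_integral
        F 0 * (if m = 0 then 1 else 0) + (hh (m - 1) - hh m)) {-1/2..1/2}"
      by (intro has_integral_add has_integral_diff has_integral_mult_right
          integral_exp_2_pi_i_int hhI)
    have eq: "F (of_real x) * ?e m x = F 0 * ?e m x + (h (of_real x) * ?e (m - 1) x - h (of_real x)
        * ?e m x)"
      if "x \<in> {-1/2..1/2}" for x
    proof -
      have "?e (m - 1) x = E (of_real x) * ?e m x"
        unfolding E_def exp_add[symmetric] by (simp add: algebra_simps)
      then have "h (of_real x) * ?e (m - 1) x - h (of_real x) * ?e m x
          = h (of_real x) * (E (of_real x) - 1) * ?e m x"
        by (simp add: algebra_simps)
      moreover have "F (of_real x) = F 0 + h (of_real x) * (E (of_real x) - 1)"
        using hmult[OF IS[OF that]] by simp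
      ultimately show ?thesis by (simp only: distrib_right)
    qed
    show "((\<lambda>x. F (of_real x) * ?e m x) has_integral
        F 0 * (if m = 0 then 1 else 0) + (hh (m - 1) - hh m)) {-1/2..1/2}"
      by (rule has_integral_eq[OF _ I]) (rule eq[symmetric])
  qed
  have sum: "(\<Sum>m\<in>{- int K..int K}. F 0 * (if m = 0 then 1 else 0) + (hh (m - 1) - hh m))
      = F 0 + hh (- int K - 1) - hh (int K)" for K
  proof (induction K)
    case (Suc K)
    have set: "{- int (Suc K)..int (Suc K)}
        = insert (- int (Suc K)) (insert (int (Suc K)) {- int K..int K})"
      by auto
    have "- int K - 1 = - int (Suc K)" "int (Suc K) - 1 = int K" by auto
    with Suc show ?case unfolding set by (simp del: of_nat_Suc) simp
  qed simp
  \<comment> \<open>Integration by parts bounds the coefficients of \<open>h\<close> by a multiple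
    of \<open>1 / \<bar>m\<bar>\<close>. The boundary terms stay, as \<open>h\<close> is not assumed
    periodic; each is at most \<open>M\<close>.\<close>
  have "\<exists>C. \<forall>m. norm (hh m) * \<bar>real_of_int m\<bar> \<le> C"
  proof -
    have "bounded ((\<lambda>x. h (of_real x)) ` {-1/2..1/2})"
      using conth by (intro compact_imp_bounded compact_continuous_image) auto
    then obtain M where M: "\<And>x. x \<in> {-1/2..1/2} \<Longrightarrow> norm (h (of_real x)) \<le> M"
      unfolding bounded_iff by (metis imageI)
    have "bounded ((\<lambda>x. deriv h (of_real x)) ` {-1/2..1/2})"
      using conth' by (intro compact_imp_bounded compact_continuous_image) auto
    then obtain M' where M': "\<And>x. x \<in> {-1/2..1/2} \<Longrightarrow> norm (deriv h (of_real x)) \<le> M'"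
      unfolding bounded_iff by (metis imageI)
    have "norm (hh m) * \<bar>real_of_int m\<bar> \<le> (M' + (M + M)) / (2 * pi)" for m
    proof -
      let ?k = "- (2 * of_real pi * \<i> * of_int m)"
      let ?G = "\<lambda>z. h z * exp (?k * z)"
      have A: "((\<lambda>x. deriv h (of_real x) * exp (?k * complex_of_real x) + ?k
          * (h (of_real x) * exp (?k * complex_of_real x)))
          has_integral (?G (of_real (1/2)) - ?G (of_real (-1/2)))) {-1/2..1/2::real}"
      proof (rule fundamental_theorem_of_calculus)
        fix x :: real assume x: "x \<in> {-1/2..1/2}"
        have "(h has_field_derivative deriv h (of_real x)) (at (of_real x))"
          using holh S IS[OF x] by (rule holomorphic_derivI)
        then show "((\<lambda>x. ?G (of_real x)) has_vector_derivative (deriv h (of_real x)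
            * exp (?k * complex_of_real x) + ?k * (h (of_real x) * exp (?k * complex_of_real x))))
            (at x within {-1/2..1/2})"
          by (intro has_vector_derivative_real_field)
            (auto intro!: derivative_eq_intros simp: algebra_simps)
      qed simp
      have B: "((\<lambda>x. ?k * (h (of_real x) * exp (?k * complex_of_real x)))
          has_integral (?k * hh m)) {-1/2..1/2}"
        using has_integral_mult_right[OF hhI[of m], of ?k] by simp
      from has_integral_diff[OF A B] have I:
          "((\<lambda>x. deriv h (of_real x) * exp (?k * complex_of_real x))
          has_integral (?G (of_real (1/2)) - ?G (of_real (-1/2)) - ?k * hh m)) {-1/2..1/2::real}"
        by simp
      have "norm (?G (of_real (1/2)) - ?G (of_real (-1/2)) - ?k * hh m)
          \<le> M' * measure lborel {-1/2..1/2::real}"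
      proof (rule has_integral_bound_real[OF _ _ I])
        show "0 \<le> M'" using order_trans[OF norm_ge_zero M'[of 0]] by simp
        show "finite ({} :: real set)" by simp
      qed (use M' in \<open>auto simp: norm_mult\<close>)
      moreover have "norm (?G (of_real (1/2))) \<le> M" "norm (?G (of_real (-1/2))) \<le> M"
        using M[of "1/2"] M[of "-1/2"] by (auto simp: norm_mult)
      moreover have "norm (?k * hh m) \<le> norm (?G (of_real (1/2)) - ?G (of_real (-1/2)) - ?k * hh m)
          + (norm (?G (of_real (1/2))) + norm (?G (of_real (-1/2))))"
        by (smt (verit) norm_triangle_ineq4 norm_minus_commute norm_triangle_sub)
      ultimately have "norm (?k * hh m) \<le> M' + (M + M)" by simp
      moreover have "norm (?k * hh m) = 2 * pi * (norm (hh m) * \<bar>real_of_int m\<bar>)"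
        by (simp add: norm_mult)
      ultimately show ?thesis by (simp add: field_simps)
    qed
    then show ?thesis by blast
  qed
  then obtain C where C: "\<And>m. norm (hh m) * \<bar>real_of_int m\<bar> \<le> C" by blast
  have bnd: "norm (hh m) \<le> C * (1 / \<bar>real_of_int m\<bar>)" if "m \<noteq> 0" for m
    using C[of m] that by (simp add: field_simps)
  have lim: "(\<lambda>K::nat. C * (1 / real K)) \<longlonglongrightarrow> 0" "(\<lambda>K::nat. C * (1 / (real K + 1))) \<longlonglongrightarrow> 0"
    by real_asymp+
  have "(\<lambda>K::nat. hh (int K)) \<longlonglongrightarrow> 0"
  proof (rule Lim_null_comparison[OF _ lim(1)])
    have "norm (hh (int K)) \<le> C * (1 / real K)" if "K > 0" for K
      using bnd[of "int K"] that by simp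
    then show "\<forall>\<^sub>F K in sequentially. norm (hh (int K)) \<le> C * (1 / real K)"
      by (intro eventually_mono[OF eventually_gt_at_top[of 0]])
  qed
  moreover have "(\<lambda>K::nat. hh (- int K - 1)) \<longlonglongrightarrow> 0"
  proof (rule Lim_null_comparison[OF _ lim(2)])
    have "norm (hh (- int K - 1)) \<le> C * (1 / (real K + 1))" for K
      using bnd[of "- int K - 1"] by (simp add: abs_if add.commute)
    then show "\<forall>\<^sub>F K in sequentially. norm (hh (- int K - 1)) \<le> C * (1 / (real K + 1))"
      by simp
  qed
  ultimately have "(\<lambda>K::nat. F 0 + hh (- int K - 1) - hh (int K)) \<longlonglongrightarrow> F 0 + 0 - 0"
    by (intro tendsto_intros)
  then show ?thesis unfolding coeff sum by simp
qed

text \<open>The factor completes the square and turns \<open>jtheta\<close> into the sum of a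
  Gaussian over its integer translates, the object to which Poisson summation applies.\<close>

lemma jtheta_completed_square:
  "exp (- of_real pi * t * z\<^sup>2) * jtheta t (\<i> * t * z)
      = (\<Sum>\<^sub>\<infinity>n::int. exp (- of_real pi * t * (of_int n + z)\<^sup>2))"
proof -
  have "exp (- of_real pi * t * z\<^sup>2) * exp (- of_real pi * t * of_int n ^ 2 + 2 * of_real pi * \<i>
      * of_int n * (\<i> * t * z))
     = exp (- of_real pi * t * (of_int n + z)\<^sup>2)" for n :: int
    unfolding exp_add[symmetric] by (simp add: power2_eq_square algebra_simps)
  then show ?thesis unfolding jtheta_def by (subst infsum_cmult_right'[symmetric]) simp
qed

text \<open>An affine change of variables in the characteristic function of the standard normal
  distribution.\<close>

lemma gaussian_fourier_transform:
  fixes t x \<xi> :: real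
  assumes "t > 0"
  shows "((\<lambda>y. exp (- of_real pi * of_real t * (of_real (y + x))\<^sup>2)
      * exp (- (2 * of_real pi * \<i> * of_real \<xi> * complex_of_real y)))
     has_integral (exp (- of_real (pi * \<xi>\<^sup>2 / t)) * exp (2 * of_real pi * \<i> * of_real \<xi> * of_real x)
         / of_real (sqrt t))) UNIV"
proof -
  \<comment> \<open>With \<open>u = r * (x + y)\<close> this scaling turns \<open>u^2 / 2\<close>
    into \<open>pi * t * (y + x)^2\<close>, and \<open>s\<close> below turns \<open>s * u\<close>
    into \<open>- 2 * pi * \<xi> * (x + y)\<close>.\<close>
  define r where "r = sqrt (2 * pi * t)"
  have r: "r > 0" "r\<^sup>2 = 2 * pi * t" using assms by (auto simp: r_def)
  define s where "s = - (2 * pi * \<xi>) / r"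
  interpret real_distribution std_normal_distribution by (rule real_dist_normal_dist)
  have "integrable std_normal_distribution (\<lambda>u. exp (\<i> * complex_of_real (s * u)))"
    by (rule integrable_iexp) auto
  then have int: "integrable lborel (\<lambda>u. std_normal_density u *\<^sub>R exp (\<i>
      * complex_of_real (s * u)))"
    by (subst (asm) integrable_density) auto
  have "char std_normal_distribution s
      = (LINT u|lborel. std_normal_density u *\<^sub>R exp (\<i> * complex_of_real (s * u)))"
    unfolding char_def by (subst integral_density) auto
  then have "has_bochner_integral lborel (\<lambda>u. std_normal_density u *\<^sub>R exp (\<i>
      * complex_of_real (s * u))) (of_real (exp (- (s\<^sup>2) / 2)))"
    using int by (simp add: has_bochner_integral_iff char_std_normal_distribution)
  then have "has_bochner_integral lborel (\<lambda>y. std_normal_density (r * x + r * y) *\<^sub>R exp (\<i>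
      * complex_of_real (s * (r * x + r * y)))) (of_real (exp (- (s\<^sup>2) / 2)) /\<^sub>R \<bar>r\<bar>)"
    using r by (subst (asm) lborel_has_bochner_integral_real_affine_iff[of r _ _ "r * x"]) auto
  from has_integral_integral_lborel[OF has_bochner_integral_iff[THEN iffD1, OF this, THEN
      conjunct1]] has_bochner_integral_integral_eq[OF this]
  have "((\<lambda>y. std_normal_density (r * x + r * y) *\<^sub>R exp (\<i>
      * complex_of_real (s * (r * x + r * y)))) has_integral (of_real (exp (- (s\<^sup>2) / 2)) /\<^sub>R
      \<bar>r\<bar>)) UNIV"
    by simp
  from has_integral_mult_right[OF this, of "of_real (sqrt (2 * pi))
      * exp (2 * of_real pi * \<i> * of_real \<xi> * of_real x)"]
  have "((\<lambda>y. of_real (sqrt (2 * pi)) * exp (2 * of_real pi * \<i> * of_real \<xi> * of_real x)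
      * (std_normal_density (r * x + r * y) *\<^sub>R exp (\<i> * complex_of_real (s * (r * x + r * y)))))
     has_integral of_real (sqrt (2 * pi)) * exp (2 * of_real pi * \<i> * of_real \<xi> * of_real x)
         * (of_real (exp (- (s\<^sup>2) / 2)) /\<^sub>R \<bar>r\<bar>)) UNIV" .
  moreover have "of_real (sqrt (2 * pi)) * exp (2 * of_real pi * \<i> * of_real \<xi> * of_real x)
      * (std_normal_density (r * x + r * y) *\<^sub>R exp (\<i> * complex_of_real (s * (r * x + r * y))))
      = exp (- of_real pi * of_real t * (of_real (y + x))\<^sup>2) * exp
          (- (2 * of_real pi * \<i> * of_real \<xi> * complex_of_real y))" for y
  proof -
    have "sqrt (2 * pi) * std_normal_density (r * x + r * y) = exp (- (r * x + r * y)\<^sup>2 / 2)"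
      by (simp add: std_normal_density_def real_sqrt_mult)
    also have "(r * x + r * y)\<^sup>2 = r\<^sup>2 * (y + x)\<^sup>2"
      by (simp add: power2_eq_square algebra_simps)
    also have "\<dots> = 2 * pi * t * (y + x)\<^sup>2" by (simp add: r(2))
    finally have 1: "sqrt (2 * pi) * std_normal_density (r * x + r * y)
        = exp (- pi * t * (y + x)\<^sup>2)"
      by simp
    have "s * (r * x + r * y) = - (2 * pi * \<xi>) * x - 2 * pi * \<xi> * y"
      using r by (simp add: s_def field_simps)
    then have 2: "exp (2 * of_real pi * \<i> * of_real \<xi> * of_real x)
        * exp (\<i> * complex_of_real (s * (r * x + r * y))) = exp
        (- (2 * of_real pi * \<i> * of_real \<xi> * complex_of_real y))"
      unfolding exp_add[symmetric] by (simp only:) (simp add: algebra_simps)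
    have "of_real (sqrt (2 * pi)) * exp (2 * of_real pi * \<i> * of_real \<xi> * of_real x)
        * (std_normal_density (r * x + r * y) *\<^sub>R exp (\<i> * complex_of_real (s * (r * x + r * y))))
      = of_real (sqrt (2 * pi) * std_normal_density (r * x + r * y))
          * (exp (2 * of_real pi * \<i> * of_real \<xi> * of_real x) * exp
          (\<i> * complex_of_real (s * (r * x + r * y))))"
      by (simp add: scaleR_conv_of_real)
    also have "\<dots> = of_real (exp (- pi * t * (y + x)\<^sup>2))
        * exp (- (2 * of_real pi * \<i> * of_real \<xi> * complex_of_real y))"
      unfolding 1 2 ..
    also have "of_real (exp (- pi * t * (y + x)\<^sup>2))
        = exp (- of_real pi * of_real t * (complex_of_real (y + x))\<^sup>2)"
      by (simp flip: exp_of_real)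
    finally show ?thesis .
  qed
  moreover have "of_real (sqrt (2 * pi)) * exp (2 * of_real pi * \<i> * of_real \<xi> * of_real x)
      * (of_real (exp (- (s\<^sup>2) / 2)) /\<^sub>R \<bar>r\<bar>)
     = exp (- of_real (pi * \<xi>\<^sup>2 / t)) * exp (2 * of_real pi * \<i> * of_real \<xi> * of_real x) / of_real
         (sqrt t)"
  proof -
    have gen: "of_real a * w * (of_real E /\<^sub>R b) = of_real E * w * of_real (a / b)"
        for a b E :: real and w :: complex
      by (cases "b = 0") (auto simp: scaleR_conv_of_real field_simps)
    have 1: "- (s\<^sup>2) / 2 = - (pi * \<xi>\<^sup>2 / t)"
      using r assms
          by (simp add: s_def power_divide power_mult_distrib)
          (simp add: field_simps power2_eq_square)
    have 2: "sqrt (2 * pi) / \<bar>r\<bar> = 1 / sqrt t" using assms by (simp add: r_def real_sqrt_mult)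
    have "of_real (sqrt (2 * pi)) * exp (2 * of_real pi * \<i> * of_real \<xi> * of_real x)
        * (of_real (exp (- (s\<^sup>2) / 2)) /\<^sub>R \<bar>r\<bar>)
      = of_real (exp (- (s\<^sup>2) / 2)) * exp (2 * of_real pi * \<i> * of_real \<xi> * of_real x) * of_real
          (sqrt (2 * pi) / \<bar>r\<bar>)"
      by (rule gen)
    then show ?thesis unfolding 1 2 by (simp flip: exp_of_real)
  qed
  ultimately show ?thesis by simp
qed

lemma exp_minus_2_pi_i_int_mult_shift:
  fixes m n :: int and y :: real
  shows "exp (- (2 * of_real pi * \<i> * of_int m * complex_of_real (y + of_int n)))
      = exp (- (2 * of_real pi * \<i> * of_int m * complex_of_real y))"
  by (subst exp_eq) (auto intro!: exI[of _ "- m * n"] simp: algebra_simps)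

lemma has_integral_real_shift:
  fixes g :: "real \<Rightarrow> 'a::real_normed_vector"
  assumes "((\<lambda>y. g (y + c)) has_integral I) {a..b}"
  shows "(g has_integral I) {a + c..b + c}"
  using has_integral_affinity[OF assms[folded box_real], of 1 "- c"] by (simp add: algebra_simps)

text \<open>Unfolding: integrating the sum of translates over one period amounts to integrating a
  single Gaussian over the whole line.\<close>

lemma fourier_coefficient_gaussian_sum:
  fixes t x :: real and m :: int
  assumes t: "t > 0"
  shows "integral {-1/2..1/2} (\<lambda>y. (\<Sum>\<^sub>\<infinity>n::int. exp (- of_real pi * of_real t
      * (of_int n + (of_real y + of_real x))\<^sup>2)) * exp
      (- (2 * of_real pi * \<i> * of_int m * complex_of_real y)))
    = exp (- of_real (pi * (of_int m)\<^sup>2 / t)) * exp (2 * of_real pi * \<i> * of_int m * of_real x)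
        / of_real (sqrt t)"
proof -
  \<comment> \<open>The character has period 1 in \<open>y\<close>, so it can be translated along
    with the Gaussian.\<close>
  define g where "g = (\<lambda>y. exp (- of_real pi * of_real t * (of_real (y + x))\<^sup>2)
      * exp (- (2 * of_real pi * \<i> * of_int m * complex_of_real y)))"
  let ?F = "\<lambda>y. (\<Sum>\<^sub>\<infinity>n::int. g (y + of_int n))"
  let ?L = "exp (- of_real (pi * (of_int m)\<^sup>2 / t)) * exp (2 * of_real pi * \<i> * of_int m
      * of_real x) / of_real (sqrt t)"
  have F: "?F y
      = (\<Sum>\<^sub>\<infinity>n::int. exp (- of_real pi * of_real t * (of_int n + (of_real y + of_real x))\<^sup>2)) * exp
      (- (2 * of_real pi * \<i> * of_int m * complex_of_real y))" for y
    unfolding g_def exp_minus_2_pi_i_int_mult_shift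
    by (subst infsum_cmult_left') (simp add: add_ac)
  have contg: "continuous_on A g" for A
    unfolding g_def by (intro continuous_intros)
  define R where "R = \<bar>x\<bar> + 1"
  have ul: "uniform_limit {-1/2..1/2} (\<lambda>X y. \<Sum>n\<in>X. g (y + of_int n)) ?F
      (finite_subsets_at_top UNIV)"
  proof (rule Weierstrass_m_test_general)
    show "(\<lambda>n::int. exp (- (pi * t) * real_of_int n ^ 2 + (2 * pi * t * R) * \<bar>real_of_int n\<bar>))
        summable_on UNIV"
      using t by (intro summable_on_exp_neg_square) simp
    fix n :: int and y :: real assume y: "y \<in> {-1/2..1/2}"
    let ?u = "y + x"
    have "\<bar>?u\<bar> \<le> R" using y by (auto simp: R_def)
    then have "\<bar>?u\<bar> * \<bar>real_of_int n\<bar> \<le> R * \<bar>real_of_int n\<bar>" by (intro mult_right_mono) auto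
    moreover have "- (\<bar>?u\<bar> * \<bar>real_of_int n\<bar>) \<le> ?u * real_of_int n"
      by (metis abs_mult abs_ge_minus_self minus_le_iff)
    ultimately have "(y + of_int n + x)\<^sup>2 \<ge> real_of_int n ^ 2 - 2 * R * \<bar>real_of_int n\<bar>"
      using zero_le_power2[of ?u] unfolding power2_eq_square by (simp add: algebra_simps) 
    then have "(pi * t) * (y + of_int n + x)\<^sup>2 \<ge> (pi * t) * (real_of_int n ^ 2 - 2 * R
        * \<bar>real_of_int n\<bar>)"
      using t by (intro mult_left_mono) auto
    then have "exp (- (pi * t * (y + of_int n + x)\<^sup>2))
        \<le> exp (- (pi * t) * real_of_int n ^ 2 + (2 * pi * t * R) * \<bar>real_of_int n\<bar>)"
      by (simp add: algebra_simps)
    moreover have "norm (g (y + of_int n)) = exp (- (pi * t * (y + of_int n + x)\<^sup>2))"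
    proof -
      have "- of_real pi * of_real t * (of_real (y + of_int n + x))\<^sup>2
          = complex_of_real (- (pi * t * (y + of_int n + x)\<^sup>2))"
        by simp
      then show ?thesis unfolding g_def norm_mult norm_exp_eq_Re by simp
    qed
    ultimately show "norm (g (y + of_int n))
        \<le> exp (- (pi * t) * real_of_int n ^ 2 + (2 * pi * t * R) * \<bar>real_of_int n\<bar>)"
      by simp
  qed
  have cont: "continuous_on {-1/2..1/2} (\<lambda>y. \<Sum>n\<in>X. g (y + of_int n))" for X :: "int set"
    by (intro continuous_intros continuous_on_compose2[OF contg[of UNIV]]) auto
  \<comment> \<open>Uniform convergence permits integration term by term: the integrals
    \<open>I X\<close> of the finite partial sums tend to \<open>J\<close>.\<close>
  obtain I J where I: "\<And>X. ((\<lambda>y. \<Sum>n\<in>X. g (y + of_int n)) has_integral I X) {-1/2..1/2}"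
    and J: "(?F has_integral J) {-1/2..1/2}" and lim: "(I \<longlongrightarrow> J) (finite_subsets_at_top UNIV)"
    using uniform_limit_integral[OF ul cont] by auto
  \<comment> \<open>Each induction step glues one translated unit interval to either end.\<close>
  have Ig: "(g has_integral I {- int K..int K}) {- real K - 1/2..real K + 1/2}" for K
  proof (induction K)
    case 0
    then show ?case using I[of "{0}"] by simp
  next
    case (Suc K)
    define gi where "gi = (\<lambda>n::int. integral {-1/2..1/2} (\<lambda>y. g (y + of_int n)))"
    have gi: "((\<lambda>y. g (y + of_int n)) has_integral gi n) {-1/2..1/2}" for n
      unfolding gi_def
      by (intro integrable_integral integrable_continuous_interval
          continuous_on_compose2[OF contg[of UNIV]] continuous_intros) auto
    have IX: "I X = (\<Sum>n\<in>X. gi n)" if "finite X" for X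
      by (rule has_integral_unique[OF I]) (intro has_integral_sum that gi)
    have set: "{- int (Suc K)..int (Suc K)}
        = insert (- int (Suc K)) (insert (int (Suc K)) {- int K..int K})"
      by auto
    have e: "-1/2 + real_of_int (- int (Suc K))
        = - real (Suc K) - 1/2" "1/2 + real_of_int (- int (Suc K)) = - real K - 1/2"
         "-1/2 + real_of_int (int (Suc K)) = real K + 1/2" "1/2 + real_of_int (int (Suc K))
             = real (Suc K) + 1/2"
      by simp_all
    have 1: "(g has_integral gi (- int (Suc K))) {- real (Suc K) - 1/2..- real K - 1/2}"
      using has_integral_real_shift[OF gi[of "- int (Suc K)"]] unfolding e .
    have 2: "(g has_integral gi (int (Suc K))) {real K + 1/2..real (Suc K) + 1/2}"
      using has_integral_real_shift[OF gi[of "int (Suc K)"]] unfolding e .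
    have 3: "(g has_integral (gi (- int (Suc K)) + I {- int K..int K})) {- real (Suc K)
        - 1/2..real K + 1/2}"
      by (rule has_integral_combine[OF _ _ 1 Suc]) auto
    have 4: "(g has_integral (gi (- int (Suc K)) + I {- int K..int K} + gi (int (Suc K))))
        {- real (Suc K) - 1/2..real (Suc K) + 1/2}"
      by (rule has_integral_combine[OF _ _ 3 2]) auto
    have "I {- int (Suc K)..int (Suc K)} = gi (- int (Suc K)) + I {- int K..int K}
        + gi (int (Suc K))"
      unfolding set by (simp add: IX del: of_nat_Suc)
    with 4 show ?case by simp
  qed
  have U: "(g has_integral ?L) UNIV"
    using gaussian_fourier_transform[OF t, of x "of_int m"] unfolding g_def by simp
  \<comment> \<open>The same sequence also consists of integrals of \<open>g\<close> over growing
    intervals, so it converges to the integral over the line.\<close>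
  have "(\<lambda>K::nat. I {- int K..int K}) \<longlonglongrightarrow> ?L"
  proof (rule LIMSEQ_I)
    fix \<epsilon> :: real assume "\<epsilon> > 0"
    moreover have "\<nexists>a b. (UNIV :: real set) = cbox a b"
      by (metis bounded_cbox not_bounded_UNIV)
    ultimately obtain B
        where B: "B > 0" "\<And>a b. ball 0 B \<subseteq> cbox a b \<Longrightarrow> \<exists>z. ((\<lambda>x. if x \<in> UNIV then g x else 0)
        has_integral z) (cbox a b) \<and> norm (z - ?L) < \<epsilon>"
      using has_integral_altD[OF U] by blast
    have "norm (I {- int K..int K} - ?L) < \<epsilon>" if "K \<ge> nat \<lceil>B\<rceil>" for K
    proof -
      have "B \<le> real K" using that by linarith
      then have "ball 0 B \<subseteq> cbox (- real K - 1/2) (real K + 1/2)"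
        by (auto simp: dist_norm)
      from B(2)[OF this] obtain z
          where z: "(g has_integral z) (cbox (- real K - 1/2) (real K + 1/2))" "norm (z - ?L) < \<epsilon>"
        by auto
      have "z = I {- int K..int K}"
        by (rule has_integral_unique[OF z(1)[unfolded box_real] Ig])
      with z(2) show ?thesis by simp
    qed
    then show "\<exists>no. \<forall>K\<ge>no. norm (I {- int K..int K} - ?L) < \<epsilon>" by blast
  qed
  moreover have "(\<lambda>K::nat. I {- int K..int K}) \<longlonglongrightarrow> J"
    using filterlim_compose[OF lim filterlim_symmetric_int_intervals] .
  ultimately have "J = ?L" using LIMSEQ_unique by blast
  then show ?thesis using J unfolding F by (simp add: integral_unique)
qed

text \<open>The Fourier series, evaluated at 0, of the sum of Gaussian translates shifted by
  \<open>x\<close>; its coefficients are the terms of the dual theta series.\<close>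

lemma poisson_real:
  fixes t x :: real
  assumes "t > 0"
  shows "exp (- of_real pi * of_real t * (of_real x)\<^sup>2) * jtheta (of_real t) (\<i> * of_real t
      * of_real x) = jtheta (1 / of_real t) (of_real x) / of_real (sqrt t)"
proof -
  let ?F = "\<lambda>z. exp (- of_real pi * of_real t * (z + of_real x)\<^sup>2)
      * jtheta (of_real t) (\<i> * of_real t * (z + of_real x))"
  let ?c = "\<lambda>m::int. exp (- of_real pi * (1 / of_real t) * of_int m ^ 2 + 2 * of_real pi * \<i>
      * of_int m * of_real x)"
  have "?F holomorphic_on UNIV"
    using assms by (intro holomorphic_intros jtheta_holomorphic) auto
  from fourier_series_at_0[OF this]
  have "(\<lambda>K::nat. \<Sum>m\<in>{- int K..int K}. integral {-1/2..1/2}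
            (\<lambda>y. ?F (of_real y) * exp (- (2 * of_real pi * \<i> * of_int m * complex_of_real y))))
                \<longlonglongrightarrow> ?F 0" .
  moreover have "integral {-1/2..1/2} (\<lambda>y. ?F (of_real y)
      * exp (- (2 * of_real pi * \<i> * of_int m * complex_of_real y))) = ?c m / of_real
      (sqrt t)" for m
    unfolding jtheta_completed_square fourier_coefficient_gaussian_sum[OF assms] exp_add by simp
  ultimately have "(\<lambda>K::nat. (\<Sum>m\<in>{- int K..int K}. ?c m) / of_real (sqrt t)) \<longlonglongrightarrow> ?F 0"
    by (simp only: sum_divide_distrib)
  moreover have "(\<lambda>K::nat. (\<Sum>m\<in>{- int K..int K}. ?c m) / of_real (sqrt t))
      \<longlonglongrightarrow> jtheta (1 / of_real t) (of_real x) / of_real (sqrt t)"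
  proof (intro tendsto_divide tendsto_const)
    have "(?c has_sum jtheta (1 / of_real t) (of_real x)) UNIV"
      unfolding jtheta_def by (intro has_sum_infsum jtheta_summable) (use assms in auto)
    then show "(\<lambda>K::nat. (\<Sum>m\<in>{- int K..int K}. ?c m)) \<longlonglongrightarrow> jtheta (1 / of_real t) (of_real x)"
      unfolding has_sum_def by (rule filterlim_compose[OF _ filterlim_symmetric_int_intervals])
  qed (use assms in auto)
  ultimately show ?thesis using LIMSEQ_unique by fastforce
qed

text \<open>Both sides are holomorphic in \<open>t\<close> on the right half plane, so they agree there because they
  agree on the positive real axis.\<close>

theorem jtheta_inversion:
  fixes x :: real
  assumes t: "Re t > 0"
  shows "exp (- of_real pi * t * (of_real x)\<^sup>2) * jtheta t (\<i> * t * of_real x)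
      = jtheta (1 / t) (of_real x) / csqrt t"
proof -
  define S where "S = {t. Re t > 0}"
  let ?f = "\<lambda>t. exp (- of_real pi * t * (of_real x)\<^sup>2) * jtheta t (\<i> * t * of_real x)
      - jtheta (1 / t) (of_real x) / csqrt t"
  have S: "open S" unfolding S_def by (intro open_Collect_less continuous_intros)
  have nz: "z \<noteq> 0" "z \<notin> \<real>\<^sub>\<le>\<^sub>0" "Re (1 / z) > 0" if "z \<in> S" for z
    using that by (auto simp: S_def complex_nonpos_Reals_iff Re_divide sum_power2_gt_zero_iff)
  have "?f t = 0"
  proof (rule analytic_continuation[of ?f S "of_real ` {0<..}" 1])
    show "?f holomorphic_on S"
      using S nz by (intro holomorphic_intros jtheta_holomorphic) (auto simp: S_def)
    show "connected S" unfolding S_def by (intro convex_connected convex_halfspace_Re_gt)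
    show "1 islimpt (complex_of_real ` {0<..})"
      unfolding islimpt_approachable
    proof (intro allI impI)
      fix e :: real assume "e > 0"
      then show "\<exists>x'\<in>complex_of_real ` {0<..}. x' \<noteq> 1 \<and> dist x' 1 < e"
        by (intro bexI[of _ "of_real (1 + e / 2)"] imageI) (auto simp: dist_norm)
    qed
    show "?f z = 0" if z: "z \<in> complex_of_real ` {0<..}" for z
    proof -
      obtain y where "z = of_real y" "y > 0" using z by auto
      then show ?thesis using poisson_real[of y x]
          by (simp add: csqrt_of_real_nonneg del: of_real_power)
    qed
  qed (use S assms in \<open>auto simp: S_def\<close>)
  then show ?thesis by simp
qed

section \<open>Theta series of residue classes\<close>

definition ee :: "complex \<Rightarrow> complex" where
  "ee z = exp (2 * of_real pi * \<i> * z)"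

lemma ee_0 [simp]: "ee 0 = 1" by (simp add: ee_def)

lemma ee_add: "ee (a + b) = ee a * ee b"
  by (simp add: ee_def ring_distribs exp_add)

lemma ee_nonzero [simp]: "ee z \<noteq> 0" by (simp add: ee_def)

lemma ee_of_int [simp]: "ee (of_int n) = 1"
  unfolding ee_def exp_eq_1 by (auto intro!: exI[of _ n])

lemma ee_add_of_int [simp]: "ee (z + of_int n) = ee z"
  by (simp add: ee_add)

lemma norm_ee: "norm (ee z) = exp (- (2 * pi * Im z))"
  by (simp add: ee_def norm_exp_eq_Re)

lemma ee_sum: "ee (\<Sum>i\<in>A. f i) = (\<Prod>i\<in>A. ee (f i))"
  by (induction A rule: infinite_finite_induct) (auto simp: ee_add)

lemma ee_cong:
  assumes "[a = b] (mod c)"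
  shows "ee (of_int a / of_int c) = ee (of_int b / of_int c)"
proof (cases "c = 0")
  case False
  from assms obtain k where "a = b + c * k" by (metis cong_iff_lin cong_sym_eq)
  then have "of_int a / of_int c = of_int b / of_int c + (of_int k :: complex)"
    using False by (simp add: field_simps)
  then show ?thesis by simp
qed simp

text \<open>\<open>Theta 1 0\<close> is the classical theta series. Summing over the index
  \<open>n\<close> of the progression, not over its members, exhibits the series as a value of
  \<open>jtheta\<close>.\<close>

definition Theta :: "int \<Rightarrow> int \<Rightarrow> complex \<Rightarrow> complex" where
  "Theta N h \<tau> = (\<Sum>\<^sub>\<infinity>n::int. ee (of_int ((N * n + h)\<^sup>2) * \<tau>))"

lemma Theta_term:
  "ee (of_int ((N * n + h)\<^sup>2) * \<tau>) = ee (of_int (h\<^sup>2) * \<tau>) *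
     exp (- of_real pi * (- 2 * \<i> * of_int N ^ 2 * \<tau>) * of_int n ^ 2 + 2 * of_real pi * \<i> * of_int n
         * (2 * of_int N * of_int h * \<tau>))"
  unfolding ee_def exp_add[symmetric] by (simp add: power2_eq_square algebra_simps)

lemma Theta_jtheta:
  "Theta N h \<tau> = ee (of_int (h\<^sup>2) * \<tau>) * jtheta (- 2 * \<i> * of_int N ^ 2 * \<tau>) (2 * of_int N
      * of_int h * \<tau>)"
  unfolding Theta_def Theta_term jtheta_def by (rule infsum_cmult_right')

lemma Re_Theta_param:
  assumes "N \<noteq> 0" "Im \<tau> > 0"
  shows "Re (- 2 * \<i> * of_int N ^ 2 * \<tau>) > 0"
  using assms by (simp add: Re_power2 Im_power2)

lemma Theta_summable_norm:
  assumes "N \<noteq> 0" "Im \<tau> > 0"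
  shows "(\<lambda>n::int. norm (ee (of_int ((N * n + h)\<^sup>2) * \<tau>))) summable_on UNIV"
  unfolding Theta_term norm_mult
  by (rule summable_on_cmult_right, rule jtheta_summable_norm, rule Re_Theta_param[OF assms])

lemma Theta_has_sum:
  assumes "N \<noteq> 0" "Im \<tau> > 0"
  shows "((\<lambda>n::int. ee (of_int ((N * n + h)\<^sup>2) * \<tau>)) has_sum Theta N h \<tau>) UNIV"
  unfolding Theta_def
  by (rule has_sum_infsum, rule abs_summable_summable, rule Theta_summable_norm[OF assms])

lemma Theta_holomorphic:
  assumes "N \<noteq> 0"
  shows "Theta N h holomorphic_on upper_half_plane"
proof -
  have "open upper_half_plane"
    unfolding upper_half_plane_def by (intro open_Collect_less continuous_intros)
  then show ?thesis
    unfolding Theta_jtheta[abs_def] ee_def using Re_Theta_param[OF assms]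
    by (intro holomorphic_intros jtheta_holomorphic) (auto simp: upper_half_plane_def)
qed

text \<open>The residue \<open>h\<close> becomes a mere phase in the dual series, whose constant
  term is 1 for every \<open>h\<close>; the limits at the cusps rest on this.\<close>

lemma Theta_inversion:
  assumes "N > 0" "Im \<tau> > 0"
  defines "t \<equiv> - 2 * \<i> * of_int N ^ 2 * \<tau>"
  shows "Theta N h \<tau> = jtheta (1 / t) (of_int h / of_int N) / csqrt t"
proof -
  let ?x = "real_of_int h / real_of_int N"
  have "- of_real pi * t * (of_int n + of_real ?x)\<^sup>2
      = 2 * of_real pi * \<i> * (of_int ((N * n + h)\<^sup>2) * \<tau>)" for n :: int
    using assms(1) by (simp add: t_def field_simps power2_eq_square)
  then have "Theta N h \<tau> = (\<Sum>\<^sub>\<infinity>n::int. exp (- of_real pi * t * (of_int n + of_real ?x)\<^sup>2))"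
    unfolding Theta_def ee_def by simp
  also have "\<dots> = jtheta (1 / t) (of_real ?x) / csqrt t"
    unfolding jtheta_completed_square[symmetric]
    using Re_Theta_param[of N \<tau>] assms by (intro jtheta_inversion) auto
  finally show ?thesis by simp
qed

lemma Theta_uminus: "Theta N (- h) \<tau> = Theta N h \<tau>"
  unfolding Theta_def
proof (rule infsum_reindex_bij_witness[of _ uminus uminus])
  fix n :: int
  have "(N * - n + h)\<^sup>2 = (N * n + - h)\<^sup>2" by (simp add: power2_eq_square algebra_simps)
  then show "ee (of_int ((N * - n + h)\<^sup>2) * \<tau>) = ee (of_int ((N * n + - h)\<^sup>2) * \<tau>)" by (simp only:)
qed auto

lemma Theta_shift: "Theta N (h + k * N) \<tau> = Theta N h \<tau>"
  unfolding Theta_def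
proof (rule infsum_reindex_bij_witness[of _ "\<lambda>n. n - k" "\<lambda>n. n + k"])
  fix n :: int
  have "N * (n + k) + h = N * n + (h + k * N)" by (simp add: algebra_simps)
  then show "ee (of_int ((N * (n + k) + h)\<^sup>2) * \<tau>) = ee (of_int ((N * n + (h + k * N))\<^sup>2) * \<tau>)"
      by (simp only:)
qed auto

lemma Theta_cong:
  assumes "[h = h'] (mod N)"
  shows "Theta N h \<tau> = Theta N h' \<tau>"
proof -
  from assms obtain k where "h' = h + N * k" using cong_iff_lin by blast
  then show ?thesis using Theta_shift[of N h k] by (simp add: mult.commute)
qed

text \<open>For \<open>n \<noteq> 0\<close> the factor \<open>exp (- (pi * (y - 1)))\<close> splits
  off because \<open>n^2 \<ge> 1\<close>, leaving the fixed summable majorant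
  \<open>exp (- pi * n^2)\<close>.\<close>

lemma gaussian_tail_tendsto_0:
  fixes u :: "'a \<Rightarrow> int \<Rightarrow> complex"
  assumes A: "0 \<notin> A" and y: "filterlim y at_top F"
    and u: "\<And>a n. n \<in> A \<Longrightarrow> y a \<ge> 1 \<Longrightarrow> norm (u a n) \<le> exp (- (pi * y a * of_int n ^ 2))"
  shows "((\<lambda>a. \<Sum>\<^sub>\<infinity>n\<in>A. u a n) \<longlongrightarrow> 0) F"
proof -
  define b where "b = (\<lambda>n::int. exp (- pi * real_of_int n ^ 2 + 0 * \<bar>real_of_int n\<bar>))"
  have b: "b summable_on UNIV" unfolding b_def by (rule summable_on_exp_neg_square) simp
  then have bA: "b summable_on A" using summable_on_subset by blast
  have "norm (\<Sum>\<^sub>\<infinity>n\<in>A. u a n) \<le> exp (- (pi * (y a - 1))) * infsum b A" if "y a \<ge> 1" for a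
  proof -
    have le: "norm (u a n) \<le> exp (- (pi * (y a - 1))) * b n" if n: "n \<in> A" for n
    proof -
      have "n \<noteq> 0" using n A by auto
      then have "1 \<le> n\<^sup>2" by (simp add: int_one_le_iff_zero_less)
      then have "1 \<le> real_of_int n ^ 2" by (metis of_int_1_le_iff of_int_power)
      then have "(y a - 1) * real_of_int n ^ 2 \<ge> (y a - 1) * 1"
        using \<open>y a \<ge> 1\<close> by (intro mult_left_mono) auto
      then have "pi * ((y a - 1) * real_of_int n ^ 2) \<ge> pi * ((y a - 1) * 1)"
        by (rule mult_left_mono) simp
      then have "exp (- (pi * y a * of_int n ^ 2)) \<le> exp (- (pi * (y a - 1))) * b n"
        unfolding b_def exp_add[symmetric] by (simp add: algebra_simps)
      then show ?thesis using u[OF n \<open>y a \<ge> 1\<close>] by linarith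
    qed
    have s: "(\<lambda>n. exp (- (pi * (y a - 1))) * b n) summable_on A"
      by (intro summable_on_cmult_right bA)
    have an: "(\<lambda>n. norm (u a n)) summable_on A"
      by (rule summable_on_comparison_test[OF s]) (use le in auto)
    have "norm (\<Sum>\<^sub>\<infinity>n\<in>A. u a n) \<le> (\<Sum>\<^sub>\<infinity>n\<in>A. norm (u a n))"
      by (rule norm_infsum_bound[OF an])
    also have "\<dots> \<le> (\<Sum>\<^sub>\<infinity>n\<in>A. exp (- (pi * (y a - 1))) * b n)"
      by (rule infsum_mono[OF an s le])
    also have "\<dots> = exp (- (pi * (y a - 1))) * infsum b A" by (rule infsum_cmult_right')
    finally show ?thesis .
  qed
  then have ev: "\<forall>\<^sub>F a in F. norm (\<Sum>\<^sub>\<infinity>n\<in>A. u a n) \<le> exp (- (pi * (y a - 1))) * infsum b A"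
    using y unfolding filterlim_at_top by (meson eventually_mono)
  have "((\<lambda>x::real. exp (- (pi * (x - 1)))) \<longlongrightarrow> 0) at_top" by real_asymp
  then have "((\<lambda>x::real. exp (- (pi * (x - 1))) * infsum b A) \<longlongrightarrow> 0) at_top"
    by (rule tendsto_mult_left_zero)
  from filterlim_compose[OF this y] show ?thesis
    by (rule Lim_null_comparison[OF ev])
qed

lemma infsum_split_0:
  fixes u :: "int \<Rightarrow> complex"
  assumes "u summable_on UNIV"
  shows "infsum u UNIV = u 0 + infsum u (UNIV - {0})"
  using infsum_Un_disjoint[of u "{0}" "UNIV - {0}"] summable_on_subset[OF assms, of "UNIV - {0}"]
  by auto

text \<open>For real \<open>x\<close> the phases have absolute value 1, so only the term
  \<open>n = 0\<close> survives.\<close>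

lemma jtheta_tendsto_1:
  assumes "filterlim (\<lambda>a. Re (s a)) at_top F" and x: "x \<in> \<real>"
  shows "((\<lambda>a. jtheta (s a) x) \<longlongrightarrow> 1) F"
proof -
  let ?u = "\<lambda>a n. exp (- of_real pi * s a * of_int n ^ 2 + 2 * of_real pi * \<i> * of_int n * x)"
  have "Im x = 0" using x by (simp add: complex_is_Real_iff)
  then have norm_u: "norm (?u a n) = exp (- (pi * Re (s a) * of_int n ^ 2))" for a n
    by (simp add: norm_exp_eq_Re Re_power2 Im_power2 power2_eq_square)
  have "((\<lambda>a. \<Sum>\<^sub>\<infinity>n\<in>UNIV - {0}. ?u a n) \<longlongrightarrow> 0) F"
    by (rule gaussian_tail_tendsto_0[OF _ assms(1)], simp, simp only: norm_u)
  then have "((\<lambda>a. 1 + (\<Sum>\<^sub>\<infinity>n\<in>UNIV - {0}. ?u a n)) \<longlongrightarrow> 1 + 0) F"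
    by (intro tendsto_intros)
  moreover have "\<forall>\<^sub>F a in F. 1 + (\<Sum>\<^sub>\<infinity>n\<in>UNIV - {0}. ?u a n) = jtheta (s a) x"
  proof -
    have "\<forall>\<^sub>F a in F. Re (s a) > 0"
      using assms(1) by (simp add: filterlim_at_top_dense)
    then show ?thesis
    proof eventually_elim
      case (elim a)
      show ?case unfolding jtheta_def
        using infsum_split_0[OF jtheta_summable[OF elim, of x]] by simp
    qed
  qed
  ultimately show ?thesis using tendsto_cong by force
qed

lemma has_sum_split_residues:
  fixes g :: "int \<Rightarrow> 'a :: {topological_comm_monoid_add, t2_space}"
  assumes "C > 0" "\<And>j. j \<in> {0..<C} \<Longrightarrow> ((\<lambda>l. g (C * l + j)) has_sum S j) UNIV"
  shows "(g has_sum (\<Sum>j\<in>{0..<C}. S j)) UNIV"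
proof -
  have "(g has_sum (\<Sum>j\<in>{0..<C}. S j)) (\<Union>j\<in>{0..<C}. range (\<lambda>l. C * l + j))"
  proof (rule sum_has_sum)
    fix j assume "j \<in> {0..<C}"
    then show "(g has_sum S j) (range (\<lambda>l. C * l + j))"
      using assms by (subst has_sum_reindex) (auto simp: inj_on_def o_def)
  next
    fix i j assume "i \<in> {0..<C}" "j \<in> {0..<C}" "i \<noteq> j"
    have "C * l + i \<noteq> C * l' + j" for l l'
    proof
      assume "C * l + i = C * l' + j"
      then have "(C * l + i) mod C = (C * l' + j) mod C" by simp
      then show False using \<open>i \<in> _\<close> \<open>j \<in> _\<close> \<open>i \<noteq> j\<close> by simp
    qed
    then show "range (\<lambda>l. C * l + i) \<inter> range (\<lambda>l. C * l + j) = {}" by auto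
  qed simp
  moreover have "x \<in> (\<Union>j\<in>{0..<C}. range (\<lambda>l. C * l + j))" for x
    using assms(1) by (intro UN_I[of "x mod C"] image_eqI[of _ _ "x div C"]) auto
  then have "(\<Union>j\<in>{0..<C}. range (\<lambda>l. C * l + j)) = UNIV" by blast
  ultimately show ?thesis by simp
qed

text \<open>The phase caused by \<open>a / c\<close> depends on the index only modulo
  \<open>c\<close>, so splitting the index by residues leaves finitely many series of level
  \<open>N * \<bar>c\<bar>\<close>.\<close>

lemma Theta_add_rational:
  assumes "N > 0" "c \<noteq> 0" "Im z > 0"
  shows "Theta N h (of_int a / of_int c + z) =
    (\<Sum>j\<in>{0..<\<bar>c\<bar>}. ee (of_int (a * (N * j + h)\<^sup>2) / of_int c) * Theta (N * \<bar>c\<bar>) (N * j + h) z)"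
proof -
  have "((\<lambda>n. ee (of_int ((N * n + h)\<^sup>2) * (of_int a / of_int c + z))) has_sum
     (\<Sum>j\<in>{0..<\<bar>c\<bar>}. ee (of_int (a * (N * j + h)\<^sup>2) / of_int c) * Theta (N * \<bar>c\<bar>) (N * j + h)
         z)) UNIV"
  proof (rule has_sum_split_residues)
    fix j
    let ?x = "N * j + h"
    have "ee (of_int ((N * (\<bar>c\<bar> * l + j) + h)\<^sup>2) * (of_int a / of_int c + z))
        = ee (of_int (a * ?x\<^sup>2) / of_int c) * ee (of_int ((N * \<bar>c\<bar> * l + ?x)\<^sup>2) * z)" for l
    proof -
      let ?X = "N * (\<bar>c\<bar> * l + j) + h"
      have X: "?X = N * \<bar>c\<bar> * l + ?x" by (simp add: algebra_simps)
      have "[?X = ?x] (mod c)" by (simp add: cong_iff_dvd_diff algebra_simps)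
      then have "[a * ?X\<^sup>2 = a * ?x\<^sup>2] (mod c)" by (intro cong_mult cong_pow) auto
      then have "ee (of_int (a * ?X\<^sup>2) / of_int c) = ee (of_int (a * ?x\<^sup>2) / of_int c)"
          by (rule ee_cong)
      moreover have "of_int (?X\<^sup>2) * (of_int a / of_int c + z)
          = of_int (a * ?X\<^sup>2) / of_int c + of_int (?X\<^sup>2) * z"
        by (simp add: field_simps)
      ultimately show ?thesis unfolding X[symmetric] by (simp only: ee_add)
    qed
    then show "((\<lambda>l. ee (of_int ((N * (\<bar>c\<bar> * l + j) + h)\<^sup>2) * (of_int a / of_int c + z))) has_sum
        ee (of_int (a * ?x\<^sup>2) / of_int c) * Theta (N * \<bar>c\<bar>) ?x z) UNIV"
      using assms by (simp only:) (intro has_sum_cmult_right Theta_has_sum, auto)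
  qed (use assms in auto)
  then show ?thesis unfolding Theta_def[of N] by (rule infsumI)
qed

text \<open>For a reduced residue, members of the progression are at least as large as their
  indices, which makes the tail estimate in \<open>n\<close> applicable.\<close>

lemma int_square_le_residue_square:
  fixes N h n :: int
  assumes "N > 0" "0 \<le> h" "h < N"
  shows "n\<^sup>2 \<le> (N * n + h)\<^sup>2"
proof -
  have "\<bar>n\<bar> \<le> \<bar>N * n + h\<bar>"
  proof (cases "n \<ge> 0")
    case True
    then have "n \<le> N * n" using assms(1) by (simp add: mult_le_cancel_right1)
    then show ?thesis using True assms by linarith
  next
    case False
    then have "(N - 1) * (n + 1) \<le> 0" using assms(1) by (simp add: mult_nonneg_nonpos)
    then have "N * n + h \<le> n" using assms(3) by (simp add: algebra_simps)
    then show ?thesis using False by linarith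
  qed
  then show ?thesis by (simp add: abs_le_square_iff)
qed

lemma Theta_tendsto_at_infinity:
  assumes "N > 0" "0 \<le> h" "h < N"
  shows "(Theta N h \<longlongrightarrow> (if h = 0 then 1 else 0)) (filtercomap Im at_top)"
proof -
  let ?u = "\<lambda>\<tau> n. ee (of_int ((N * n + h)\<^sup>2) * \<tau>)"
  have Im: "filterlim Im at_top (filtercomap Im at_top)" by (rule filterlim_filtercomap)
  then have Im2: "filterlim (\<lambda>\<tau>. 2 * Im \<tau>) at_top (filtercomap Im at_top)"
    by (intro filterlim_tendsto_pos_mult_at_top[OF tendsto_const]) auto
  have "((\<lambda>\<tau>. \<Sum>\<^sub>\<infinity>n\<in>UNIV - {0}. ?u \<tau> n) \<longlongrightarrow> 0) (filtercomap Im at_top)"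
  proof (rule gaussian_tail_tendsto_0[OF _ Im2])
    fix \<tau> and n :: int assume "2 * Im \<tau> \<ge> 1"
    have "real_of_int (n\<^sup>2) \<le> real_of_int ((N * n + h)\<^sup>2)"
      using int_square_le_residue_square[OF assms] of_int_le_iff by blast
    then have "pi * (2 * Im \<tau>) * real_of_int (n\<^sup>2) \<le> pi * (2 * Im \<tau>) * real_of_int ((N * n + h)\<^sup>2)"
      using \<open>2 * Im \<tau> \<ge> 1\<close> by (intro mult_left_mono) auto
    moreover have "norm (?u \<tau> n) = exp (- (pi * (2 * Im \<tau>) * real_of_int ((N * n + h)\<^sup>2)))"
      unfolding norm_ee by (simp del: of_int_power)
    ultimately show "norm (?u \<tau> n) \<le> exp (- (pi * (2 * Im \<tau>) * of_int n ^ 2))"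
      by simp
  qed simp
  moreover have "((\<lambda>\<tau>. ?u \<tau> 0) \<longlongrightarrow> (if h = 0 then 1 else 0)) (filtercomap Im at_top)"
  proof (cases "h = 0")
    case False
    have "((\<lambda>y::real. exp (- (2 * pi * (real_of_int (h\<^sup>2) * y)))) \<longlongrightarrow> 0) at_top"
    proof -
      have "real_of_int (h\<^sup>2) > 0" using False by simp
      then show ?thesis by real_asymp
    qed
    from filterlim_compose[OF this Im] have "((\<lambda>\<tau>. norm (?u \<tau> 0)) \<longlongrightarrow> 0) (filtercomap Im at_top)"
      unfolding norm_ee by simp
    then have "((\<lambda>\<tau>. ?u \<tau> 0) \<longlongrightarrow> 0) (filtercomap Im at_top)" by (rule tendsto_norm_zero_cancel)
    then show ?thesis using False by simp
  qed simp
  ultimately have "((\<lambda>\<tau>. ?u \<tau> 0 + (\<Sum>\<^sub>\<infinity>n\<in>UNIV - {0}. ?u \<tau> n))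
      \<longlongrightarrow> (if h = 0 then 1 else 0) + 0) (filtercomap Im at_top)"
    by (intro tendsto_intros)
  moreover have "\<forall>\<^sub>F \<tau> in filtercomap Im at_top. ?u \<tau> 0 + (\<Sum>\<^sub>\<infinity>n\<in>UNIV - {0}. ?u \<tau> n) = Theta N h \<tau>"
  proof -
    have "\<forall>\<^sub>F \<tau> in filtercomap Im at_top. Im \<tau> > 0"
      using Im by (simp add: filterlim_at_top_dense)
    then show ?thesis
    proof eventually_elim
      case (elim \<tau>)
      show ?case unfolding Theta_def
        by (rule infsum_split_0[symmetric]) (use Theta_has_sum[of N \<tau> h] assms elim in \<open>auto intro:
            has_sum_imp_summable\<close>)
    qed
  qed
  ultimately show ?thesis by (auto dest: Lim_transform_eventually)
qed

text \<open>Absolutely convergent series are multiplied out over functions; \<open>vec_nth\<close>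
  transports the result to vectors.\<close>

lemma has_sum_prod_vec:
  fixes \<phi> :: "'n::finite \<Rightarrow> int \<Rightarrow> complex"
  assumes "\<And>i. (\<lambda>k. norm (\<phi> i k)) summable_on UNIV"
  shows "((\<lambda>y::int^'n. \<Prod>i\<in>UNIV. \<phi> i (y $ i)) has_sum (\<Prod>i\<in>UNIV. \<Sum>\<^sub>\<infinity>k. \<phi> i k)) UNIV"
proof -
  have "infsum (\<lambda>g. \<Prod>i\<in>UNIV. \<phi> i (g i)) (PiE UNIV (\<lambda>_. UNIV)) = (\<Prod>i\<in>UNIV. \<Sum>\<^sub>\<infinity>k. \<phi> i k)"
    by (rule infsum_prod_PiE_abs) (use assms in auto)
  moreover have "(\<lambda>g. \<Prod>i\<in>UNIV. \<phi> i (g i)) summable_on (PiE UNIV (\<lambda>_. UNIV))"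
  proof (rule abs_summable_summable, subst abs_summable_equivalent, rule abs_summable_on_prod_PiE)
    show "Infinite_Set_Sum.abs_summable_on (\<phi> i) UNIV" for i
      using assms by (subst abs_summable_equivalent[symmetric])
  qed auto
  ultimately have "((\<lambda>g. \<Prod>i\<in>UNIV. \<phi> i (g i)) has_sum (\<Prod>i\<in>UNIV. \<Sum>\<^sub>\<infinity>k. \<phi> i k)) UNIV"
    using has_sum_infsum by fastforce
  moreover have "bij_betw vec_nth (UNIV :: (int^'n) set) UNIV"
    by (rule bij_betw_byWitness[where f' = vec_lambda]) (auto simp: vec_lambda_inverse
        vec_nth_inverse)
  ultimately show ?thesis
    using has_sum_reindex_bij_betw[of vec_nth UNIV UNIV "\<lambda>g. \<Prod>i\<in>UNIV. \<phi> i (g i)"] by blast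
qed

lemma finite_residue_vectors: "finite (residue_vectors p :: (int^'n) set)"
proof -
  have "(residue_vectors p :: (int^'n) set) \<subseteq> vec_lambda ` (PiE UNIV (\<lambda>_. {0..<int p}))"
  proof
    fix x :: "int^'n" assume "x \<in> residue_vectors p"
    then show "x \<in> vec_lambda ` (PiE UNIV (\<lambda>_. {0..<int p}))"
      by (intro image_eqI[of _ _ "vec_nth x"]) (auto simp: residue_vectors_def vec_eq_iff)
  qed
  moreover have "finite (PiE (UNIV :: 'n set) (\<lambda>_. {0..<int p}))" by (intro finite_PiE) auto
  ultimately show ?thesis using finite_surj by blast
qed

text \<open>Since \<open>Q\<close> is a sum of squares, the exponential factors over the coordinates
  once the lattice is partitioned into residue classes, the ranges of \<open>B r\<close> in the
  proof.\<close>

theorem theta_eq_sum_prod_Theta: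
  fixes f :: "int^'n \<Rightarrow> complex"
  assumes "p > 0" "Im \<tau> > 0"
  shows "theta p f \<tau> = (\<Sum>r\<in>residue_vectors p. f r * (\<Prod>i\<in>UNIV. Theta (int p) (r $ i) \<tau>))"
proof -
  let ?g = "\<lambda>x::int^'n. f (reduce p x) * ee (of_int (Q x) * \<tau>)"
  define B where "B = (\<lambda>(r::int^'n) (y::int^'n). (\<chi> i. int p * (y $ i) + r $ i))"
  have red: "reduce p (B r y) = r" if "r \<in> residue_vectors p" for r y
    using that by (auto simp: B_def reduce_def residue_vectors_def vec_eq_iff)
  have "(?g has_sum (\<Sum>r\<in>residue_vectors p. f r * (\<Prod>i\<in>UNIV. Theta (int p) (r $ i) \<tau>)))
      (\<Union>r\<in>residue_vectors p. range (B r))"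
  proof (rule sum_has_sum[OF finite_residue_vectors])
    fix r :: "int^'n" assume r: "r \<in> residue_vectors p"
    have "inj (B r)" using assms(1) by (auto simp: B_def inj_on_def vec_eq_iff)
    moreover have "?g (B r y) = f r * (\<Prod>i\<in>UNIV. ee (of_int ((int p * (y $ i) + r $ i)\<^sup>2) * \<tau>))"
        for y
      unfolding red[OF r] by (simp add: Q_def B_def sum_distrib_right ee_sum)
    moreover have "((\<lambda>y. f r * (\<Prod>i\<in>UNIV. ee (of_int ((int p * (y $ i) + r $ i)\<^sup>2) * \<tau>)))
        has_sum f r * (\<Prod>i\<in>UNIV. Theta (int p) (r $ i) \<tau>)) UNIV"
      unfolding Theta_def
      by (intro has_sum_cmult_right has_sum_prod_vec Theta_summable_norm) (use assms in auto)
    ultimately show "(?g has_sum f r * (\<Prod>i\<in>UNIV. Theta (int p) (r $ i) \<tau>)) (range (B r))"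
      by (subst has_sum_reindex) (simp_all add: o_def)
  next
    fix r r' :: "int^'n" assume "r \<in> residue_vectors p" "r' \<in> residue_vectors p" "r \<noteq> r'"
    then show "range (B r) \<inter> range (B r') = {}" using red
        by (metis (no_types, lifting) disjoint_iff imageE)
  qed
  moreover have "x \<in> (\<Union>r\<in>residue_vectors p. range (B r))" for x
    using assms(1) by (intro UN_I[of "reduce p x"] image_eqI[of _ _ "\<chi> i. x $ i div int p"])
      (auto simp: B_def reduce_def residue_vectors_def vec_eq_iff)
  then have "(\<Union>r\<in>residue_vectors p. range (B r)) = UNIV" by blast
  ultimately show ?thesis
    unfolding theta_def by (simp add: infsumI ee_def mult.assoc)
qed

section \<open>The transformation law\<close>

declare csqrt.simps [simp del]

lemma Re_Im_csqrt:
  "(Re (csqrt z))\<^sup>2 - (Im (csqrt z))\<^sup>2 = Re z" "2 * Re (csqrt z) * Im (csqrt z) = Im z"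
proof -
  have "Re ((csqrt z)\<^sup>2) = Re z" "Im ((csqrt z)\<^sup>2) = Im z" by simp_all
  then show "(Re (csqrt z))\<^sup>2 - (Im (csqrt z))\<^sup>2 = Re z" "2 * Re (csqrt z) * Im (csqrt z) = Im z"
    by (simp_all only: Re_power2 Im_power2)
qed

text \<open>Knowing the quadrants of two principal roots decides the sign between their product and
  the root of the product.\<close>

lemma csqrt_quadrant:
  assumes "Im z \<noteq> 0"
  shows "Re (csqrt z) > 0" "Im z > 0 \<Longrightarrow> Im (csqrt z) > 0" "Im z < 0 \<Longrightarrow> Im (csqrt z) < 0"
proof -
  note i = Re_Im_csqrt(2)[of z]
  have "Re (csqrt z) \<noteq> 0" using assms i by auto
  then show r: "Re (csqrt z) > 0" using csqrt_principal[of z] by linarith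
  show "Im z > 0 \<Longrightarrow> Im (csqrt z) > 0" "Im z < 0 \<Longrightarrow> Im (csqrt z) < 0"
    using r unfolding i[symmetric] by (auto simp: zero_less_mult_iff mult_less_0_iff)
qed

text \<open>Both roots have argument below pi/4 in absolute value, so their product still has
  positive real part.\<close>

lemma csqrt_mult_right_half_plane:
  assumes "Re a > 0" "Re b > 0"
  shows "csqrt (a * b) = csqrt a * csqrt b"
proof (rule csqrt_unique)
  have *: "\<bar>Im (csqrt z)\<bar> < Re (csqrt z)" if "Re z > 0" for z
  proof -
    have "(Im (csqrt z))\<^sup>2 < (Re (csqrt z))\<^sup>2" using that Re_Im_csqrt(1)[of z] by simp
    then have "\<bar>Im (csqrt z)\<bar> < \<bar>Re (csqrt z)\<bar>" by (metis abs_le_square_iff not_le)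
    then show ?thesis using csqrt_principal[of z] by auto
  qed
  show "(csqrt a * csqrt b)\<^sup>2 = a * b" by (simp add: power_mult_distrib)
  have "\<bar>Im (csqrt a)\<bar> * \<bar>Im (csqrt b)\<bar> < Re (csqrt a) * Re (csqrt b)"
    using *[OF assms(1)] *[OF assms(2)] by (intro mult_strict_mono') auto
  then have "Im (csqrt a) * Im (csqrt b) < Re (csqrt a) * Re (csqrt b)"
    by (metis abs_ge_self abs_mult order_le_less_trans)
  then show "0 < Re (csqrt a * csqrt b) \<or> Re (csqrt a * csqrt b) = 0 \<and> 0 \<le> Im (csqrt a * csqrt b)"
    by simp
qed

section \<open>The theta series under translation, inversion and a parabolic move\<close>

lemma Theta_add_of_int: "Theta N h (\<tau> + of_int k) = Theta N h \<tau>"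
proof -
  have "ee (of_int m * (\<tau> + of_int k)) = ee (of_int m * \<tau>)" for m
    using ee_add_of_int[of "of_int m * \<tau>" "m * k"] by (simp add: algebra_simps)
  then show ?thesis unfolding Theta_def by (simp only:)
qed

text \<open>The 4 reflects the exponent \<open>2 * pi * \<i> * n^2 * \<tau>\<close>: the series is
  \<open>jtheta\<close> at \<open>- 2 * \<i> * \<tau>\<close>, whose reciprocal belongs to
  \<open>- 1 / (4 * \<tau>)\<close>.\<close>

lemma Theta_1_0_inversion:
  assumes "Im \<tau> > 0"
  shows "Theta 1 0 (- 1 / (4 * \<tau>)) = csqrt (- 2 * \<i> * \<tau>) * Theta 1 0 \<tau>"
proof -
  have nz: "\<tau> \<noteq> 0" using assms by auto
  then have "- 2 * \<i> * (- 1 / (4 * \<tau>)) = 1 / (- 2 * \<i> * \<tau>)" by (simp add: field_simps)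
  then have "Theta 1 0 (- 1 / (4 * \<tau>)) = jtheta (1 / (- 2 * \<i> * \<tau>)) 0"
    unfolding Theta_jtheta by simp
  then show ?thesis using Theta_inversion[of 1 \<tau> 0] assms nz by simp
qed

lemma Im_one_over_neg: "Im \<tau> > 0 \<Longrightarrow> Im (- 1 / (4 * \<tau>)) > 0"
  by (auto simp: Im_divide intro!: divide_pos_pos add_nonneg_pos)

text \<open>The parabolic map is the conjugate of the translation \<open>w \<mapsto> w + 1\<close>
  under the inversion \<open>w = - 1 / (4 * \<tau>)\<close>; the two root factors multiply without a
  sign.\<close>

lemma Theta_1_0_parabolic:
  assumes "Im \<tau> > 0"
  shows "Theta 1 0 (\<tau> / (1 - 4 * \<tau>)) = csqrt (1 - 4 * \<tau>) * Theta 1 0 \<tau>"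
proof -
  define w where "w = - 1 / (4 * \<tau>)"
  have nz: "\<tau> \<noteq> 0" "1 - 4 * \<tau> \<noteq> 0" using assms by (auto simp: complex_eq_iff)
  have w: "Im w > 0" unfolding w_def using assms by (rule Im_one_over_neg)
  then have "w + 1 \<noteq> 0" by (auto simp: complex_eq_iff)
  have w1: "- 4 * \<tau> * (w + 1) = 1 - 4 * \<tau>" using nz by (simp add: w_def field_simps)
  then have "\<tau> / (1 - 4 * \<tau>) = \<tau> / (- 4 * \<tau> * (w + 1))" by (simp only:)
  also have "\<dots> = - 1 / (4 * (w + 1))"
    using nz \<open>w + 1 \<noteq> 0\<close> by (subst frac_eq_eq) (auto simp del: distrib_left_numeral)
  finally have "\<tau> / (1 - 4 * \<tau>) = - 1 / (4 * (w + 1))" .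
  moreover have "Theta 1 0 (- 1 / (4 * (w + 1))) = csqrt (- 2 * \<i> * (w + 1)) * Theta 1 0 (w + 1)"
    using w by (intro Theta_1_0_inversion) simp
  moreover have "Theta 1 0 (w + 1) = Theta 1 0 w" using Theta_add_of_int[of 1 0 w 1] by simp
  moreover have "Theta 1 0 w = csqrt (- 2 * \<i> * \<tau>) * Theta 1 0 \<tau>"
    unfolding w_def using assms by (rule Theta_1_0_inversion)
  moreover have "csqrt (1 - 4 * \<tau>) = csqrt (- 2 * \<i> * (w + 1)) * csqrt (- 2 * \<i> * \<tau>)"
  proof -
    have "(- 2 * \<i> * (w + 1)) * (- 2 * \<i> * \<tau>) = - 4 * \<tau> * (w + 1)" by (simp add: algebra_simps)
    also note w1
    finally show ?thesis
        using csqrt_mult_right_half_plane[of "- 2 * \<i> * (w + 1)" "- 2 * \<i> * \<tau>"] w assms by simp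
  qed
  ultimately show ?thesis by simp
qed

lemma unit_mod_4_eq_1:
  fixes e :: int
  assumes "is_unit e" "e mod 4 = 1" shows "e = 1"
  using assms by (auto simp: zdvd1_eq abs_if split: if_splits)

lemma parabolic_factor:
  fixes x y :: int and \<tau> :: complex
  assumes "1 - 4 * \<tau> \<noteq> 0"
  shows "of_int (x + 4 * y) * (\<tau> / (1 - 4 * \<tau>)) + of_int y
      = (of_int x * \<tau> + of_int y) / (1 - 4 * \<tau>)"
  using assms by (simp add: field_simps)

text \<open>Cocycle relation for the parabolic move. The arguments of the roots satisfy
  \<open>u * v = w\<close>, so the roots agree up to sign; the signs of \<open>c'\<close>,
  \<open>c\<close> and \<open>e\<close> determine it and match the extra sign in the symbol.\<close>

lemma automorphy_factor_step:
  fixes c e :: int and \<tau> :: complex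
  assumes "e mod 4 = 1" "coprime c e" "Im \<tau> > 0"
  defines "c' \<equiv> c + 4 * e"
  defines "\<tau>' \<equiv> \<tau> / (1 - 4 * \<tau>)"
  shows "of_int (quadratic_symbol c' e) * csqrt (of_int c' * \<tau>' + of_int e) * csqrt (1 - 4 * \<tau>)
       = of_int (quadratic_symbol c e) * csqrt (of_int c * \<tau> + of_int e)" (is "?L = ?R")
proof -
  define v where "v = 1 - 4 * \<tau>"
  define w where "w = of_int c * \<tau> + of_int e"
  define u where "u = of_int c' * \<tau>' + of_int e"
  define s where "s = csqrt u * csqrt v"
  have v: "Im v < 0" "v \<noteq> 0" using assms(3) by (auto simp: v_def complex_eq_iff)
  have "u * v = w" using v(2) unfolding u_def w_def c'_def \<tau>'_def v_def
      by (subst parabolic_factor) auto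
  then have s2: "s\<^sup>2 = w" by (simp add: s_def power_mult_distrib)
  then have pm: "s = csqrt w \<or> s = - csqrt w" by (metis power2_csqrt power2_eq_iff)
  have "Im \<tau>' > 0"
  proof -
    have "Im \<tau>' = Im (\<tau> * cnj v) / (norm v)\<^sup>2" unfolding \<tau>'_def v_def[symmetric]
      by (simp add: complex_div_cnj[of \<tau> v] Im_divide_of_real)
    moreover have "Im (\<tau> * cnj v) = Im \<tau>" by (simp add: v_def algebra_simps)
    ultimately show ?thesis using assms(3) v(2) by simp
  qed
  then have signu: "Im u > 0 \<longleftrightarrow> c' > 0" "Im u < 0 \<longleftrightarrow> c' < 0"
    by (auto simp: u_def zero_less_mult_iff mult_less_0_iff)
  have signw: "Im w > 0 \<longleftrightarrow> c > 0" "Im w < 0 \<longleftrightarrow> c < 0"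
    using assms(3) by (auto simp: w_def zero_less_mult_iff mult_less_0_iff)
  have qv: "Re (csqrt v) > 0" "Im (csqrt v) < 0" using csqrt_quadrant[of v] v by auto
  have jac: "jacobi c' e = jacobi c e"
    by (rule jacobi_cong) (simp add: c'_def cong_iff_dvd_diff)
  have "?L = of_int (quadratic_symbol c' e) * s" by (simp add: s_def u_def v_def)
  moreover have "?R = of_int (quadratic_symbol c e) * csqrt w" by (simp add: w_def)
  moreover have "of_int (quadratic_symbol c' e) * s = of_int (quadratic_symbol c e) * csqrt w"
  proof (rule linorder_cases[of c' 0])
    assume c': "c' > 0"
    then have "Re (csqrt u) > 0" "Im (csqrt u) > 0" using csqrt_quadrant[of u] signu by auto
    then have "Re s > 0" using qv unfolding s_def
      by (simp add: mult_pos_pos mult_pos_neg less_trans[of _ 0])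
    then have "csqrt w = s" using s2 by (intro csqrt_unique) auto
    then show ?thesis using c' jac by (auto simp: quadratic_symbol_jacobi c'_def)
  next
    assume c': "c' = 0"
    then have "c = - 4 * e" by (simp add: c'_def)
    then have "is_unit e" using assms(2) by (metis coprime_common_divisor dvd_refl dvd_triv_right)
    then have "e = 1" using assms(1) unit_mod_4_eq_1 by blast
    then have "csqrt w = s" using c' \<open>u * v = w\<close> by (simp add: s_def u_def)
    then show ?thesis using c' jac \<open>e = 1\<close> by (auto simp: quadratic_symbol_jacobi)
  next
    \<comment> \<open>Both roots now lie in the fourth quadrant, so the imaginary part of
      \<open>s\<close> decides the sign instead of the real part.\<close>
    assume c': "c' < 0"
    then have "Re (csqrt u) > 0" "Im (csqrt u) < 0" using csqrt_quadrant[of u] signu by auto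
    then have "Im s < 0" using qv unfolding s_def
      by (simp add: mult_pos_neg mult_neg_pos add_neg_neg)
    have "c \<noteq> 0"
    proof
      assume "c = 0"
      then have "is_unit e" using assms(2) by simp
      then have "e = 1" using assms(1) unit_mod_4_eq_1 by blast
      then show False using c' \<open>c = 0\<close> by (simp add: c'_def)
    qed
    then consider "c > 0" "e < 0" | "c < 0" using c' by (fastforce simp: c'_def)
    then show ?thesis
    proof cases
      \<comment> \<open>The only case where the product leaves the principal branch. The extra sign
        of \<open>quadratic_symbol\<close>, present for \<open>c'\<close> and absent for
        \<open>c\<close>, compensates.\<close>
      case 1
      then have "Im (csqrt w) > 0" using csqrt_quadrant[of w] signw by auto
      then have "s = - csqrt w" using pm \<open>Im s < 0\<close> by auto
      then show ?thesis using 1 c' jac by (simp add: quadratic_symbol_jacobi)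
    next
      case 2
      then have "Im (csqrt w) < 0" using csqrt_quadrant[of w] signw by auto
      then have "s = csqrt w" using pm \<open>Im s < 0\<close> by auto
      then show ?thesis using 2 c' jac by (simp add: quadratic_symbol_jacobi)
    qed
  qed
  ultimately show ?thesis by (simp only:)
qed

text \<open>All top rows completing \<open>(c, e)\<close> are included: they differ by integer
  translations of the transformed point, so the law concerns the bottom row and a descent can run on
  pairs.\<close>

definition theta_law :: "int \<Rightarrow> int \<Rightarrow> bool" where
  "theta_law c e \<longleftrightarrow> (\<forall>a b \<tau>. a * e - b * c = 1 \<longrightarrow> Im \<tau> > 0 \<longrightarrow>
     Theta 1 0 ((of_int a * \<tau> + of_int b) / (of_int c * \<tau> + of_int e)) =
     of_int (quadratic_symbol c e) * csqrt (of_int c * \<tau> + of_int e) * Theta 1 0 \<tau>)"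

text \<open>Multiplying the matrix by a translation on the right, that is, substituting
  \<open>\<tau> - k\<close> for \<open>\<tau>\<close>.\<close>

lemma theta_law_translate:
  assumes "theta_law c (e + k * c)" "e mod 4 = 1" "4 dvd c" "coprime c e"
  shows "theta_law c e"
  unfolding theta_law_def
proof (intro allI impI)
  fix a b \<tau> assume d: "a * e - b * c = 1" and t: "Im \<tau> > 0"
  let ?t = "\<tau> + of_int (- k)"
  have "a * (e + k * c) - (b + a * k) * c = 1" using d by (simp add: algebra_simps)
  moreover have "Im ?t > 0" using t by simp
  ultimately have "Theta 1 0 ((of_int a * ?t + of_int (b + a * k))
      / (of_int c * ?t + of_int (e + k * c))) =
     of_int (quadratic_symbol c (e + k * c)) * csqrt (of_int c * ?t + of_int (e + k * c))
         * Theta 1 0 ?t"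
    using assms(1) unfolding theta_law_def by blast
  moreover have "of_int a * ?t + of_int (b + a * k) = of_int a * \<tau> + of_int b"
       "of_int c * ?t + of_int (e + k * c) = of_int c * \<tau> + of_int e"
    by (simp_all add: algebra_simps)
  ultimately show "Theta 1 0 ((of_int a * \<tau> + of_int b) / (of_int c * \<tau> + of_int e)) =
     of_int (quadratic_symbol c e) * csqrt (of_int c * \<tau> + of_int e) * Theta 1 0 \<tau>"
    using quadratic_symbol_add_multiple_right[OF assms(2-4), of k] Theta_add_of_int[of 1 0 \<tau> "- k"]
        by (simp only:)
qed

lemma parabolic_conjugation:
  fixes a b c e :: int and \<tau> :: complex
  assumes "1 - 4 * \<tau> \<noteq> 0"
  shows "(of_int (a + 4 * b) * (\<tau> / (1 - 4 * \<tau>)) + of_int b)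
      / (of_int (c + 4 * e) * (\<tau> / (1 - 4 * \<tau>)) + of_int e)
     = (of_int a * \<tau> + of_int b) / (of_int c * \<tau> + of_int e)"
proof -
  show ?thesis unfolding parabolic_factor[OF assms] using assms by simp
qed

lemma Im_divide_one_minus_4:
  assumes "Im \<tau> > 0" shows "Im (\<tau> / (1 - 4 * \<tau>)) > 0" and "Im (\<tau> / (1 + 4 * \<tau>)) > 0"
proof -
  have "Im (\<tau> / (1 + of_real k * \<tau>)) = Im \<tau> / (norm (1 + of_real k * \<tau>))\<^sup>2" for k
    by (simp add: Im_divide cmod_power2 algebra_simps)
  moreover have "1 + of_real k * \<tau> \<noteq> 0" for k
    using assms by (auto simp: complex_eq_iff)
  ultimately have *: "Im (\<tau> / (1 + of_real k * \<tau>)) > 0" for k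
    using assms by simp
  show "Im (\<tau> / (1 - 4 * \<tau>)) > 0" using *[of "-4"] by simp
  show "Im (\<tau> / (1 + 4 * \<tau>)) > 0" using *[of "4"] by simp
qed

text \<open>Substituting \<open>\<tau> / (1 - 4 * \<tau>)\<close>. The move is invertible, which
  gives an equivalence, so the descent can apply it in either direction.\<close>

lemma theta_law_parabolic:
  assumes "e mod 4 = 1" "coprime c e"
  shows "theta_law (c + 4 * e) e \<longleftrightarrow> theta_law c e"
proof -
  have nz: "1 - 4 * \<tau> \<noteq> 0" if "Im \<tau> > 0" for \<tau> using that by (auto simp: complex_eq_iff)
  have key: "Theta 1 0 ((of_int (a + 4 * b) * \<tau>' + of_int b) / (of_int (c + 4 * e) * \<tau>'
      + of_int e)) =
       of_int (quadratic_symbol (c + 4 * e) e) * csqrt (of_int (c + 4 * e) * \<tau>' + of_int e) * Theta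
           1 0 \<tau>'
     \<longleftrightarrow> Theta 1 0 ((of_int a * \<tau> + of_int b) / (of_int c * \<tau> + of_int e)) =
     of_int (quadratic_symbol c e) * csqrt (of_int c * \<tau> + of_int e) * Theta 1 0 \<tau>"
    if t: "Im \<tau> > 0" "\<tau>' = \<tau> / (1 - 4 * \<tau>)" for a b :: int and \<tau> \<tau>'
    unfolding t(2) parabolic_conjugation[OF nz[OF t(1)]] Theta_1_0_parabolic[OF t(1)]
    using automorphy_factor_step[OF assms t(1)] by (simp only: mult.assoc[symmetric])
  show ?thesis
  proof
    assume L: "theta_law (c + 4 * e) e"
    show "theta_law c e" unfolding theta_law_def
    proof (intro allI impI)
      fix a b \<tau> assume d: "a * e - b * c = 1" and t: "Im \<tau> > 0"
      have "(a + 4 * b) * e - b * (c + 4 * e) = 1" using d by (simp add: algebra_simps)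
      then show "Theta 1 0 ((of_int a * \<tau> + of_int b) / (of_int c * \<tau> + of_int e)) =
        of_int (quadratic_symbol c e) * csqrt (of_int c * \<tau> + of_int e) * Theta 1 0 \<tau>"
        using L Im_divide_one_minus_4[OF t] key[OF t refl, of a b] unfolding theta_law_def by blast
    qed
  next
    assume L: "theta_law c e"
    show "theta_law (c + 4 * e) e" unfolding theta_law_def
    proof (intro allI impI)
      fix a b \<tau>' assume d: "a * e - b * (c + 4 * e) = 1" and t: "Im \<tau>' > 0"
      \<comment> \<open>The inverse substitution:
        \<open>\<tau>' = ?t / (1 - 4 * ?t)\<close>.\<close>
      let ?t = "\<tau>' / (1 + 4 * \<tau>')"
      have d': "(a - 4 * b) * e - b * c = 1" using d by (simp add: algebra_simps)
      have t': "Im ?t > 0" using Im_divide_one_minus_4[OF t] by simp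
      have "1 + 4 * \<tau>' \<noteq> 0" using t by (auto simp: complex_eq_iff)
      then have "1 - 4 * ?t = 1 / (1 + 4 * \<tau>')" by (simp add: field_simps)
      then have "\<tau>' = ?t / (1 - 4 * ?t)" using \<open>1 + 4 * \<tau>' \<noteq> 0\<close> by simp
      note key = key[OF t' this, of "a - 4 * b" b, unfolded diff_add_cancel]
      have "Theta 1 0 ((of_int (a - 4 * b) * ?t + of_int b) / (of_int c * ?t + of_int e)) =
        of_int (quadratic_symbol c e) * csqrt (of_int c * ?t + of_int e) * Theta 1 0 ?t"
        using L d' t' unfolding theta_law_def by blast
      with key show "Theta 1 0 ((of_int a * \<tau>' + of_int b) / (of_int (c + 4 * e) * \<tau>' + of_int e)) =
        of_int (quadratic_symbol (c + 4 * e) e) * csqrt (of_int (c + 4 * e) * \<tau>' + of_int e) * Theta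
            1 0 \<tau>'"
        by (simp only:)
    qed
  qed
qed

text \<open>Euclid's algorithm on the bottom row: one of the four moves strictly decreases
  \<open>\<bar>c\<bar> + \<bar>e\<bar>\<close>, since \<open>\<bar>c\<bar> = 2 \<bar>e\<bar>\<close> is excluded modulo 4.\<close>

theorem theta_law_holds:
  assumes "4 dvd c" "e mod 4 = 1" "coprime c e"
  shows "theta_law c e"
  using assms
proof (induction "nat (\<bar>c\<bar> + \<bar>e\<bar>)" arbitrary: c e rule: less_induct)
  case less
  have IH: "theta_law c' e'" if "\<bar>c'\<bar> + \<bar>e'\<bar> < \<bar>c\<bar> + \<bar>e\<bar>" "4 dvd c'" "e' mod 4 = 1" "coprime c' e'"
      for c' e'
    using less(1)[of c' e'] that by simp
  show ?case
  proof (cases "c = 0")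
    case True
    then have "e = 1" using less(3,4) unit_mod_4_eq_1 by simp
    then show ?thesis using True Theta_add_of_int[of 1 0]
      by (auto simp: theta_law_def quadratic_symbol_jacobi)
  next
    case False
    have "\<bar>c\<bar> \<noteq> 2 * \<bar>e\<bar>" using less(2,3) by presburger
    then consider "\<bar>c\<bar> < 2 * \<bar>e\<bar>" | "2 * \<bar>e\<bar> < \<bar>c\<bar>" by linarith
    then show ?thesis
    proof cases
      case 1
      \<comment> \<open>As \<open>c\<close> is non-zero and
        \<open>\<bar>c\<bar> < 2 * \<bar>e\<bar>\<close>, adding or subtracting \<open>c\<close>
        once shortens \<open>e\<close>.\<close>
      obtain k :: int where k: "\<bar>e + k * c\<bar> < \<bar>e\<bar>" "k = 1 \<or> k = -1"
      proof (cases "(e > 0) = (c > 0)")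
        case True
        then show ?thesis using 1 False by (intro that[of "-1"]) auto
      next
        case f: False
        then show ?thesis using 1 False by (intro that[of 1]) auto
      qed
      have "theta_law c (e + k * c)"
      proof (rule IH)
        show "(e + k * c) mod 4 = 1" using k(2) less(2,3) by (auto elim!: dvdE) presburger+
        show "coprime c (e + k * c)"
          using less(4) by (metis coprime_iff_gcd_eq_1 gcd_add_mult add.commute)
      qed (use k less in auto)
      then show ?thesis using less(2-4) by (intro theta_law_translate[of c e k])
    next
      case 2
      have cop: "coprime (c + k * e) e" for k
        using less(4) by (metis coprime_iff_gcd_eq_1 gcd_add_mult gcd.commute add.commute)
      have enz: "e \<noteq> 0" using less(3) by auto
      \<comment> \<open>Since \<open>\<bar>c\<bar> > 2 * \<bar>e\<bar>\<close> and \<open>e\<close>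
        is non-zero, moving \<open>c\<close> by \<open>4 * e\<close> towards 0 shortens it, even if
        its sign changes.\<close>
      show ?thesis
      proof (cases "(e > 0) = (c > 0)")
        case True
        have "theta_law (c - 4 * e) e"
          using less True 2 enz False cop[of "-4"]
              by (intro IH) (auto simp: abs_if split: if_splits)
        then show ?thesis
          using theta_law_parabolic[of e "c - 4 * e"] less(3) cop[of "-4"] by simp
      next
        case f: False
        have "theta_law (c + 4 * e) e"
          using less f 2 enz False cop[of "4"] by (intro IH) (auto simp: abs_if split: if_splits)
        then show ?thesis
          using theta_law_parabolic[of e "c"] less(3,4) by simp
      qed
    qed
  qed
qed

section \<open>Finite Fourier analysis and the law for residue classes\<close>

lemma sum_periodic_shift:
  fixes F :: "int \<Rightarrow> 'a::comm_monoid_add"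
  assumes "C > 0" "\<And>j. F (j + C) = F j"
  shows "(\<Sum>j\<in>{0..<C}. F (j + s)) = (\<Sum>j\<in>{0..<C}. F j)"
proof -
  have nat: "F (j + int k * C) = F j" for j k
  proof (induction k)
    case (Suc k)
    have "j + int (Suc k) * C = (j + int k * C) + C" by (simp add: algebra_simps)
    then show ?case using assms(2) Suc by (simp only:)
  qed simp
  have per: "F (j + k * C) = F j" for j k
  proof (cases "k \<ge> 0")
    case True
    then show ?thesis using nat[of j "nat k"] by simp
  next
    case False
    then show ?thesis using nat[of "j + k * C" "nat (- k)"] by simp
  qed
  have md: "F (j mod C) = F j" for j
    using per[of "j mod C" "j div C"] by (simp add: add.commute)
  show ?thesis
  proof (rule sum.reindex_bij_witness[of _ "\<lambda>j. (j - s) mod C" "\<lambda>j. (j + s) mod C"])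
    fix j assume "j \<in> {0..<C}"
    then show "((j + s) mod C - s) mod C = j" "((j - s) mod C + s) mod C = j"
      by (simp_all add: mod_simps)
    show "F ((j + s) mod C) = F (j + s)" by (rule md)
  qed (use assms(1) in auto)
qed

lemma ee_eq_1_iff:
  assumes "q \<noteq> 0"
  shows "ee (of_int m / of_int q) = 1 \<longleftrightarrow> q dvd m"
proof
  assume "ee (of_int m / of_int q) = 1"
  then obtain n :: int where "Im (2 * of_real pi * \<i> * (of_int m / of_int q)) = of_int (2 * n) * pi"
    unfolding ee_def exp_eq_1 by blast
  moreover have "2 * of_real pi * \<i> * (of_int m / of_int q)
      = \<i> * complex_of_real (2 * pi * (of_int m / of_int q))"
    by simp
  ultimately have "2 * pi * (of_int m / of_int q) = of_int (2 * n) * pi"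
    by (simp only: Im_i_times Re_complex_of_real)
  then have "(2 * pi) * (of_int m / of_int q) = (2 * pi) * of_int n"
      by (simp only: of_int_mult mult_ac of_int_numeral)
  then have "real_of_int m / real_of_int q = of_int n"
    by (subst (asm) mult_left_cancel) auto
  then have "real_of_int m = real_of_int (q * n)" using assms by (simp add: field_simps)
  then show "q dvd m" by (metis dvd_triv_left of_int_eq_iff)
next
  assume "q dvd m"
  then have "[m = 0] (mod q)" by (simp add: cong_0_iff)
  from ee_cong[OF this] show "ee (of_int m / of_int q) = 1" by simp
qed

text \<open>Shifting the index multiplies the sum by \<open>ee (m / q)\<close>, which differs from 1
  unless \<open>q\<close> divides \<open>m\<close>.\<close>

lemma sum_ee_orthogonality:
  assumes "q > 0"
  shows "(\<Sum>j\<in>{0..<q}. ee (of_int (j * m) / of_int q)) = (if q dvd m then of_int q else 0)"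
proof (cases "q dvd m")
  case True
  then have "ee (of_int (j * m) / of_int q) = 1" for j
    using assms by (subst ee_eq_1_iff) auto
  then show ?thesis using True assms by simp
next
  case False
  let ?F = "\<lambda>j. ee (of_int (j * m) / of_int q)"
  have "(\<Sum>j\<in>{0..<q}. ?F j) = (\<Sum>j\<in>{0..<q}. ?F (j + 1))"
  proof (rule sum_periodic_shift[symmetric])
    show "?F (j + q) = ?F j" for j
      by (rule ee_cong) (simp add: cong_iff_dvd_diff algebra_simps)
  qed fact
  also have "\<dots> = (\<Sum>j\<in>{0..<q}. ?F j) * ee (of_int m / of_int q)"
  proof -
    have "?F (j + 1) = ?F j * ee (of_int m / of_int q)" for j
      unfolding ee_add[symmetric] by (simp add: add_divide_distrib algebra_simps)
    then show ?thesis by (simp only: sum_distrib_right)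
  qed
  finally have "(\<Sum>j\<in>{0..<q}. ?F j) = 0"
    using ee_eq_1_iff[of q m] False assms by simp
  then show ?thesis using False by simp
qed

text \<open>A residue class modulo a prime is determined up to sign by its square, and \<open>Theta p\<close> is even in
  the residue, so it can be recovered from rational translates of the classical theta function.\<close>

lemma Theta_eq_sum_translates:
  fixes p :: int
  assumes "prime p"
  obtains w where "\<And>\<tau>. Im \<tau> > 0 \<Longrightarrow> Theta p h \<tau>
      = (\<Sum>j\<in>{0..<p}. w j * Theta 1 0 (\<tau> + of_int j / of_int p))"
proof
  have p: "p > 0" using assms prime_gt_0_int by blast
  \<comment> \<open>\<open>I\<close> collects the residues of \<open>h\<close> and
    \<open>- h\<close>. Its size enters only as a non-zero factor, which covers \<open>p = 2\<close>
    and \<open>p dvd h\<close> as well.\<close>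
  define I where "I = {i \<in> {0..<p}. p dvd i\<^sup>2 - h\<^sup>2}"
  have "h mod p \<in> I"
    using p by (auto simp: I_def mod_eq_dvd_iff[symmetric] power_mod)
  moreover have "finite I" unfolding I_def by (rule finite_subset[of _ "{0..<p}"]) auto
  ultimately have card: "card I \<noteq> 0" by auto
  fix \<tau> :: complex assume \<tau>: "Im \<tau> > 0"
  let ?e = "\<lambda>m. ee (of_int m / of_int p)"
  have "(\<Sum>j\<in>{0..<p}. ?e (- (j * h\<^sup>2)) * Theta 1 0 (\<tau> + of_int j / of_int p))
    = (\<Sum>j\<in>{0..<p}. \<Sum>i\<in>{0..<p}. ?e (j * (i\<^sup>2 - h\<^sup>2)) * Theta p i \<tau>)"
  proof (rule sum.cong[OF refl])
    fix j
    have "Theta 1 0 (\<tau> + of_int j / of_int p) = (\<Sum>i\<in>{0..<p}. ?e (j * i\<^sup>2) * Theta p i \<tau>)"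
      using Theta_add_rational[of 1 p \<tau> 0 j] p \<tau> by (simp add: add.commute)
    moreover have "?e (- (j * h\<^sup>2)) * ?e (j * i\<^sup>2) = ?e (j * (i\<^sup>2 - h\<^sup>2))" for i
      unfolding ee_add[symmetric]
          by (simp add: add_divide_distrib diff_divide_distrib algebra_simps)
    ultimately show "?e (- (j * h\<^sup>2)) * Theta 1 0 (\<tau> + of_int j / of_int p)
        = (\<Sum>i\<in>{0..<p}. ?e (j * (i\<^sup>2 - h\<^sup>2)) * Theta p i \<tau>)"
      by (simp add: sum_distrib_left mult.assoc[symmetric])
  qed
  also have "\<dots> = (\<Sum>i\<in>{0..<p}. (\<Sum>j\<in>{0..<p}. ?e (j * (i\<^sup>2 - h\<^sup>2))) * Theta p i \<tau>)"
    by (subst sum.swap) (simp only: sum_distrib_right)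
  also have "\<dots> = (\<Sum>i\<in>I. of_int p * Theta p i \<tau>)"
    unfolding sum_ee_orthogonality[OF p] I_def by (rule sum.mono_neutral_cong_right) auto
  also have "\<dots> = (\<Sum>i\<in>I. of_int p * Theta p h \<tau>)"
  proof (rule sum.cong[OF refl])
    fix i assume "i \<in> I"
    then have "p dvd (i - h) * (i + h)" by (simp add: I_def power2_eq_square algebra_simps)
    then have "[i = h] (mod p) \<or> [i = - h] (mod p)"
      using assms by (simp add: prime_dvd_mult_iff cong_iff_dvd_diff)
    then have "Theta p i \<tau> = Theta p h \<tau>" using Theta_cong Theta_uminus by metis
    then show "of_int p * Theta p i \<tau> = of_int p * Theta p h \<tau>" by simp
  qed
  also have "\<dots> = of_nat (card I) * of_int p * Theta p h \<tau>" by simp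
  finally have eq: "(\<Sum>j\<in>{0..<p}. ?e (- (j * h\<^sup>2)) * Theta 1 0 (\<tau> + of_int j / of_int p))
      = of_nat (card I) * of_int p * Theta p h \<tau>" .
  have nz: "of_nat (card I) * of_int p \<noteq> (0 :: complex)" using card p by simp
  have "(\<Sum>j\<in>{0..<p}. (?e (- (j * h\<^sup>2)) / (of_nat (card I) * of_int p))
      * Theta 1 0 (\<tau> + of_int j / of_int p))
    = (\<Sum>j\<in>{0..<p}. ?e (- (j * h\<^sup>2)) * Theta 1 0 (\<tau> + of_int j / of_int p))
        / (of_nat (card I) * of_int p)"
    unfolding sum_divide_distrib by (simp only: times_divide_eq_left)
  also have "\<dots> = Theta p h \<tau>" unfolding eq using nz by simp
  finally show "Theta p h \<tau> = (\<Sum>j\<in>{0..<p}. (?e (- (j * h\<^sup>2)) / (of_nat (card I) * of_int p))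
      * Theta 1 0 (\<tau> + of_int j / of_int p))"
    by (rule sym)
qed

lemma Im_moebius:
  fixes a b c e :: int
  shows "Im ((of_int a * \<tau> + of_int b) / (of_int c * \<tau> + of_int e))
      = of_int (a * e - b * c) * Im \<tau> / (norm (of_int c * \<tau> + of_int e))\<^sup>2"
proof -
  have "Im (x / y) = (Im x * Re y - Re x * Im y) / (norm y)\<^sup>2" for x y
    by (simp add: Im_divide cmod_power2)
  then show ?thesis by (simp add: algebra_simps)
qed

text \<open>Conjugation by the translation by \<open>j / p\<close> keeps the matrix integral,
  because \<open>p^2\<close> divides \<open>c\<close> and \<open>a\<close> is congruent to
  \<open>e\<close> modulo \<open>p\<close>. Each classical translate thus obeys the law with the
  same factor.\<close>

theorem Theta_transformation:
  fixes p a b c e :: int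
  assumes p: "prime p" and det: "a * e - b * c = 1" and c: "4 * p\<^sup>2 dvd c"
    and e: "e mod 4 = 1" and ae: "[a = e] (mod p)" and t: "Im \<tau> > 0"
  shows "Theta p h ((of_int a * \<tau> + of_int b) / (of_int c * \<tau> + of_int e)) =
     of_int (quadratic_symbol c e) * csqrt (of_int c * \<tau> + of_int e) * Theta p h \<tau>"
proof -
  have p0: "p > 0" using p prime_gt_0_int by blast
  obtain m where "c = 4 * p\<^sup>2 * m" using c by (elim dvdE)
  then obtain d where d: "c = p\<^sup>2 * d" "4 dvd d" by (intro that[of "4 * m"]) auto
  have "p dvd e - a" using cong_sym[OF ae] by (simp add: cong_iff_dvd_diff)
  then obtain l where l: "e - a = p * l" by (elim dvdE)
  let ?g = "(of_int a * \<tau> + of_int b) / (of_int c * \<tau> + of_int e)"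
  let ?s = "of_int (quadratic_symbol c e) * csqrt (of_int c * \<tau> + of_int e)"
  have nz: "of_int c * \<tau> + of_int e \<noteq> 0"
  proof
    assume z: "of_int c * \<tau> + of_int e = 0"
    then have "Im (of_int c * \<tau> + of_int e) = 0" by simp
    then have "c = 0" using t by simp
    then show False using z e by auto
  qed
  have cop: "coprime p (e + k * (p * d))" "coprime d (e + k * (p * d))" for k
  proof -
    have "coprime (p * d) e"
    proof (rule coprimeI)
      fix x assume "x dvd p * d" "x dvd e"
      then have "x dvd c" using dvd_mult[of x "p * d" p]
          by (simp add: d(1) power2_eq_square mult.assoc)
      then have "x dvd a * e - b * c" using \<open>x dvd e\<close> by simp
      then show "is_unit x" using det by simp
    qed
    then have "coprime (p * d) (e + k * (p * d))"
      by (metis coprime_iff_gcd_eq_1 gcd_add_mult add.commute)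
    then show "coprime p (e + k * (p * d))" "coprime d (e + k * (p * d))" by simp_all
  qed
  have emod: "(e + k * (p * d)) mod 4 = 1" for k
    using e d(2) by (auto elim!: dvdE simp: mod_add_eq[symmetric])
  have odd: "odd x" if "x mod 4 = 1" for x :: int using that by presburger
  \<comment> \<open>Without its square factor \<open>p^2\<close>, the numerator \<open>c\<close>
    becomes \<open>d\<close>, and the shift \<open>k * (p * d)\<close> is a multiple of it.\<close>
  have sym: "quadratic_symbol c (e + k * (p * d)) = quadratic_symbol c e" for k
  proof -
    have "quadratic_symbol c (e + k * (p * d)) = quadratic_symbol d (e + k * (p * d))" for k
      unfolding d(1) using cop p0 odd[OF emod]
      by (intro quadratic_symbol_square_mult_left) auto
    note s = this[of k] this[of 0]
    have "quadratic_symbol d (e + (k * p) * d) = quadratic_symbol d e"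
      using e d(2) cop(2)[of 0] by (intro quadratic_symbol_add_multiple_right) auto
    then show ?thesis using s by (simp add: mult.assoc)
  qed
  have step: "Theta 1 0 (?g + of_int j / of_int p) = ?s * Theta 1 0 (\<tau> + of_int j / of_int p)" for j
  proof -
    let ?t = "\<tau> + of_int j / of_int p"
    \<comment> \<open>Entries of the matrix conjugated by the translation by \<open>j / p\<close>,
      rewritten with \<open>c = p^2 * d\<close> and \<open>e - a = p * l\<close>.\<close>
    let ?a = "a + j * (p * d)" and ?b = "b + j * l - j\<^sup>2 * d" and ?e = "e + (- j) * (p * d)"
    have "theta_law c ?e"
    proof (rule theta_law_holds)
      show "4 dvd c" using d by simp
      show "coprime c ?e" using cop[of "- j"] d(1) by simp
    qed (rule emod)
    moreover have "?a * ?e - ?b * c = 1"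
    proof -
      have "?a * ?e - ?b * c = (a * e - b * c) + j * (p * d) * (e - a) - j * l * c - j\<^sup>2
          * ((p * d)\<^sup>2 - d * c)"
        by (simp add: power2_eq_square algebra_simps)
      also have "\<dots> = 1" unfolding l det by (simp add: d(1) power2_eq_square algebra_simps)
      finally show ?thesis .
    qed
    moreover have "Im ?t > 0" using t by (simp add: Im_divide)
    ultimately have "Theta 1 0 ((of_int ?a * ?t + of_int ?b) / (of_int c * ?t + of_int ?e)) =
       of_int (quadratic_symbol c ?e) * csqrt (of_int c * ?t + of_int ?e) * Theta 1 0 ?t"
      unfolding theta_law_def by blast
    moreover have den: "of_int c * ?t + of_int ?e = of_int c * \<tau> + of_int e"
      using p0 by (simp add: d(1) field_simps power2_eq_square)
    moreover have "(of_int ?a * ?t + of_int ?b) / (of_int c * ?t + of_int ?e)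
        = ?g + of_int j / of_int p"
    proof -
      have pz: "(of_int p :: complex) \<noteq> 0" using p0 by simp
      have "e = a + p * l" using l by simp
      then have ez: "(of_int e :: complex) = of_int a + of_int p * of_int l" by simp
      have num: "of_int ?a * ?t + of_int ?b = (of_int a * \<tau> + of_int b) + (of_int j / of_int p)
          * (of_int c * \<tau> + of_int e)"
        unfolding d(1) ez using pz by (simp add: field_simps power2_eq_square)
      show ?thesis unfolding den num using nz by (simp add: add_divide_distrib)
    qed
    ultimately show ?thesis unfolding sym by (simp only:)
  qed
  obtain w where w: "\<And>\<tau>. Im \<tau> > 0 \<Longrightarrow> Theta p h \<tau>
      = (\<Sum>j\<in>{0..<p}. w j * Theta 1 0 (\<tau> + of_int j / of_int p))"
    using Theta_eq_sum_translates[OF p] by blast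
  have "Im ?g > 0"
  proof -
    show ?thesis unfolding Im_moebius det using t nz by simp
  qed
  from w[OF this] show ?thesis unfolding step w[OF t]
    by (simp add: sum_distrib_left mult_ac)
qed

section \<open>Behaviour at the cusps\<close>

text \<open>Testing vanishing on absolute values removes the need to follow the arguments of complex
  square roots.\<close>

lemma tendsto_0_iff_norm_limit:
  assumes "F \<noteq> bot" "((\<lambda>x. norm (f x)) \<longlongrightarrow> l) F"
  shows "(f \<longlongrightarrow> 0) F \<longleftrightarrow> l = 0"
proof
  assume "(f \<longlongrightarrow> 0) F"
  then have "((\<lambda>x. norm (f x)) \<longlongrightarrow> 0) F" by (rule tendsto_norm_zero)
  then show "l = 0" using tendsto_unique[OF assms] by blast
qed (use assms(2) in \<open>auto intro: tendsto_norm_zero_cancel\<close>)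

text \<open>A Gauss sum over one residue class, with \<open>x = p * j + h\<close>. The absolute
  value in the range admits negative \<open>c\<close>.\<close>

definition cusp_sum :: "int \<Rightarrow> int \<Rightarrow> int \<Rightarrow> int \<Rightarrow> complex" where
  "cusp_sum p a c h = (\<Sum>j\<in>{0..<\<bar>c\<bar>}. ee (of_int (a * (p * j + h)\<^sup>2) / of_int c))"

text \<open>Splits off the cusp \<open>a / c\<close>; the remaining term is suited to
  inversion.\<close>

lemma moebius_eq_add:
  fixes a b c e :: int and \<tau> :: complex
  assumes "a * e - b * c = 1" "c \<noteq> 0" "of_int c * \<tau> + of_int e \<noteq> 0"
  shows "(of_int a * \<tau> + of_int b) / (of_int c * \<tau> + of_int e) =
     of_int a / of_int c + - 1 / (of_int c * (of_int c * \<tau> + of_int e))"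
proof -
  have c: "(of_int c :: complex) \<noteq> 0" using assms(2) by simp
  have "(of_int a * of_int e - of_int b * of_int c :: complex) = 1"
    using assms(1) by (metis of_int_1 of_int_diff of_int_mult)
  then have "of_int c * (of_int a * \<tau> + of_int b) = of_int a * (of_int c * \<tau> + of_int e) - 1"
    by (simp add: algebra_simps)
  then have "of_int c * (of_int a * \<tau> + of_int b) / (of_int c * (of_int c * \<tau> + of_int e)) =
     (of_int a * (of_int c * \<tau> + of_int e) - 1) / (of_int c * (of_int c * \<tau> + of_int e))"
         by (simp only:)
  then show ?thesis using c assms(3) by (simp add: diff_divide_distrib)
qed

lemma eventually_Im_gt_0: "\<forall>\<^sub>F \<tau> in filtercomap Im at_top. Im \<tau> > 0"
  using eventually_filtercomapI[OF eventually_gt_at_top[of 0]] .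

text \<open>Translation by \<open>a / c\<close> leads to series of level
  \<open>p * \<bar>c\<bar>\<close>; after inversion each of them tends to 1, so only the phases are
  summed.\<close>

lemma Theta_tendsto_at_cusp:
  fixes p a b c e :: int
  assumes "p > 0" "a * e - b * c = 1" "c \<noteq> 0"
  shows "((\<lambda>\<tau>. csqrt (2 * \<i> * of_int (p * \<bar>c\<bar>) ^ 2 / (of_int c * (of_int c * \<tau> + of_int e)))
           * Theta p h ((of_int a * \<tau> + of_int b) / (of_int c * \<tau> + of_int e)))
     \<longlongrightarrow> cusp_sum p a c h) (filtercomap Im at_top)"
proof -
  define N where "N = p * \<bar>c\<bar>"
  define W :: "complex \<Rightarrow> complex" where "W = (\<lambda>\<tau>. of_int c * (of_int c * \<tau> + of_int e))"
  define t where "t = (\<lambda>\<tau>. 2 * \<i> * of_int N ^ 2 / W \<tau>)"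
  have N: "N > 0" using assms by (simp add: N_def)
  have ImW: "Im (W \<tau>) = of_int (c\<^sup>2) * Im \<tau>" for \<tau> by (simp add: W_def power2_eq_square)
  have Re_t: "Re (1 / t \<tau>) = of_int (c\<^sup>2) / of_int (2 * N\<^sup>2) * Im \<tau>" if "Im \<tau> > 0" for \<tau>
  proof -
    \<comment> \<open>The reciprocal of \<open>t \<tau>\<close>, written with a real denominator so
      that its real part can be read off.\<close>
    let ?Z = "- \<i> * W \<tau> / complex_of_real (of_int (2 * N\<^sup>2))"
    have "Im (W \<tau>) > 0" using that assms(3) by (simp add: ImW)
    then have "W \<tau> \<noteq> 0" by auto
    then have 1: "t \<tau> * ?Z = 1" using N by (simp add: t_def)
    then have "t \<tau> \<noteq> 0" by auto
    with 1 have "1 / t \<tau> = ?Z" by (simp add: field_simps)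
    then show ?thesis by (simp only: Re_divide_of_real) (simp add: ImW)
  qed
  have "filterlim (\<lambda>\<tau>. of_int (c\<^sup>2) / of_int (2 * N\<^sup>2) * Im \<tau>) at_top (filtercomap Im at_top)"
    using assms N
        by (intro filterlim_tendsto_pos_mult_at_top[OF tendsto_const] filterlim_filtercomap) auto
  moreover have "\<forall>\<^sub>F \<tau> in filtercomap Im at_top. of_int (c\<^sup>2) / of_int (2 * N\<^sup>2) * Im \<tau>
      = Re (1 / t \<tau>)"
    using eventually_Im_gt_0 by eventually_elim (simp add: Re_t)
  ultimately have lim: "filterlim (\<lambda>\<tau>. Re (1 / t \<tau>)) at_top (filtercomap Im at_top)"
    using filterlim_cong by fast
  have "((\<lambda>\<tau>. \<Sum>j\<in>{0..<\<bar>c\<bar>}. ee (of_int (a * (p * j + h)\<^sup>2) / of_int c)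
      * jtheta (1 / t \<tau>) (of_int (p * j + h) / of_int N))
     \<longlongrightarrow> (\<Sum>j\<in>{0..<\<bar>c\<bar>}. ee (of_int (a * (p * j + h)\<^sup>2) / of_int c) * 1)) (filtercomap Im at_top)"
    by (intro tendsto_intros jtheta_tendsto_1[OF lim]) simp
  moreover have "\<forall>\<^sub>F \<tau> in filtercomap Im at_top.
     (\<Sum>j\<in>{0..<\<bar>c\<bar>}. ee (of_int (a * (p * j + h)\<^sup>2) / of_int c) * jtheta (1 / t \<tau>)
         (of_int (p * j + h) / of_int N))
     = csqrt (t \<tau>) * Theta p h ((of_int a * \<tau> + of_int b) / (of_int c * \<tau> + of_int e))"
    using eventually_Im_gt_0
  proof eventually_elim
    case (elim \<tau>)
    define z where "z = - 1 / W \<tau>"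
    have W: "Im (W \<tau>) > 0" using elim assms(3) by (simp add: ImW)
    then have Wnz: "W \<tau> \<noteq> 0" by auto
    have z: "Im z > 0" using W Wnz
        by (simp add: z_def Im_divide sum_power2_gt_zero_iff complex_eq_iff)
    have tz: "t \<tau> = - 2 * \<i> * of_int N ^ 2 * z" by (simp add: t_def z_def)
    have tnz: "csqrt (t \<tau>) \<noteq> 0" using N Wnz by (simp add: t_def)
    have "Theta N x z = jtheta (1 / t \<tau>) (of_int x / of_int N) / csqrt (t \<tau>)" for x
      unfolding tz using N z by (rule Theta_inversion)
    then have J: "csqrt (t \<tau>) * Theta N x z = jtheta (1 / t \<tau>) (of_int x / of_int N)" for x
      using tnz by simp
    have "(of_int a * \<tau> + of_int b) / (of_int c * \<tau> + of_int e) = of_int a / of_int c + z"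
      unfolding z_def W_def using assms Wnz by (intro moebius_eq_add) (auto simp: W_def)
    then have T: "Theta p h ((of_int a * \<tau> + of_int b) / (of_int c * \<tau> + of_int e)) =
      (\<Sum>j\<in>{0..<\<bar>c\<bar>}. ee (of_int (a * (p * j + h)\<^sup>2) / of_int c) * Theta N (p * j + h) z)"
      using Theta_add_rational[OF assms(1,3) z, of h a] by (simp add: N_def)
    show ?case unfolding T sum_distrib_left J[symmetric]
      by (intro sum.cong refl) (rule mult.left_commute)
  qed
  ultimately show ?thesis
    unfolding cusp_sum_def t_def W_def N_def using tendsto_cong by fastforce
qed

text \<open>The limit of the theta series at the cusp \<open>a / c\<close>, normalized by the root
  of \<open>Theta_tendsto_at_cusp\<close> once per coordinate.\<close>

definition cusp_value :: "nat \<Rightarrow> (int^'n \<Rightarrow> complex) \<Rightarrow> int \<Rightarrow> int \<Rightarrow> complex" where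
  "cusp_value p f a c = (\<Sum>r\<in>residue_vectors p. f r * (\<Prod>i\<in>UNIV. cusp_sum (int p) a c (r $ i)))"

lemma filtercomap_Im_at_top_neq_bot: "filtercomap Im at_top \<noteq> bot"
  by (rule filtercomap_neq_bot_surj[OF _ surjI[of _ "Complex 0"]]) auto

text \<open>The root normalizing the one-dimensional limits and the automorphy factor have a product
  of constant absolute value \<open>\<kappa>\<close>, so either normalization detects
  vanishing.\<close>

lemma theta_vanishes_at_cusp_iff:
  fixes f :: "int^'n \<Rightarrow> complex" and a b c e :: int
  assumes "p > 0" "a * e - b * c = 1" "c \<noteq> 0"
  shows "((\<lambda>\<tau>. inverse (csqrt (of_int c * \<tau> + of_int e) ^ CARD('n)) *
       theta p f ((of_int a * \<tau> + of_int b) / (of_int c * \<tau> + of_int e))) \<longlongrightarrow> 0)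
           (filtercomap Im at_top)
     \<longleftrightarrow> cusp_value p f a c = 0" (is "(?L \<longlongrightarrow> 0) ?F \<longleftrightarrow> _")
proof -
  let ?g = "\<lambda>\<tau>. (of_int a * \<tau> + of_int b) / (of_int c * \<tau> + of_int e)"
  define s where "s
      = (\<lambda>\<tau>. csqrt (2 * \<i> * of_int (int p * \<bar>c\<bar>) ^ 2 / (of_int c * (of_int c * \<tau> + of_int e))))"
  define \<kappa> where "\<kappa> = sqrt (2 * of_int (int p * \<bar>c\<bar>) ^ 2 / of_int \<bar>c\<bar>)"
  have \<kappa>: "\<kappa> > 0" using assms by (simp add: \<kappa>_def)
  have "((\<lambda>\<tau>. \<Sum>r\<in>residue_vectors p. f r * (\<Prod>i\<in>UNIV. s \<tau> * Theta (int p) (r $ i) (?g \<tau>)))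
      \<longlongrightarrow> cusp_value p f a c) ?F"
    unfolding cusp_value_def s_def using assms
    by (intro tendsto_intros Theta_tendsto_at_cusp) auto
  then have "((\<lambda>\<tau>. norm (\<Sum>r\<in>residue_vectors p. f r * (\<Prod>i\<in>UNIV. s \<tau> * Theta (int p) (r $ i) (?g \<tau>)))
      / \<kappa> ^ CARD('n))
      \<longlongrightarrow> norm (cusp_value p f a c) / \<kappa> ^ CARD('n)) ?F"
    using \<kappa> by (intro tendsto_intros) auto
  moreover have "\<forall>\<^sub>F \<tau> in ?F. norm (\<Sum>r\<in>residue_vectors p. f r
      * (\<Prod>i\<in>UNIV. s \<tau> * Theta (int p) (r $ i) (?g \<tau>))) / \<kappa> ^ CARD('n) = norm (?L \<tau>)"
    using eventually_Im_gt_0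
  proof eventually_elim
    case (elim \<tau>)
    let ?D = "of_int c * \<tau> + of_int e :: complex"
    have D: "?D \<noteq> 0" using elim assms(3) by (auto simp: complex_eq_iff)
    have "Im (?g \<tau>) > 0" unfolding Im_moebius assms(2) using elim D by simp
    then have "s \<tau> ^ CARD('n) * theta p f (?g \<tau>)
        = (\<Sum>r\<in>residue_vectors p. f r * (\<Prod>i\<in>UNIV. s \<tau> * Theta (int p) (r $ i) (?g \<tau>)))"
      using assms(1) by (simp add: theta_eq_sum_prod_Theta sum_distrib_left prod.distrib mult_ac)
    moreover have "norm (s \<tau>) * norm (csqrt ?D) = \<kappa>"
    proof -
      have "norm (s \<tau>) * norm (csqrt ?D)
          = sqrt (norm (2 * \<i> * of_int (int p * \<bar>c\<bar>) ^ 2 / (of_int c * ?D)) * norm ?D)"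
        unfolding s_def by (simp only: norm_csqrt real_sqrt_mult)
      also have "norm (2 * \<i> * of_int (int p * \<bar>c\<bar>) ^ 2 / (of_int c * ?D)) * norm ?D
          = 2 * of_int (int p * \<bar>c\<bar>) ^ 2 / of_int \<bar>c\<bar>"
        using D by (simp add: norm_mult norm_divide norm_power)
      finally show ?thesis by (simp add: \<kappa>_def)
    qed
    then have "norm (s \<tau>) / \<kappa> = inverse (norm (csqrt ?D))"
      using \<kappa> by (auto simp: field_simps)
    then have "norm (s \<tau>) ^ CARD('n) / \<kappa> ^ CARD('n) = inverse (norm (csqrt ?D) ^ CARD('n))"
      by (metis power_divide power_inverse)
    ultimately show ?case
      by (simp add: norm_mult norm_inverse norm_power flip: times_divide_eq_left)
          (metis (no_types, lifting) norm_mult norm_power times_divide_eq_left)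
  qed
  ultimately have lim: "((\<lambda>\<tau>. norm (?L \<tau>)) \<longlongrightarrow> norm (cusp_value p f a c) / \<kappa> ^ CARD('n)) ?F"
    using tendsto_cong by fastforce
  show ?thesis
    unfolding tendsto_0_iff_norm_limit[OF filtercomap_Im_at_top_neq_bot lim] using \<kappa> by simp
qed

lemma theta_add_of_int:
  fixes f :: "int^'n \<Rightarrow> complex"
  assumes "p > 0" "Im \<tau> > 0"
  shows "theta p f (\<tau> + of_int k) = theta p f \<tau>"
  using assms by (simp add: theta_eq_sum_prod_Theta Theta_add_of_int)

lemma theta_tendsto_at_infinity:
  fixes f :: "int^'n \<Rightarrow> complex"
  assumes "p > 0"
  shows "(theta p f \<longlongrightarrow> f (\<chi> i. 0)) (filtercomap Im at_top)"
proof -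
  have "((\<lambda>\<tau>. \<Sum>r\<in>residue_vectors p. f r * (\<Prod>i\<in>UNIV. Theta (int p) (r $ i) \<tau>))
      \<longlongrightarrow> (\<Sum>r\<in>residue_vectors p. f r * (\<Prod>i\<in>UNIV.
          if r $ i = 0 then 1 else 0))) (filtercomap Im at_top)"
    by (intro tendsto_intros Theta_tendsto_at_infinity)
        (use assms in \<open>auto simp: residue_vectors_def\<close>)
  moreover have "(\<Sum>r\<in>residue_vectors p. f r * (\<Prod>i\<in>UNIV. if r $ i = 0 then 1 else 0)) = f (\<chi> i. 0)"
  proof -
    have "(\<Sum>r\<in>residue_vectors p. f r * (\<Prod>i\<in>UNIV. if r $ i = 0 then 1 else 0)) = (\<Sum>r\<in>{\<chi> i. 0}. f r)"
    proof (rule sum.mono_neutral_cong_right[OF finite_residue_vectors])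
      show "\<forall>r\<in>residue_vectors p - {\<chi> i. 0}. f r * (\<Prod>i\<in>UNIV. if r $ i = 0 then 1 else 0) = 0"
        by (auto simp: vec_eq_iff)
    qed (use assms in \<open>auto simp: residue_vectors_def\<close>)
    then show ?thesis by simp
  qed
  moreover have "\<forall>\<^sub>F \<tau> in filtercomap Im at_top. (\<Sum>r\<in>residue_vectors p. f r
      * (\<Prod>i\<in>UNIV. Theta (int p) (r $ i) \<tau>)) = theta p f \<tau>"
    using eventually_Im_gt_0 by eventually_elim (use assms in \<open>simp add: theta_eq_sum_prod_Theta\<close>)
  ultimately show ?thesis using tendsto_cong by fastforce
qed

text \<open>The bottom row is \<open>(0, 1)\<close> or \<open>(0, -1)\<close>: the matrix acts as an
  integer translation and the automorphy factor has absolute value 1.\<close>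

lemma theta_vanishes_at_infinity_iff:
  fixes f :: "int^'n \<Rightarrow> complex" and a b e :: int
  assumes "p > 0" "a * e = 1"
  shows "((\<lambda>\<tau>. inverse (csqrt (of_int 0 * \<tau> + of_int e) ^ CARD('n)) *
       theta p f ((of_int a * \<tau> + of_int b) / (of_int 0 * \<tau> + of_int e))) \<longlongrightarrow> 0)
           (filtercomap Im at_top)
     \<longleftrightarrow> f (\<chi> i. 0) = 0" (is "(?L \<longlongrightarrow> 0) ?F \<longleftrightarrow> _")
proof -
  have ae: "a = e" "e = 1 \<or> e = -1" using assms(2) by (auto simp: zmult_eq_1_iff)
  have "((\<lambda>\<tau>. norm (theta p f \<tau>)) \<longlongrightarrow> norm (f (\<chi> i. 0))) ?F"
    by (intro tendsto_intros theta_tendsto_at_infinity assms)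
  moreover have "\<forall>\<^sub>F \<tau> in ?F. norm (theta p f \<tau>) = norm (?L \<tau>)"
    using eventually_Im_gt_0
  proof eventually_elim
    case (elim \<tau>)
    have "(of_int a * \<tau> + of_int b) / (of_int 0 * \<tau> + of_int e) = \<tau> + of_int (b * e)"
      using ae by auto
    moreover have "norm (csqrt (of_int 0 * \<tau> + of_int e)) = 1"
      unfolding norm_csqrt using ae(2) by auto
    ultimately show ?case
      using elim assms(1) by (simp only: theta_add_of_int norm_mult norm_inverse norm_power) simp
  qed
  ultimately have lim: "((\<lambda>\<tau>. norm (?L \<tau>)) \<longlongrightarrow> norm (f (\<chi> i. 0))) ?F"
    using tendsto_cong by fastforce
  show ?thesis
    unfolding tendsto_0_iff_norm_limit[OF filtercomap_Im_at_top_neq_bot lim] by simp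
qed

lemma theta_holomorphic:
  fixes f :: "int^'n \<Rightarrow> complex"
  assumes "p > 0"
  shows "theta p f holomorphic_on upper_half_plane"
proof (rule holomorphic_transform)
  show "(\<lambda>\<tau>. \<Sum>r\<in>residue_vectors p. f r * (\<Prod>i\<in>UNIV. Theta (int p) (r $ i) \<tau>))
      holomorphic_on upper_half_plane"
    using assms by (intro holomorphic_intros Theta_holomorphic) auto
qed (use assms in \<open>auto simp: theta_eq_sum_prod_Theta upper_half_plane_def\<close>)

text \<open>Boundedness at the cusps follows from vanishing there, and the transformation law from
  its one-dimensional case, so only the vanishing conditions remain. They depend on the first column
  of the matrix alone.\<close>

theorem cusp_form_theta_iff:
  fixes f :: "int^'n \<Rightarrow> complex"
  assumes p: "prime p"
    and \<Gamma>: "\<And>g. g \<in> \<Gamma> \<Longrightarrow> g \<in> SL2Z \<and> 4 * (int p)\<^sup>2 dvd g $ 2 $ 1 \<and> (g $ 2 $ 2) mod 4 = 1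
        \<and> [g $ 1 $ 1 = g $ 2 $ 2] (mod int p)"
  shows "cusp_form CARD('n) \<Gamma> (theta p f) \<longleftrightarrow>
     f (\<chi> i. 0) = 0 \<and> (\<forall>a c. c \<noteq> 0 \<longrightarrow> coprime a c \<longrightarrow> cusp_value p f a c = 0)"
proof -
  have p0: "p > 0" using p prime_gt_0_nat by blast
  let ?V = "\<lambda>g. ((\<lambda>\<tau>. inverse (root_factor g \<tau> ^ CARD('n)) * theta p f (act g \<tau>))
      \<longlongrightarrow> 0) (filtercomap Im at_top)"
  have det: "g $ 1 $ 1 * g $ 2 $ 2 - g $ 1 $ 2 * g $ 2 $ 1 = 1" if "g \<in> SL2Z" for g :: "int^2^2"
    using that by (simp add: SL2Z_def det_2)
  have V: "?V g \<longleftrightarrow> (if g $ 2 $ 1 = 0 then f (\<chi> i. 0) = 0 else cusp_value p f (g $ 1 $ 1) (g $ 2 $ 1)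
      = 0)" if "g \<in> SL2Z" for g
    unfolding root_factor_def act_def moebius_def
    using theta_vanishes_at_cusp_iff[OF p0 det[OF that], of f]
      theta_vanishes_at_infinity_iff[OF p0, of "g $ 1 $ 1" "g $ 2 $ 2" f "g $ 1 $ 2"] det[OF that]
    by auto
  have mf: "modular_form CARD('n) \<Gamma> (theta p f)" if all: "\<forall>g\<in>SL2Z. ?V g"
    unfolding modular_form_def
  proof (intro conjI ballI)
    show "theta p f holomorphic_on upper_half_plane" by (rule theta_holomorphic[OF p0])
    show "Bfun (\<lambda>\<tau>. inverse (root_factor g \<tau> ^ CARD('n)) * theta p f (act g \<tau>))
        (filtercomap Im at_top)" if "g \<in> SL2Z" for g
    proof -
      have "?V g" using all that by blast
      from tendstoD[OF this, of 1] show ?thesis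
        by (auto intro!: BfunI[of _ 1] elim: eventually_mono)
    qed
  next
    fix g \<tau> assume g: "g \<in> \<Gamma>" and "\<tau> \<in> upper_half_plane"
    then have t: "Im \<tau> > 0" by (simp add: upper_half_plane_def)
    define J where "J = of_int (quadratic_symbol (g $ 2 $ 1) (g $ 2 $ 2)) * root_factor g \<tau>"
    note G = \<Gamma>[OF g]
    have d: "g $ 1 $ 1 * g $ 2 $ 2 - g $ 1 $ 2 * g $ 2 $ 1 = 1" using det G by blast
    have T: "Theta (int p) h (act g \<tau>) = J * Theta (int p) h \<tau>" for h
      unfolding J_def act_def moebius_def root_factor_def
      using Theta_transformation[OF _ d _ _ _ t, of "int p" h] G p by simp
    have "of_int (g $ 2 $ 1) * \<tau> + of_int (g $ 2 $ 2) \<noteq> 0"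
    proof
      assume z: "of_int (g $ 2 $ 1) * \<tau> + of_int (g $ 2 $ 2) = 0"
      then have "Im (of_int (g $ 2 $ 1) * \<tau> + of_int (g $ 2 $ 2)) = 0" by simp
      then have "g $ 2 $ 1 = 0" using t by simp
      then show False using z G by auto
    qed
    then have "Im (act g \<tau>) > 0"
      unfolding act_def moebius_def Im_moebius d using t by simp
    then show "theta p f (act g \<tau>)
        = (of_int (quadratic_symbol (g $ 2 $ 1) (g $ 2 $ 2)) * root_factor g \<tau>) ^ CARD('n) * theta p
        f \<tau>"
      using p0 t unfolding J_def[symmetric]
      by (simp add: theta_eq_sum_prod_Theta T prod.distrib sum_distrib_left mult_ac)
  qed
  have "cusp_form CARD('n) \<Gamma> (theta p f) \<longleftrightarrow> (\<forall>g\<in>SL2Z. ?V g)"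
    unfolding cusp_form_def using mf by blast
  also have "\<dots> \<longleftrightarrow> f (\<chi> i. 0) = 0 \<and> (\<forall>a c. c \<noteq> 0 \<longrightarrow> coprime a c \<longrightarrow> cusp_value p f a c = 0)"
  proof (intro iffI conjI allI impI ballI)
    assume all: "\<forall>g\<in>SL2Z. ?V g"
    let ?M = "\<lambda>a b c e. vector [vector [a, b], vector [c, e]] :: int^2^2"
    have "?M 1 0 0 1 \<in> SL2Z" by (simp add: SL2Z_def det_2)
    then show "f (\<chi> i. 0) = 0" using all V[of "?M 1 0 0 1"] by simp
    fix a c :: int assume c: "c \<noteq> 0" "coprime a c"
    \<comment> \<open>Bezout completes the column \<open>(a, c)\<close> to a matrix of determinant
      1.\<close>
    obtain u v where "u * a + v * c = 1" using bezout_int[of a c] c(2) by auto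
    then have "?M a (- v) c u \<in> SL2Z" by (simp add: SL2Z_def det_2 mult.commute)
    then show "cusp_value p f a c = 0" using all V[of "?M a (- v) c u"] c by simp
  next
    fix g assume R: "f (\<chi> i. 0) = 0 \<and> (\<forall>a c. c \<noteq> 0 \<longrightarrow> coprime a c \<longrightarrow> cusp_value p f a c = 0)"
        and g: "g \<in> SL2Z"
    have "coprime (g $ 1 $ 1) (g $ 2 $ 1)"
    proof (rule coprimeI)
      fix x assume "x dvd g $ 1 $ 1" "x dvd g $ 2 $ 1"
      then have "x dvd g $ 1 $ 1 * g $ 2 $ 2 - g $ 1 $ 2 * g $ 2 $ 1" by simp
      then show "is_unit x" using det[OF g] by simp
    qed
    then show "?V g" using V[OF g] R by auto
  qed
  finally show ?thesis .
qed

section \<open>Gauss sums at the cusps\<close>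

text \<open>The mechanism behind the evaluations below: a shift to another class relates two Gauss
  sums, and a shift within the class with \<open>\<rho> \<noteq> 1\<close> forces the sum to
  vanish.\<close>

lemma cusp_sum_shift:
  assumes "\<And>x. [x = h] (mod p) \<Longrightarrow> ee (of_int (a * (x + k)\<^sup>2) / of_int c)
      = \<rho> * ee (of_int (a * x\<^sup>2) / of_int c)"
  shows "cusp_sum p a c (h + k) = \<rho> * cusp_sum p a c h"
  unfolding cusp_sum_def sum_distrib_left
proof (intro sum.cong refl)
  fix j
  have "[p * j + h = h] (mod p)" by (simp add: cong_iff_dvd_diff)
  from assms[OF this] show "ee (of_int (a * (p * j + (h + k))\<^sup>2) / of_int c)
      = \<rho> * ee (of_int (a * (p * j + h)\<^sup>2) / of_int c)"
    by (simp only: add.assoc)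
qed

lemma cusp_sum_cong:
  assumes "c \<noteq> 0" "[h = h'] (mod p)"
  shows "cusp_sum p a c h = cusp_sum p a c h'"
proof -
  obtain k where k: "h' = h + p * k" using assms(2) cong_iff_lin by blast
  have "cusp_sum p a c h' = (\<Sum>j\<in>{0..<\<bar>c\<bar>}. ee (of_int (a * (p * (j + k) + h)\<^sup>2) / of_int c))"
    unfolding cusp_sum_def k
        by (intro sum.cong refl) (simp only: distrib_left add.assoc add.commute[of h])
  also have "\<dots> = cusp_sum p a c h"
    unfolding cusp_sum_def
  proof (rule sum_periodic_shift[of "\<bar>c\<bar>" "\<lambda>j. ee (of_int (a * (p * j + h)\<^sup>2) / of_int c)"])
    fix j
    have "[p * (j + \<bar>c\<bar>) + h = p * j + h] (mod c)" by (simp add: cong_iff_dvd_diff algebra_simps)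
    then show "ee (of_int (a * (p * (j + \<bar>c\<bar>) + h)\<^sup>2) / of_int c)
        = ee (of_int (a * (p * j + h)\<^sup>2) / of_int c)"
      by (intro ee_cong cong_mult cong_pow) auto
  qed (use assms(1) in simp)
  finally show ?thesis by simp
qed

lemma ee_square_shift:
  fixes a x k c q n :: int
  assumes "c \<noteq> 0" "q \<noteq> 0" "q * (a * (2 * x * k + k\<^sup>2)) = c * n"
  shows "ee (of_int (a * (x + k)\<^sup>2) / of_int c)
      = ee (of_int n / of_int q) * ee (of_int (a * x\<^sup>2) / of_int c)"
proof -
  have "(of_int (q * (a * (2 * x * k + k\<^sup>2))) :: complex) = of_int (c * n)" using assms(3) by simp
  then have "(of_int (a * (2 * x * k + k\<^sup>2)) / of_int c :: complex) = of_int n / of_int q"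
    using assms(1,2) by (simp add: frac_eq_eq mult.commute)
  moreover have "a * (x + k)\<^sup>2 = a * (2 * x * k + k\<^sup>2) + a * x\<^sup>2"
      by (simp add: power2_eq_square algebra_simps)
  ultimately show ?thesis by (simp only: ee_add[symmetric] of_int_add add_divide_distrib)
qed

text \<open>Every class modulo \<open>p\<close> contains a multiple of \<open>c\<close>, and
  shifting by it leaves the summands unchanged.\<close>

lemma cusp_sum_coprime:
  fixes p c :: int
  assumes "c \<noteq> 0" "coprime p c"
  shows "cusp_sum p a c h = cusp_sum p a c 0"
proof -
  obtain u v where uv: "u * p + v * c = 1" using bezout_int[of p c] assms(2) by auto
  have "cusp_sum p a c (0 + c * (v * h)) = 1 * cusp_sum p a c 0"
  proof (rule cusp_sum_shift)
    fix x
    show "ee (of_int (a * (x + c * (v * h))\<^sup>2) / of_int c) = 1 * ee (of_int (a * x\<^sup>2) / of_int c)"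
      unfolding mult_1 by (intro ee_cong cong_mult cong_pow) (auto simp: cong_iff_dvd_diff)
  qed
  moreover have "[0 + c * (v * h) = h] (mod p)"
  proof -
    have "0 + c * (v * h) - h = - (p * (u * h))" using uv
        by (simp add: algebra_simps) (metis add.commute distrib_left mult.assoc mult.commute mult_1)
    then show ?thesis by (simp add: cong_iff_dvd_diff)
  qed
  ultimately show ?thesis using cusp_sum_cong[OF assms(1)] by simp
qed

text \<open>With \<open>y\<close> inverse to \<open>m\<close> modulo \<open>p\<close>, the shift by
  \<open>m * y * h\<close> leads from class 0 to class \<open>h\<close>. On multiples of
  \<open>p\<close> the cross term disappears, leaving a phase quadratic in \<open>h\<close>.\<close>

lemma cusp_sum_once_divisible:
  fixes p m :: int
  assumes "p > 0" "m \<noteq> 0" "coprime p m"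
  obtains u where "\<And>h. cusp_sum p a (p * m) h = ee (of_int (u * h\<^sup>2) / of_int p)
      * cusp_sum p a (p * m) 0"
proof -
  obtain x y where xy: "x * p + y * m = 1" using bezout_int[of p m] assms(3) by auto
  have c: "p * m \<noteq> 0" using assms by simp
  have "cusp_sum p a (p * m) h = ee (of_int ((a * m * y\<^sup>2) * h\<^sup>2) / of_int p)
      * cusp_sum p a (p * m) 0" for h
  proof -
    let ?s = "y * h"
    have "cusp_sum p a (p * m) (0 + m * ?s) = ee (of_int ((a * m * y\<^sup>2) * h\<^sup>2) / of_int p)
        * cusp_sum p a (p * m) 0"
    proof (rule cusp_sum_shift)
      fix z assume z: "[z = 0] (mod p)"
      have "ee (of_int (a * (z + m * ?s)\<^sup>2) / of_int (p * m))
          = ee (of_int (a * (2 * z * ?s + m * ?s\<^sup>2)) / of_int p) * ee (of_int (a * z\<^sup>2) / of_int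
          (p * m))"
        using c assms by (intro ee_square_shift) (auto simp: power2_eq_square algebra_simps)
      moreover have "[a * (2 * z * ?s + m * ?s\<^sup>2) = (a * m * y\<^sup>2) * h\<^sup>2] (mod p)"
      proof -
        have "a * (2 * z * ?s + m * ?s\<^sup>2) - (a * m * y\<^sup>2) * h\<^sup>2 = z * (2 * a * ?s)"
          by (simp add: power2_eq_square algebra_simps)
        then show ?thesis using z by (simp add: cong_iff_dvd_diff)
      qed
      ultimately show "ee (of_int (a * (z + m * ?s)\<^sup>2) / of_int (p * m))
          = ee (of_int ((a * m * y\<^sup>2) * h\<^sup>2) / of_int p) * ee (of_int (a * z\<^sup>2) / of_int (p * m))"
        using ee_cong by metis
    qed
    moreover have "[0 + m * ?s = h] (mod p)"
    proof -
      have "y * m = 1 - x * p" using xy by simp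
      then have "0 + m * ?s - h = - (p * (x * h))"
          by (simp add: algebra_simps) (metis add.commute distrib_left mult.assoc mult.commute
          mult_1 xy)
      then show ?thesis by (simp add: cong_iff_dvd_diff)
    qed
    ultimately show ?thesis using cusp_sum_cong[OF c] by metis
  qed
  then show ?thesis by (rule that)
qed

text \<open>The shift by \<open>c / p\<close> stays in the class, yet multiplies the sum by
  \<open>ee (2 * a * h / p)\<close>, which is not 1 for odd \<open>p\<close>.\<close>

lemma cusp_sum_square_divides:
  fixes p :: int
  assumes p: "prime p" "odd p" and "c \<noteq> 0" "p\<^sup>2 dvd c" "coprime a c" "\<not> p dvd h"
  shows "cusp_sum p a c h = 0"
proof -
  obtain n where n: "c = p\<^sup>2 * n" using assms(4) by (elim dvdE)
  have p0: "p \<noteq> 0" "p > 2" using p prime_ge_2_int[of p] by (auto simp: le_less)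
  define m where "m = p * n"
  have c: "c = p * m" by (simp add: n m_def power2_eq_square)
  have "cusp_sum p a c (h + m) = ee (of_int (2 * a * h) / of_int p) * cusp_sum p a c h"
  proof (rule cusp_sum_shift)
    fix x assume x: "[x = h] (mod p)"
    have "ee (of_int (a * (x + m)\<^sup>2) / of_int c) = ee (of_int (a * (2 * x + m)) / of_int p)
        * ee (of_int (a * x\<^sup>2) / of_int c)"
      using assms(3) p0 by (intro ee_square_shift) (auto simp: c power2_eq_square algebra_simps)
    moreover have "[a * (2 * x + m) = 2 * a * h] (mod p)"
    proof -
      have "a * (2 * x + m) - 2 * a * h = (x - h) * (2 * a) + p * (n * a)"
        by (simp add: m_def algebra_simps)
      then show ?thesis using x by (simp add: cong_iff_dvd_diff)
    qed
    ultimately show "ee (of_int (a * (x + m)\<^sup>2) / of_int c) = ee (of_int (2 * a * h) / of_int p)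
        * ee (of_int (a * x\<^sup>2) / of_int c)"
      using ee_cong by metis
  qed
  moreover have "cusp_sum p a c (h + m) = cusp_sum p a c h"
    by (rule cusp_sum_cong[OF assms(3)]) (simp add: m_def cong_iff_dvd_diff)
  moreover have "ee (of_int (2 * a * h) / of_int p) \<noteq> 1"
  proof -
    have "\<not> p dvd a"
    proof
      assume "p dvd a"
      moreover have "p dvd c" by (simp add: c)
      ultimately have "is_unit p" using assms(5) coprime_common_divisor by blast
      then show False using p not_prime_unit by blast
    qed
    moreover have "\<not> p dvd 2" using p0 zdvd_imp_le[of p 2] by auto
    ultimately have "\<not> p dvd 2 * a * h" using p assms(6) by (simp add: prime_dvd_mult_iff)
    then show ?thesis using ee_eq_1_iff[OF p0(1), of "2 * a * h"] by blast
  qed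
  ultimately show ?thesis by (metis mult_cancel_right1)
qed

text \<open>The shift by the odd number \<open>m\<close> leads from even to odd \<open>x\<close>; on
  even \<open>x\<close> the cross term is divisible by 4, so a phase modulo 4 remains.\<close>

lemma cusp_sum_2_4:
  fixes m :: int
  assumes "odd m" "h \<in> {0, 1}"
  shows "cusp_sum 2 a (4 * m) h = ee (of_int ((a * m) * h\<^sup>2) / of_int 4) * cusp_sum 2 a (4 * m) 0"
proof (cases "h = 0")
  case False
  then have h: "h = 1" using assms by simp
  have m0: "m \<noteq> 0" using assms by auto
  have "cusp_sum 2 a (4 * m) (0 + m) = ee (of_int (a * m) / of_int 4) * cusp_sum 2 a (4 * m) 0"
  proof (rule cusp_sum_shift)
    fix z :: int assume "[z = 0] (mod 2)"
    then obtain y where y: "z = 2 * y" by (auto simp: cong_0_iff elim!: dvdE)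
    have "ee (of_int (a * (z + m)\<^sup>2) / of_int (4 * m)) = ee (of_int (a * (2 * z + m)) / of_int 4)
        * ee (of_int (a * z\<^sup>2) / of_int (4 * m))"
      using m0 by (intro ee_square_shift) (auto simp: power2_eq_square algebra_simps)
    moreover have "[a * (2 * z + m) = a * m] (mod 4)"
      by (simp add: y cong_iff_dvd_diff algebra_simps)
    ultimately show "ee (of_int (a * (z + m)\<^sup>2) / of_int (4 * m))
        = ee (of_int (a * m) / of_int 4) * ee (of_int (a * z\<^sup>2) / of_int (4 * m))"
      using ee_cong by metis
  qed
  moreover have "[0 + m = 1] (mod 2)" using assms(1) by (simp add: cong_def odd_iff_mod_2_eq_one)
  ultimately show ?thesis using cusp_sum_cong[of "4 * m"] m0 h by simp
qed simp

text \<open>The shift by \<open>2 * m\<close> preserves parity and, for odd \<open>h + m\<close>,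
  changes the sign of every summand.\<close>

lemma cusp_sum_2_8:
  fixes m :: int
  assumes "m \<noteq> 0" "odd a" "odd (h + m)"
  shows "cusp_sum 2 a (8 * m) h = 0"
proof -
  have "cusp_sum 2 a (8 * m) (h + 2 * m) = - 1 * cusp_sum 2 a (8 * m) h"
  proof (rule cusp_sum_shift)
    fix x :: int assume x: "[x = h] (mod 2)"
    have "ee (of_int (a * (x + 2 * m)\<^sup>2) / of_int (8 * m)) = ee (of_int (a * (x + m)) / of_int 2)
        * ee (of_int (a * x\<^sup>2) / of_int (8 * m))"
      using assms by (intro ee_square_shift) (auto simp: power2_eq_square algebra_simps)
    moreover have "[a * (x + m) = 1] (mod 2)"
    proof -
      have "odd (x + m)" using x assms(3) by (simp add: cong_def) presburger
      then have "odd (a * (x + m))" using assms(2) by simp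
      then show ?thesis unfolding cong_def by (simp only: odd_iff_mod_2_eq_one) simp
    qed
    moreover have "ee (of_int 1 / of_int 2) = - 1"
      by (simp add: ee_def)
    ultimately show "ee (of_int (a * (x + 2 * m)\<^sup>2) / of_int (8 * m))
        = - 1 * ee (of_int (a * x\<^sup>2) / of_int (8 * m))"
      using ee_cong by metis
  qed
  moreover have "cusp_sum 2 a (8 * m) (h + 2 * m) = cusp_sum 2 a (8 * m) h"
    using assms by (intro cusp_sum_cong) (auto simp: cong_iff_dvd_diff)
  ultimately show ?thesis by simp
qed

text \<open>All summands coincide, which yields Gauss sums that are visibly non-zero.\<close>

lemma cusp_sum_eq_single:
  assumes "c > 0" "\<And>j. [(p * j + h)\<^sup>2 = h\<^sup>2] (mod c)"
  shows "cusp_sum p a c h = of_int c * ee (of_int (a * h\<^sup>2) / of_int c)"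
proof -
  have "ee (of_int (a * (p * j + h)\<^sup>2) / of_int c) = ee (of_int (a * h\<^sup>2) / of_int c)" for j
    by (intro ee_cong cong_mult assms(2)) simp
  then show ?thesis unfolding cusp_sum_def using assms(1) by simp
qed

section \<open>From Gauss sums to linear conditions on \<open>f\<close>\<close>

lemma prod_cusp_sum_eq:
  fixes r :: "int^'n"
  assumes "\<And>i. cusp_sum p a c (r $ i) = ee (of_int (u * (r $ i)\<^sup>2) / of_int q) * K"
  shows "(\<Prod>i\<in>UNIV. cusp_sum p a c (r $ i)) = ee (of_int (u * Q r) / of_int q) * K ^ CARD('n)"
proof -
  have "(of_int (u * Q r) / of_int q :: complex) = (\<Sum>i\<in>UNIV. of_int (u * (r $ i)\<^sup>2) / of_int q)"
    by (simp add: Q_def sum_distrib_left sum_divide_distrib)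
  then show ?thesis unfolding assms prod.distrib by (simp add: ee_sum)
qed

lemma cusp_value_eq:
  fixes f :: "int^'n \<Rightarrow> complex"
  assumes "\<And>h. 0 \<le> h \<Longrightarrow> h < int p \<Longrightarrow> cusp_sum (int p) a c h = ee (of_int (u * h\<^sup>2) / of_int q) * K"
  shows "cusp_value p f a c
      = K ^ CARD('n) * (\<Sum>r\<in>residue_vectors p. f r * ee (of_int (u * Q r) / of_int q))"
  unfolding cusp_value_def sum_distrib_left
proof (intro sum.cong refl)
  fix r :: "int^'n" assume "r \<in> residue_vectors p"
  then have "\<And>i. cusp_sum (int p) a c (r $ i) = ee (of_int (u * (r $ i)\<^sup>2) / of_int q) * K"
    by (intro assms) (auto simp: residue_vectors_def)
  from prod_cusp_sum_eq[OF this]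
  show "f r * (\<Prod>i\<in>UNIV. cusp_sum (int p) a c (r $ i))
      = K ^ CARD('n) * (f r * ee (of_int (u * Q r) / of_int q))"
    by simp
qed

text \<open>Finite Fourier inversion for the distribution of the values of \<open>Q\<close> modulo
  \<open>q\<close>, weighted by \<open>f\<close>.\<close>

lemma weighted_sums_vanish_iff:
  fixes f :: "int^'n \<Rightarrow> complex"
  assumes q: "q > 0"
  shows "(\<forall>u. (\<Sum>r\<in>residue_vectors p. f r * ee (of_int (u * Q r) / of_int q)) = 0) \<longleftrightarrow>
     (\<forall>b\<in>{0..<q}. (\<Sum>r\<in>{r \<in> residue_vectors p. [Q r = b] (mod q)}. f r) = 0)"
proof (intro iffI allI ballI)
  fix b
  assume all: "\<forall>u. (\<Sum>r\<in>residue_vectors p. f r * ee (of_int (u * Q r) / of_int q)) = 0"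
  \<comment> \<open>Summing against the inverse character selects the vectors with
    \<open>Q r\<close> congruent to \<open>b\<close>.\<close>
  have "0 = (\<Sum>u\<in>{0..<q}. ee (of_int (- (u * b)) / of_int q) * (\<Sum>r\<in>residue_vectors p. f r
      * ee (of_int (u * Q r) / of_int q)))"
    using all by simp
  also have "\<dots> = (\<Sum>u\<in>{0..<q}. \<Sum>r\<in>residue_vectors p. f r * ee (of_int (u * (Q r - b)) / of_int q))"
  proof (intro sum.cong refl)
    fix u
    have "ee (of_int (- (u * b)) / of_int q) * ee (of_int (u * m) / of_int q)
        = ee (of_int (u * (m - b)) / of_int q)" for m
      unfolding ee_add[symmetric] by (simp add: diff_divide_distrib algebra_simps)
    then show "ee (of_int (- (u * b)) / of_int q) * (\<Sum>r\<in>residue_vectors p. f r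
        * ee (of_int (u * Q r) / of_int q)) =
       (\<Sum>r\<in>residue_vectors p. f r * ee (of_int (u * (Q r - b)) / of_int q))"
      by (simp only: sum_distrib_left mult.left_commute)
  qed
  also have "\<dots> = (\<Sum>r\<in>residue_vectors p. f r * (\<Sum>u\<in>{0..<q}. ee (of_int (u * (Q r - b)) / of_int q)))"
    by (subst sum.swap) (simp only: sum_distrib_left)
  also have "\<dots> = (\<Sum>r\<in>{r \<in> residue_vectors p. [Q r = b] (mod q)}. f r * of_int q)"
    unfolding sum_ee_orthogonality[OF q]
    by (rule sum.mono_neutral_cong_right[OF finite_residue_vectors]) (auto simp: cong_iff_dvd_diff)
  finally show "(\<Sum>r\<in>{r \<in> residue_vectors p. [Q r = b] (mod q)}. f r) = 0"
    using q by (simp flip: sum_distrib_right)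
next
  fix u
  assume all: "\<forall>b\<in>{0..<q}. (\<Sum>r\<in>{r \<in> residue_vectors p. [Q r = b] (mod q)}. f r) = 0"
  have "(\<Sum>r\<in>residue_vectors p. f r * ee (of_int (u * Q r) / of_int q)) =
    (\<Sum>b\<in>{0..<q}. \<Sum>r\<in>{r \<in> residue_vectors p. Q r mod q = b}. f r * ee (of_int (u * Q r) / of_int q))"
    using q by (intro sum.group[symmetric] finite_residue_vectors) auto
  also have "\<dots> = (\<Sum>b\<in>{0..<q}. \<Sum>r\<in>{r \<in> residue_vectors p. [Q r = b] (mod q)}. f r
      * ee (of_int (u * b) / of_int q))"
  proof (intro sum.cong refl)
    fix b assume "b \<in> {0..<q}"
    then show "{r \<in> residue_vectors p. Q r mod q = b} = {r \<in> residue_vectors p. [Q r = b] (mod q)}"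
      by (auto simp: cong_def)
    fix r :: "int^'n" assume "r \<in> {r \<in> residue_vectors p. [Q r = b] (mod q)}"
    then have "[u * Q r = u * b] (mod q)" by (intro cong_mult) auto
    then show "f r * ee (of_int (u * Q r) / of_int q) = f r * ee (of_int (u * b) / of_int q)"
      using ee_cong by metis
  qed
  also have "\<dots> = 0" using all by (simp flip: sum_distrib_right)
  finally show "(\<Sum>r\<in>residue_vectors p. f r * ee (of_int (u * Q r) / of_int q)) = 0" .
qed

text \<open>The cusp is \<open>u / q\<close> in lowest terms. By \<open>sq\<close> squares are
  constant modulo \<open>c\<close> on each class, so the factor in front of the weighted sum is a
  power of \<open>c\<close>, hence non-zero.\<close>

lemma weighted_sum_vanishes:
  fixes f :: "int^'n \<Rightarrow> complex"
  assumes "p > 0" "q > 0" and sq: "\<And>j h. [(int p * j + h)\<^sup>2 = h\<^sup>2] (mod q)"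
    and cusps: "\<And>a c. c \<noteq> 0 \<Longrightarrow> coprime a c \<Longrightarrow> cusp_value p f a c = 0"
  shows "(\<Sum>r\<in>residue_vectors p. f r * ee (of_int (u * Q r) / of_int q)) = 0"
proof -
  define d where "d = gcd u q"
  have d: "d > 0" using assms(2) by (simp add: d_def)
  obtain a c where ac: "u = a * d" "q = c * d" "coprime a c"
    using gcd_coprime_exists[of u q] d unfolding d_def by (metis less_irrefl)
  have c: "c > 0" using ac(2) assms(2) d by (simp add: zero_less_mult_iff)
  have eq: "ee (of_int (a * m) / of_int c) = ee (of_int (u * m) / of_int q)" for m
    using d by (simp add: ac)
  have "cusp_value p f a c
      = of_int c ^ CARD('n) * (\<Sum>r\<in>residue_vectors p. f r * ee (of_int (u * Q r) / of_int q))"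
  proof (rule cusp_value_eq)
    fix h :: int
    have "[(int p * j + h)\<^sup>2 = h\<^sup>2] (mod c)" for j
      using sq[of j h] by (rule cong_dvd_modulus) (simp add: ac)
    from cusp_sum_eq_single[OF c this] show "cusp_sum (int p) a c h
        = ee (of_int (u * h\<^sup>2) / of_int q) * of_int c"
      by (simp only: eq mult.commute)
  qed
  then show ?thesis using cusps[of c a] ac(3) c by simp
qed

text \<open>The square of an integer modulo 4 depends only on its parity, so a residue vector can
  serve as its own lift.\<close>

lemma X_two_eq: "X_two b = {r \<in> residue_vectors 2. [Q r = b] (mod 4)}"
proof -
  have A: "[Q y = Q x] (mod 4)" if "reduce 2 y = x" for x y :: "int^'n"
    unfolding Q_def
  proof (rule cong_sum)
    fix i
    have "x $ i = y $ i mod 2" using that by (auto simp: reduce_def)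
    then have "y $ i = x $ i + 2 * (y $ i div 2)" by simp
    then obtain k where "y $ i = x $ i + 2 * k" by blast
    then have "(y $ i)\<^sup>2 - (x $ i)\<^sup>2 = 4 * (x $ i * k + k\<^sup>2)"
        by (simp add: power2_eq_square algebra_simps)
    then show "[(y $ i)\<^sup>2 = (x $ i)\<^sup>2] (mod 4)" by (simp add: cong_iff_dvd_diff)
  qed
  have B: "reduce 2 x = x" if "x \<in> residue_vectors 2" for x :: "int^'n"
    using that by (auto simp: reduce_def residue_vectors_def vec_eq_iff)
  have "(\<exists>y. reduce 2 y = x \<and> [Q y = b] (mod 4)) \<longleftrightarrow> [Q x = b] (mod 4)" if "x \<in> residue_vectors 2"
      for x :: "int^'n"
  proof
    assume "\<exists>y. reduce 2 y = x \<and> [Q y = b] (mod 4)"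
    then obtain y where y: "reduce 2 y = x" "[Q y = b] (mod 4)" by blast
    show "[Q x = b] (mod 4)" using cong_trans[OF cong_sym[OF A[OF y(1)]] y(2)] .
  qed (use B[OF that] in blast)
  then show ?thesis unfolding X_two_def by blast
qed

lemma cusp_value_eq_single:
  fixes f :: "int^'n \<Rightarrow> complex"
  assumes "\<And>h. 0 \<le> h \<Longrightarrow> h < int p \<Longrightarrow> h \<noteq> h0 \<Longrightarrow> cusp_sum (int p) a c h = 0"
    and "0 \<le> h0" "h0 < int p"
  shows "cusp_value p f a c = f (\<chi> i. h0) * cusp_sum (int p) a c h0 ^ CARD('n)"
proof -
  have "cusp_value p f a c = (\<Sum>r\<in>{\<chi> i. h0}. f r * (\<Prod>i\<in>UNIV. cusp_sum (int p) a c (r $ i)))"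
    unfolding cusp_value_def
  proof (rule sum.mono_neutral_right[OF finite_residue_vectors])
    show "\<forall>r\<in>residue_vectors p - {\<chi> i. h0}. f r * (\<Prod>i\<in>UNIV. cusp_sum (int p) a c (r $ i)) = 0"
    proof
      fix r :: "int^'n" assume r: "r \<in> residue_vectors p - {\<chi> i. h0}"
      then obtain i where "r $ i \<noteq> h0" by (auto simp: vec_eq_iff)
      then have "cusp_sum (int p) a c (r $ i) = 0" using r
          by (intro assms(1)) (auto simp: residue_vectors_def)
      then show "f r * (\<Prod>i\<in>UNIV. cusp_sum (int p) a c (r $ i)) = 0" by auto
    qed
  qed (use assms in \<open>auto simp: residue_vectors_def\<close>)
  then show ?thesis by simp
qed

text \<open>The argument of \<open>cusp_sum_square_divides\<close> fails for \<open>p = 2\<close>,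
  as \<open>2 * a * h\<close> is then divisible by \<open>p\<close>. Hence phases modulo 4 occur,
  and concentration on one class starts only when 8 divides \<open>c\<close>.\<close>

theorem theta_cusp_form_two_iff:
  fixes f :: "int^'n \<Rightarrow> complex"
  shows "cusp_form CARD('n) Gamma_two (theta 2 f) \<longleftrightarrow>
    (\<forall>a\<in>{0..<4}. (\<Sum>x\<in>X_two a. f x) = 0) \<and> f (\<chi> i. 1) = 0 \<and> f (\<chi> i. 0) = 0"
proof -
  have "g \<in> SL2Z \<and> 4 * (int 2)\<^sup>2 dvd g $ 2 $ 1 \<and> (g $ 2 $ 2) mod 4 = 1
      \<and> [g $ 1 $ 1 = g $ 2 $ 2] (mod int 2)"
    if "g \<in> Gamma_two" for g
  proof -
    have "[g $ 1 $ 1 = g $ 2 $ 2] (mod 4)" "[g $ 2 $ 2 = 1] (mod 4)"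
      using that cong_sym cong_trans unfolding Gamma_two_def by blast+
    moreover from this(1) have "[g $ 1 $ 1 = g $ 2 $ 2] (mod 2)" by (rule cong_dvd_modulus) simp
    ultimately show ?thesis using that by (auto simp: Gamma_two_def cong_0_iff cong_def)
  qed
  then have "cusp_form CARD('n) Gamma_two (theta 2 f) \<longleftrightarrow>
     f (\<chi> i. 0) = 0 \<and> (\<forall>a c. c \<noteq> 0 \<longrightarrow> coprime a c \<longrightarrow> cusp_value 2 f a c = 0)"
    by (intro cusp_form_theta_iff) auto
  also have "\<dots> \<longleftrightarrow> (\<forall>a\<in>{0..<4}. (\<Sum>x\<in>X_two a. f x) = 0) \<and> f (\<chi> i. 1) = 0 \<and> f (\<chi> i. 0) = 0"
    unfolding X_two_eq weighted_sums_vanish_iff[of 4, symmetric, simplified]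
  proof (intro iffI conjI allI impI; (elim conjE)?)
    assume all: "\<forall>a c. c \<noteq> 0 \<longrightarrow> coprime a c \<longrightarrow> cusp_value 2 f a c = 0"
    have "[(2 * j + h)\<^sup>2 = h\<^sup>2] (mod 4)" for j h :: int
    proof -
      have "(2 * j + h)\<^sup>2 - h\<^sup>2 = 4 * (j\<^sup>2 + j * h)" by (simp add: power2_eq_square algebra_simps)
      then show ?thesis by (simp add: cong_iff_dvd_diff)
    qed
    then show "(\<Sum>r\<in>residue_vectors 2. f r * ee (of_int u * of_int (Q r) / 4)) = 0" for u
      using weighted_sum_vanishes[of 2 4 f u] all by simp
    \<comment> \<open>At the cusp 1/8 the even class cancels, isolating the all-ones vector; odd
      squares are 1 modulo 8, so the remaining Gauss sum is non-zero.\<close>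
    have "cusp_value 2 f 1 8 = f (\<chi> i. 1) * cusp_sum (int 2) 1 8 1 ^ CARD('n)"
    proof (rule cusp_value_eq_single)
      fix h assume "0 \<le> h" "h < int 2" "h \<noteq> 1"
      then have "h = 0" by simp
      then show "cusp_sum (int 2) 1 8 h = 0" using cusp_sum_2_8[of 1 1 h] by simp
    qed auto
    moreover have "cusp_sum 2 1 8 1 = of_int 8 * ee (of_int (1 * 1\<^sup>2) / of_int 8)"
    proof (rule cusp_sum_eq_single)
      fix j :: int
      have "even (j * (j + 1))" by simp
      then obtain k where "j * (j + 1) = 2 * k" by (elim evenE)
      then have "(2 * j + 1)\<^sup>2 - 1\<^sup>2 = 8 * k" by (simp add: power2_eq_square algebra_simps)
      then show "[(2 * j + 1)\<^sup>2 = 1\<^sup>2] (mod 8)" by (simp add: cong_iff_dvd_diff)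
    qed simp
    moreover have "cusp_value 2 f 1 8 = 0" using all by simp
    ultimately show "f (\<chi> i. 1) = 0" by simp
  next
    fix a c :: int
    assume W: "\<forall>u. (\<Sum>r\<in>residue_vectors 2. f r * ee (of_int u * of_int (Q r) / 4)) = 0"
      and f1: "f (\<chi> i. 1) = 0" and f0: "f (\<chi> i. 0) = 0" and c: "c \<noteq> 0" "coprime a c"
    \<comment> \<open>Covers every cusp where the Gauss sums share a quadratic phase modulo
      4.\<close>
    have W': "cusp_value 2 f a c = 0"
      if "\<And>h. h \<in> {0, 1} \<Longrightarrow> cusp_sum 2 a c h = ee (of_int (u * h\<^sup>2) / of_int 4) * cusp_sum 2 a c 0"
          for u
    proof -
      have "cusp_value 2 f a c
          = cusp_sum 2 a c 0 ^ CARD('n) * (\<Sum>r\<in>residue_vectors 2. f r * ee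
          (of_int (u * Q r) / of_int 4))"
      proof (rule cusp_value_eq)
        fix h assume "0 \<le> h" "h < int 2"
        then have "h \<in> {0, 1}" by auto
        from that[OF this] show "cusp_sum (int 2) a c h = ee (of_int (u * h\<^sup>2) / of_int 4)
            * cusp_sum 2 a c 0"
          by (simp only: of_nat_numeral)
      qed
      then show ?thesis using W by simp
    qed
    consider "odd c" | m where "c = 2 * m" "odd m" | m where "c = 4 * m" "odd m" | m
        where "c = 8 * m"
    proof -
      have "odd c \<or> (\<exists>m. c = 2 * m \<and> odd m) \<or> (\<exists>m. c = 4 * m \<and> odd m) \<or> (\<exists>m. c = 8 * m)"
          by presburger
      then show ?thesis using that by blast
    qed
    then show "cusp_value 2 f a c = 0"
    proof cases
      case 1
      then have cop: "coprime 2 c" by simp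
      show ?thesis by (rule W'[of 0], subst cusp_sum_coprime[OF c(1) cop]) simp
    next
      case (2 m)
      then have "m \<noteq> 0" "coprime 2 m" using c by auto
      then obtain u
          where u: "\<And>h. cusp_sum 2 a c h = ee (of_int (u * h\<^sup>2) / of_int 2) * cusp_sum 2 a c 0"
        using cusp_sum_once_divisible[of 2 m a] 2 by auto
      \<comment> \<open>A phase modulo 2 is rewritten modulo 4 to fit \<open>W'\<close>.\<close>
      have "ee (of_int (u * h\<^sup>2) / of_int 2) = ee (of_int (2 * u * h\<^sup>2) / of_int 4)" for h by simp
      with u show ?thesis by (intro W'[of "2 * u"]) metis
    next
      case (3 m)
      show ?thesis unfolding 3(1)
        by (rule W'[of "a * m", unfolded 3(1)], rule cusp_sum_2_4[OF 3(2)])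
    next
      case (4 m)
      have "odd a" using coprime_common_divisor[OF c(2), of 2] 4 by auto
      then have m: "m \<noteq> 0" "odd a" using c 4 by auto
      \<comment> \<open>The surviving class has the parity of \<open>m\<close>: it is 1 if 8 divides
        \<open>c\<close> exactly, and 0 if 16 divides \<open>c\<close>.\<close>
      define h0 where "h0 = (if odd m then 1 else 0 :: int)"
      have "cusp_value 2 f a c = f (\<chi> i. h0) * cusp_sum (int 2) a c h0 ^ CARD('n)"
      proof (rule cusp_value_eq_single)
        fix h assume h: "0 \<le> h" "h < int 2" "h \<noteq> h0"
        then have "h = 0 \<or> h = 1" by auto
        then have "odd (h + m)" using h(3) by (auto simp: h0_def split: if_splits)
        then show "cusp_sum (int 2) a c h = 0" using cusp_sum_2_8[of m a h] m 4 by simp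
      qed (auto simp: h0_def)
      then show ?thesis using f0 f1 by (simp add: h0_def split: if_splits)
    qed
  qed
  finally show ?thesis .
qed

text \<open>Cusps are sorted by the power of \<open>p\<close> in \<open>c\<close>: exponents 0 and 1
  give phases modulo \<open>p\<close>, trivial for exponent 0, and higher exponents see only the
  value of \<open>f\<close> at 0.\<close>

theorem theta_cusp_form_odd_iff:
  fixes f :: "int^'n \<Rightarrow> complex"
  assumes p: "prime p" "odd p"
  shows "cusp_form CARD('n) (Gamma_odd p) (theta p f) \<longleftrightarrow>
    (\<forall>a\<in>{0..<int p}. (\<Sum>x\<in>X_odd p a. f x) = 0) \<and> f (\<chi> i. 0) = 0"
proof -
  have p0: "p > 0" "prime (int p)" "odd (int p)" using p prime_gt_0_nat by auto
  have "g \<in> SL2Z \<and> 4 * (int p)\<^sup>2 dvd g $ 2 $ 1 \<and> (g $ 2 $ 2) mod 4 = 1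
      \<and> [g $ 1 $ 1 = g $ 2 $ 2] (mod int p)"
    if "g \<in> Gamma_odd p" for g
  proof -
    have "[g $ 1 $ 1 = g $ 2 $ 2] (mod 4 * int p)"
      using that cong_sym cong_trans unfolding Gamma_odd_def by blast
    then have "[g $ 1 $ 1 = g $ 2 $ 2] (mod int p)" by (rule cong_dvd_modulus) simp
    moreover have "[g $ 2 $ 2 = 1] (mod 4)"
      using that by (intro cong_dvd_modulus[of _ _ "4 * int p" 4]) (auto simp: Gamma_odd_def)
    ultimately show ?thesis using that by (auto simp: Gamma_odd_def cong_0_iff cong_def)
  qed
  then have "cusp_form CARD('n) (Gamma_odd p) (theta p f) \<longleftrightarrow>
     f (\<chi> i. 0) = 0 \<and> (\<forall>a c. c \<noteq> 0 \<longrightarrow> coprime a c \<longrightarrow> cusp_value p f a c = 0)"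
    using p by (intro cusp_form_theta_iff) auto
  also have "\<dots> \<longleftrightarrow> (\<forall>u. (\<Sum>r\<in>residue_vectors p. f r * ee (of_int (u * Q r) / of_int (int p))) = 0)
      \<and> f (\<chi> i. 0) = 0"
  proof (intro iffI conjI allI impI; (elim conjE)?)
    assume all: "\<forall>a c. c \<noteq> 0 \<longrightarrow> coprime a c \<longrightarrow> cusp_value p f a c = 0"
    have "[(int p * j + h)\<^sup>2 = h\<^sup>2] (mod int p)" for j h
      by (intro cong_pow) (simp add: cong_iff_dvd_diff)
    then show "(\<Sum>r\<in>residue_vectors p. f r * ee (of_int (u * Q r) / of_int (int p))) = 0" for u
      using weighted_sum_vanishes[of p "int p" f u] all p0 by simp
  next
    fix a c :: int
    assume W: "\<forall>u. (\<Sum>r\<in>residue_vectors p. f r * ee (of_int (u * Q r) / of_int (int p))) = 0"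
      and f0: "f (\<chi> i. 0) = 0" and c: "c \<noteq> 0" "coprime a c"
    have W': "cusp_value p f a c = 0"
      if "\<And>h. cusp_sum (int p) a c h = ee (of_int (u * h\<^sup>2) / of_int (int p))
          * cusp_sum (int p) a c 0" for u
      using cusp_value_eq[where f = f, OF that] W by simp
    consider "\<not> int p dvd c" | m where "c = int p * m" "\<not> int p dvd m" | "(int p)\<^sup>2 dvd c"
    proof (cases "int p dvd c")
      case True
      then obtain m where "c = int p * m" by (elim dvdE)
      then show ?thesis using that by (cases "int p dvd m") (auto simp: power2_eq_square)
    qed
    then show "cusp_value p f a c = 0"
    proof cases
      case 1
      then have cop: "coprime (int p) c" using p0 prime_imp_coprime by blast
      show ?thesis by (rule W'[of 0], subst cusp_sum_coprime[OF c(1) cop]) simp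
    next
      case (2 m)
      then have "m \<noteq> 0" "coprime (int p) m" using c prime_imp_coprime[OF p0(2), of m] by auto
      then obtain u
          where "\<And>h. cusp_sum (int p) a c h = ee (of_int (u * h\<^sup>2) / of_int (int p))
          * cusp_sum (int p) a c 0"
        using cusp_sum_once_divisible[of "int p" m a] 2 p0 by auto
      then show ?thesis by (rule W')
    next
      case 3
      have "cusp_value p f a c = f (\<chi> i. 0) * cusp_sum (int p) a c 0 ^ CARD('n)"
      proof (rule cusp_value_eq_single)
        fix h assume "0 \<le> h" "h < int p" "h \<noteq> 0"
        then have "\<not> int p dvd h" using zdvd_imp_le[of "int p" h] by auto
        then show "cusp_sum (int p) a c h = 0" using cusp_sum_square_divides[OF p0(2,3) c(1) 3 c(2)]
            by blast
      qed (use p0 in auto)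
      then show ?thesis using f0 by simp
    qed
  qed
  also have "\<dots> \<longleftrightarrow> (\<forall>a\<in>{0..<int p}. (\<Sum>x\<in>X_odd p a. f x) = 0) \<and> f (\<chi> i. 0) = 0"
    using weighted_sums_vanish_iff[of "int p" f p] p0 unfolding X_odd_def by simp
  finally show ?thesis .
qed

theorem theorem1p3:
  fixes p :: nat and f :: "int ^ 'n \<Rightarrow> complex"
  assumes "prime p"
  shows "(p = 2 \<longrightarrow>
            (cusp_form CARD('n) Gamma_two (theta p f) \<longleftrightarrow>
              (\<forall>a\<in>{0..<4}. (\<Sum>x\<in>X_two a. f x) = 0) \<and> f (\<chi> i. 1) = 0 \<and> f (\<chi> i. 0) = 0)) \<and>
         (odd p \<longrightarrow>
            (cusp_form CARD('n) (Gamma_odd p) (theta p f) \<longleftrightarrow>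
              (\<forall>a\<in>{0..<int p}. (\<Sum>x\<in>X_odd p a. f x) = 0) \<and> f (\<chi> i. 0) = 0))"
  using theta_cusp_form_two_iff[of f] theta_cusp_form_odd_iff[OF assms, of f] by simp

end
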